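(* Let $k\geq 2$ be an integer, let $L,M,t\geq 1$ be integers, and let $\psi$, $\varrho$ be Dirichlet characters mod $L$ and $M$, respectively, with $\psi(-1)\varrho(-1)=(-1)^k$. Assume $k>2$, or $k=2$ and $(\psi,\varrho)\neq(\mathbf{1}_L,\mathbf{1}_M)$. Put $$c_{2-k}^+(0,t,\psi,\varrho):=\begin{cases}\dfrac{2^{2-k}\pi\, i^{k-2}}{(tM)^{k-1}(k-1)}L(k-1,\overline{\psi})\prod_{p\mid M}(1-p^{-1}), & \text{if } \varrho=\mathbf{1}_M,\\ 0, & \text{if } \varrho\neq\mathbf{1}_M,\end{cases}$$ and for $n>0$ put $$c_{2-k}^+(n,t,\psi,\varrho):=\frac{2^{2-k}\pi\, i^{k-2}}{M^k(k-1)}W(\varrho^0)\, n^{1-k}\,\sigma_{k-1}^{\overline{\psi},\overline{\varrho}}\!\left(\frac{n}{t}\right).$$ Then the series $G_{2-k}^{\psi,\varrho,t}(z):=\sum_{n=0}^{\infty}c_{2-k}^+(n,t,\psi,\varrho)q^n$ is a mock modular form of weight $2-k$, level $tLM$ and character $\overline{\psi\varrho}$ with shadow $E_k^{\psi,\varrho,t}(z)$.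
   Context: Notation: $\mathbb{H}$ is the upper half-plane, $z=x+iy\in\mathbb{H}$, $q=e^{2\pi i z}$. For $N\geq1$, $\Gamma_0(N)=\{\pm\left(\begin{smallmatrix}a&b\\c&d\end{smallmatrix}\right)\in \mathrm{PSL}_2(\mathbb{Z}): c\equiv 0 \bmod N\}$. For an integer $j$ and a Dirichlet character $\chi$ mod $N$, a function $f:\mathbb{H}\to\mathbb{C}$ transforms with weight $j$, level $N$, character $\chi$ if $f(\gamma z)=\chi(d)(cz+d)^j f(z)$ for all $\gamma=\pm\left(\begin{smallmatrix}a&b\\c&d\end{smallmatrix}\right)\in\Gamma_0(N)$. $M_j(N,\chi)$ is the space of holomorphic such $f$ that are holomorphic at all cusps. $H_{2-k}(N,\chi)$ is the space of real-analytic $F:\mathbb{H}\to\mathbb{C}$ transforming with weight $2-k$, level $N$, character $\chi$, with $\Delta_{2-k}F=0$ where $\Delta_{2-k}=y^2(\partial_x^2+\partial_y^2)-i(2-k)y(\partial_x+i\partial_y)$, of at most linear exponential growth at the cusps, and such that $\xi_{2-k}F$ is holomorphic at every cusp, where $\xi_{2-k}:=2iy^{2-k}\overline{\partial_{\bar z}}$. Every $F\in H_{2-k}(N,\chi)$ has an expansion $F(z)=\sum_{n\geq n_0}c^+(n)q^n-\sum_{n\geq0}\overline{c(n)}\beta_{2-k}(n,y)q^{-n}$, where $\beta_{2-k}(n,y)=\int_y^\infty e^{-4\pi n u}u^{k-2}du$ for $n>0$, $\beta_{2-k}(0,y)=(1-k)^{-1}y^{k-1}$ if $k\neq1$ and $=-\log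 y$ if $k=1$; then $\xi_{2-k}F=\sum_{n\ge0}c(n)q^n$. A series $g=\sum c^+(n)q^n$ is a mock modular form of weight $2-k$, level $N$, character $\chi$ with shadow $f$ if it is the holomorphic part $\sum_{n\ge n_0} c^+(n)q^n$ of some $F\in H_{2-k}(N,\chi)$ with $\xi_{2-k}F=f$. Characters: $\mathbf{1}_N$ is the trivial character mod $N$. For a Dirichlet character $\chi$ mod $N$, $\chi^0$ is the primitive character inducing $\chi$, $m_\chi$ its conductor, $\ell_\chi:=N/m_\chi$, $W(\chi^0)=\sum_{n=1}^{m_\chi}\chi^0(n)e^{2\pi i n/m_\chi}$ its Gauss sum, and $L(s,\chi)=\sum_{n\ge1}\chi(n)n^{-s}$ (meromorphically continued). $\mu$ is the Möbius function. Any arithmetic function $f$ is set to $f(x)=0$ when $x$ is not a positive integer. For characters $\psi$ mod $L$ and $\varrho$ mod $M$, $$\sigma^{\psi,\varrho}_{k-1}(n):=\sum_{0<c\mid n}\psi\!\left(\tfrac{n}{c}\right)c^{k-1}\sum_{0<d\mid\gcd(\ell_\varrho,c)}d\,\mu\!\left(\tfrac{\ell_\varrho}{d}\right)\overline{\varrho^0}\!\left(\tfrac{\ell_\varrho}{d}\right)\varrho^0\!\left(\tfrac{c}{d}\right).$$ Eisenstein series: $C_k(\psi,\varrho):=L(k,\overline{\varrho})$ if $\psi=\mathbf{1}_1$ and $0$ otherwise. Under the hypotheses of the claim, $E_k^{\psi,\varrho}(z):=C_k(\psi,\varrho)+\left(-\frac{2\pi i}{M}\right)^k\frac{W(\overline{\varrho^0})}{(k-1)!}\sum_{n\ge1}\sigma^{\psi,\varrho}_{k-1}(n)q^n$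 and $E_k^{\psi,\varrho,t}(z):=E_k^{\psi,\varrho}(tz)$; this lies in $M_k(tLM,\psi\varrho)$. *)

theory Defs
  imports
    "HOL-Complex_Analysis.Complex_Analysis"
    "HOL-Computational_Algebra.Computational_Algebra"
begin

section \<open>Dirichlet characters, Gauss sums and L-functions\<close>

definition dirichlet_character :: "nat \<Rightarrow> (int \<Rightarrow> complex) \<Rightarrow> bool" where
  "dirichlet_character N \<eta> \<longleftrightarrow> N > 0 \<and>
     (\<forall>m n. \<eta> (m * n) = \<eta> m * \<eta> n) \<and>
     (\<forall>n. \<eta> (n + int N) = \<eta> n) \<and>
     (\<forall>n. \<eta> n \<noteq> 0 \<longleftrightarrow> coprime n (int N))"

definition trivial_char :: "nat \<Rightarrow> int \<Rightarrow> complex" where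
  "trivial_char N n = (if coprime n (int N) then 1 else 0)"

definition conj_char :: "(int \<Rightarrow> complex) \<Rightarrow> int \<Rightarrow> complex" where
  "conj_char \<eta> n = cnj (\<eta> n)"

text \<open>The product of the two characters, regarded as a character modulo \<open>N\<close>
  (any common multiple of the two moduli).\<close>

definition product_char :: "nat \<Rightarrow> (int \<Rightarrow> complex) \<Rightarrow> (int \<Rightarrow> complex) \<Rightarrow> int \<Rightarrow> complex" where
  "product_char N \<psi> \<rho> n = (if coprime n (int N) then \<psi> n * \<rho> n else 0)"

definition induces :: "nat \<Rightarrow> (int \<Rightarrow> complex) \<Rightarrow> nat \<Rightarrow> (int \<Rightarrow> complex) \<Rightarrow> bool" where
  "induces m \<eta>' N \<eta> \<longleftrightarrow> m dvd N \<and> dirichlet_character m \<eta>' \<and>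
     (\<forall>n. coprime n (int N) \<longrightarrow> \<eta> n = \<eta>' n)"

definition conductor :: "nat \<Rightarrow> (int \<Rightarrow> complex) \<Rightarrow> nat" where
  "conductor N \<eta> = (LEAST m. \<exists>\<eta>'. induces m \<eta>' N \<eta>)"

text \<open>The character \<open>\<eta>\<^sup>0\<close>; it is primitive because its modulus is minimal.\<close>

definition primitive_char :: "nat \<Rightarrow> (int \<Rightarrow> complex) \<Rightarrow> int \<Rightarrow> complex" where
  "primitive_char N \<eta> = (THE \<eta>'. induces (conductor N \<eta>) \<eta>' N \<eta>)"

text \<open>The number \<open>\<ell>\<^sub>\<eta>\<close>.\<close>

definition conductor_index :: "nat \<Rightarrow> (int \<Rightarrow> complex) \<Rightarrow> nat" where
  "conductor_index N \<eta> = N div conductor N \<eta>"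

text \<open>\<open>primitive_gauss_sum N \<eta>\<close> is \<open>W(\<eta>\<^sup>0)\<close> for a character \<open>\<eta>\<close> modulo \<open>N\<close>.\<close>

definition primitive_gauss_sum :: "nat \<Rightarrow> (int \<Rightarrow> complex) \<Rightarrow> complex" where
  "primitive_gauss_sum N \<eta> =
     (\<Sum>n = 1..conductor N \<eta>. primitive_char N \<eta> (int n) *
        exp (2 * of_real pi * \<i> * of_nat n / of_nat (conductor N \<eta>)))"

definition dirichlet_series :: "(int \<Rightarrow> complex) \<Rightarrow> complex \<Rightarrow> complex" where
  "dirichlet_series \<eta> s = (\<Sum>n. \<eta> (int (Suc n)) * of_nat (Suc n) powr (- s))"

text \<open>The meromorphic continuation of the Dirichlet series, evaluated at \<open>s\<close>: the value at \<open>s\<close> of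
  a meromorphic function on some right half-plane containing \<open>s\<close> that agrees with the series for
  real part greater than 1. By the identity theorem on (nested) half-planes the value does not
  depend on the choice of half-plane; at a pole the value is 0 by convention.\<close>

definition dirichlet_L :: "complex \<Rightarrow> (int \<Rightarrow> complex) \<Rightarrow> complex" where
  "dirichlet_L s \<eta> = (THE v. \<exists>b < Re s. \<exists>f.
     f nicely_meromorphic_on {w. Re w > b} \<and>
     (\<forall>w. Re w > max b 1 \<longrightarrow> f w = dirichlet_series \<eta> w) \<and> v = f s)"


section \<open>Twisted divisor sums and Eisenstein series\<close>

definition moebius :: "nat \<Rightarrow> int" where
  "moebius n = (if squarefree n then (-1) ^ card (prime_factors n) else 0)"

text \<open>\<open>divisor_sum k \<psi> M \<rho> n\<close> is \<open>\<sigma>\<^sub>k\<^sub>-\<^sub>1(n)\<close> with upper indices \<open>\<psi>\<close> and \<open>\<rho>\<close>, where \<open>\<rho>\<close> is a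
  character modulo \<open>M\<close>. Arithmetic functions vanish outside the positive integers.\<close>

definition divisor_sum ::
  "nat \<Rightarrow> (int \<Rightarrow> complex) \<Rightarrow> nat \<Rightarrow> (int \<Rightarrow> complex) \<Rightarrow> nat \<Rightarrow> complex" where
  "divisor_sum k \<psi> M \<rho> n = (if n = 0 then 0 else
     (\<Sum>c | c dvd n. \<psi> (int (n div c)) * of_nat c ^ (k - 1) *
       (\<Sum>d | d dvd gcd (conductor_index M \<rho>) c.
          of_nat d * of_int (moebius (conductor_index M \<rho> div d)) *
          cnj (primitive_char M \<rho> (int (conductor_index M \<rho> div d))) *
          primitive_char M \<rho> (int (c div d)))))"

definition eisenstein_const :: "nat \<Rightarrow> (int \<Rightarrow> complex) \<Rightarrow> (int \<Rightarrow> complex) \<Rightarrow> complex" where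
  "eisenstein_const k \<psi> \<rho> =
     (if \<psi> = trivial_char 1 then dirichlet_L (of_nat k) (conj_char \<rho>) else 0)"

text \<open>\<open>q_power n z\<close> is the \<open>n\<close>-th power of \<open>q = exp (2\<pi>\<i>z)\<close>.\<close>

definition q_power :: "int \<Rightarrow> complex \<Rightarrow> complex" where
  "q_power n z = exp (2 * of_real pi * \<i> * of_int n * z)"

definition eisenstein ::
  "nat \<Rightarrow> (int \<Rightarrow> complex) \<Rightarrow> nat \<Rightarrow> (int \<Rightarrow> complex) \<Rightarrow> complex \<Rightarrow> complex" where
  "eisenstein k \<psi> M \<rho> z = eisenstein_const k \<psi> \<rho> +
     (- (2 * of_real pi * \<i> / of_nat M)) ^ k * (primitive_gauss_sum M (conj_char \<rho>) / fact (k - 1)) *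
     (\<Sum>\<^sub>\<infinity>n\<in>{1..}. divisor_sum k \<psi> M \<rho> n * q_power (int n) z)"


section \<open>Harmonic Maass forms and mock modular forms\<close>

definition upper_half_plane :: "complex set" where
  "upper_half_plane = {z. Im z > 0}"

text \<open>The quantification over integer matrices of determinant 1 covers both signs of each element
  of \<open>PSL\<^sub>2(\<int>)\<close>.\<close>

definition transforms :: "int \<Rightarrow> nat \<Rightarrow> (int \<Rightarrow> complex) \<Rightarrow> (complex \<Rightarrow> complex) \<Rightarrow> bool" where
  "transforms j N \<eta> f \<longleftrightarrow>
     (\<forall>a b c d :: int. a * d - b * c = 1 \<longrightarrow> int N dvd c \<longrightarrow>
        (\<forall>z\<in>upper_half_plane.
           f ((of_int a * z + of_int b) / (of_int c * z + of_int d)) =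
           \<eta> d * (of_int c * z + of_int d) powi j * f z))"

definition slash :: "int \<Rightarrow> (complex \<Rightarrow> complex) \<Rightarrow> int \<Rightarrow> int \<Rightarrow> int \<Rightarrow> int \<Rightarrow> complex \<Rightarrow> complex" where
  "slash j f a b c d z =
     (of_int c * z + of_int d) powi (- j) * f ((of_int a * z + of_int b) / (of_int c * z + of_int d))"

text \<open>Every cusp is \<open>\<gamma>\<infinity>\<close> for some \<open>\<gamma>\<close> in \<open>SL\<^sub>2(\<int>)\<close>; a condition at all cusps is a condition at infinity
  on all the functions obtained from the slash operator.\<close>

definition holomorphic_at_cusps :: "int \<Rightarrow> (complex \<Rightarrow> complex) \<Rightarrow> bool" where
  "holomorphic_at_cusps j f \<longleftrightarrow>
     (\<forall>a b c d :: int. a * d - b * c = 1 \<longrightarrow>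
        (\<exists>h :: nat. h > 0 \<and> (\<exists>u :: nat \<Rightarrow> complex. \<forall>z\<in>upper_half_plane.
           ((\<lambda>n. u n * exp (2 * of_real pi * \<i> * of_nat n * z / of_nat h)) has_sum
              slash j f a b c d z) UNIV)))"

definition linear_exponential_growth_at_cusps :: "int \<Rightarrow> (complex \<Rightarrow> complex) \<Rightarrow> bool" where
  "linear_exponential_growth_at_cusps j f \<longleftrightarrow>
     (\<forall>a b c d :: int. a * d - b * c = 1 \<longrightarrow>
        (\<exists>A B y\<^sub>0 :: real. y\<^sub>0 > 0 \<and>
           (\<forall>z. Im z \<ge> y\<^sub>0 \<longrightarrow> norm (slash j f a b c d z) \<le> A * exp (B * Im z))))"

definition real_analytic_on :: "(complex \<Rightarrow> complex) \<Rightarrow> complex set \<Rightarrow> bool" where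
  "real_analytic_on f U \<longleftrightarrow>
     (\<forall>z\<in>U. \<exists>r > 0. \<exists>u :: nat \<times> nat \<Rightarrow> complex. \<forall>s t :: real.
        \<bar>s\<bar> < r \<longrightarrow> \<bar>t\<bar> < r \<longrightarrow>
        ((\<lambda>(m, n). u (m, n) * of_real s ^ m * of_real t ^ n) has_sum f (z + Complex s t)) UNIV)"

definition partial_x :: "(complex \<Rightarrow> complex) \<Rightarrow> complex \<Rightarrow> complex" where
  "partial_x f z = vector_derivative (\<lambda>s :: real. f (z + of_real s)) (at 0)"

definition partial_y :: "(complex \<Rightarrow> complex) \<Rightarrow> complex \<Rightarrow> complex" where
  "partial_y f z = vector_derivative (\<lambda>s :: real. f (z + \<i> * of_real s)) (at 0)"

definition partial_zbar :: "(complex \<Rightarrow> complex) \<Rightarrow> complex \<Rightarrow> complex" where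
  "partial_zbar f z = (partial_x f z + \<i> * partial_y f z) / 2"

definition laplacian :: "int \<Rightarrow> (complex \<Rightarrow> complex) \<Rightarrow> complex \<Rightarrow> complex" where
  "laplacian w f z =
     of_real (Im z) ^ 2 * (partial_x (partial_x f) z + partial_y (partial_y f) z) -
     \<i> * of_int w * of_real (Im z) * (partial_x f z + \<i> * partial_y f z)"

definition xi :: "int \<Rightarrow> (complex \<Rightarrow> complex) \<Rightarrow> complex \<Rightarrow> complex" where
  "xi w f z = 2 * \<i> * of_real (Im z) powi w * cnj (partial_zbar f z)"

text \<open>Functions are given on the whole complex plane; only their values on the upper half-plane
  matter. The weight is \<open>w = 2 - k\<close>, so \<open>xi w F\<close> has weight \<open>2 - w = k\<close>.\<close>

definition harmonic_maass_form :: "int \<Rightarrow> nat \<Rightarrow> (int \<Rightarrow> complex) \<Rightarrow> (complex \<Rightarrow> complex) \<Rightarrow> bool" where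
  "harmonic_maass_form w N \<eta> F \<longleftrightarrow>
     N > 0 \<and> dirichlet_character N \<eta> \<and>
     real_analytic_on F upper_half_plane \<and>
     transforms w N \<eta> F \<and>
     (\<forall>z\<in>upper_half_plane. laplacian w F z = 0) \<and>
     linear_exponential_growth_at_cusps w F \<and>
     holomorphic_at_cusps (2 - w) (xi w F)"

text \<open>In terms of \<open>k = 2 - w\<close>, the exponents below are \<open>k - 2 = - w\<close> and \<open>k - 1 = 1 - w\<close>, and
  \<open>1 - k = w - 1\<close>.\<close>

definition beta :: "int \<Rightarrow> nat \<Rightarrow> real \<Rightarrow> real" where
  "beta w n y =
     (if n > 0 then integral {y..} (\<lambda>u. exp (- 4 * pi * real n * u) * u powi (- w))
      else if w = 1 then - ln y
      else y powi (1 - w) / of_int (w - 1))"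

text \<open>\<open>holomorphic_part w F cp\<close>: the holomorphic part of \<open>F\<close> is the \<open>q\<close>-series with coefficients
  \<open>cp\<close>.\<close>

definition holomorphic_part :: "int \<Rightarrow> (complex \<Rightarrow> complex) \<Rightarrow> (int \<Rightarrow> complex) \<Rightarrow> bool" where
  "holomorphic_part w F cp \<longleftrightarrow>
     (\<exists>n\<^sub>0 :: int. \<exists>c :: nat \<Rightarrow> complex. (\<forall>n < n\<^sub>0. cp n = 0) \<and>
        (\<forall>z\<in>upper_half_plane. \<exists>P Q.
           ((\<lambda>n. cp n * q_power n z) has_sum P) {n\<^sub>0..} \<and>
           ((\<lambda>n. cnj (c n) * of_real (beta w n (Im z)) * q_power (- int n) z) has_sum Q) UNIV \<and>
           F z = P - Q))"

text \<open>The \<open>q\<close>-series is represented by its coefficients \<open>cp\<close>.\<close>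

definition mock_modular_form ::
  "int \<Rightarrow> nat \<Rightarrow> (int \<Rightarrow> complex) \<Rightarrow> (int \<Rightarrow> complex) \<Rightarrow> (complex \<Rightarrow> complex) \<Rightarrow> bool" where
  "mock_modular_form w N \<eta> cp f \<longleftrightarrow>
     (\<exists>F. harmonic_maass_form w N \<eta> F \<and> holomorphic_part w F cp \<and>
        (\<forall>z\<in>upper_half_plane. xi w F z = f z))"

text \<open>The coefficients \<open>c\<^sup>+(n, t, \<psi>, \<rho>)\<close> of weight \<open>2 - k\<close>, extended by 0 to negative \<open>n\<close>.
  The conjugate of \<open>\<rho>\<close> has the same modulus \<open>M\<close>; the case distinction on \<open>t\<close> dividing \<open>n\<close> is the
  convention that arithmetic functions vanish at non-integers.\<close>

definition mock_eisenstein_coeff ::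
  "nat \<Rightarrow> nat \<Rightarrow> (int \<Rightarrow> complex) \<Rightarrow> nat \<Rightarrow> (int \<Rightarrow> complex) \<Rightarrow> int \<Rightarrow> complex" where
  "mock_eisenstein_coeff k t \<psi> M \<rho> n =
     (if n < 0 then 0
      else if n = 0 then
        (if \<rho> = trivial_char M then
           2 powi (2 - int k) * of_real pi * \<i> ^ (k - 2) /
             (of_nat (t * M) ^ (k - 1) * of_nat (k - 1)) *
           dirichlet_L (of_nat (k - 1)) (conj_char \<psi>) *
           (\<Prod>p\<in>prime_factors M. 1 - 1 / of_nat p)
         else 0)
      else
        2 powi (2 - int k) * of_real pi * \<i> ^ (k - 2) / (of_nat M ^ k * of_nat (k - 1)) *
        primitive_gauss_sum M \<rho> * of_int n powi (1 - int k) *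
        (if int t dvd n then divisor_sum k (conj_char \<psi>) M (conj_char \<rho>) (nat n div t) else 0))"

end

theory Submission
  imports
    Defs
    "HOL-Number_Theory.Number_Theory"
    "HOL-Real_Asymp.Real_Asymp"
begin

text \<open>
  Put \<open>K = k - 2\<close>. The completion of the series is, up to the factor \<open>1 / (2 (k - 1))\<close>, the lattice sum
  of \<open>\<phi>(c, d) y\<^sup>k\<^sup>-\<^sup>1 / (w w'\<^sup>k\<^sup>-\<^sup>1)\<close> with \<open>w = c z + d\<close>, \<open>w'\<close> its conjugate, and
  \<open>\<phi>(c, d) = \<psi>'(c / (t M)) \<rho>(d)\<close>, where \<open>\<psi>'\<close> is the conjugate of \<open>\<psi>\<close> and \<open>\<phi>(c, d) = 0\<close> unless \<open>t M\<close>
  divides \<open>c\<close>. The group \<open>SL\<^sub>2(\<int>)\<close> permutes the lattice sums with arbitrary periodic weights \<open>\<phi>\<close>, so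
  the transformation law and the conditions at all cusps follow from properties of one such sum at infinity.
  For \<open>k = 2\<close> the sum converges only after grouping into blocks of residues, which is possible since the
  weights of a block add up to 0; invariance then comes from an invariant regularisation
  \<open>1 / Q - 1 / (Q + n)\<close> of the terms \<open>1 / Q\<close>, where \<open>Q = |w|\<^sup>2 / y\<close> and \<open>n \<rightarrow> \<infinity>\<close>.

  Summing over \<open>d\<close> by the Lipschitz formula gives the Fourier expansion. It has the shape
  \<open>P + C y\<^sup>k\<^sup>-\<^sup>1 + (\<Sum>j \<le> k - 2. (2 i y)\<^sup>j / j! H\<^sub>j')\<close> with \<open>P\<close> and \<open>H\<^sub>0\<close> holomorphic, \<open>H\<^sub>j\<close> the \<open>j\<close>-th
  derivative of \<open>H\<^sub>0\<close> and \<open>H\<^sub>j'\<close> its conjugate. Every function of this shape is annihilated by the Laplacian,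
  and the sum telescopes under \<open>\<xi>\<close>. The coefficients become twisted divisor sums by evaluating Gauss sums of
  imprimitive characters.
\<close>

section \<open>Dirichlet characters and Gauss sums\<close>

text \<open>The term y^(k-1) / (w w'^(k-1)) is chosen because \<open>xi\<close> sends it to (k - 1)
  / w^k, the term of an Eisenstein series: the derivative by the conjugate of z has (i / 2) w in its
  numerator, which cancels w. So 1 / (2 (k - 1)) removes the factor k - 1 and counts v and -v once.
  This termwise identity only guides the construction. The proof reads the shadow off the Fourier
  expansion, which covers k = 2 as well, and matches coefficients. The cusps then need no separate
  study of Eisenstein series: differentiating the transformation law of the lattice sum carries the
  shadow of one weight to the shadow of the permuted weight, again a power series in q^(1/N). For k
  = 2 convergence is conditional in two places: in the lattice sum itself, and in the constant term,
  where the value of the L-function at 1 arises as a limit over c up to multiples of the level. The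
  excluded pair of trivial characters is the case in which the weights of a block do not cancel and
  this limit does not exist.\<close>

lemma dirichlet_character_mult: "dirichlet_character N \<theta> \<Longrightarrow> \<theta> (a * b) = \<theta> a * \<theta> b"
  and dirichlet_character_eq_0_iff: "dirichlet_character N \<theta> \<Longrightarrow> \<theta> a = 0 \<longleftrightarrow> \<not> coprime a (int N)"
  and dirichlet_character_pos: "dirichlet_character N \<theta> \<Longrightarrow> N > 0"
  by (auto simp: dirichlet_character_def)

lemma dirichlet_character_cong:
  assumes "dirichlet_character N \<theta>" "[a = b] (mod int N)"
  shows "\<theta> a = \<theta> b"
proof -
  have per: "\<theta> (n + int N) = \<theta> n" for n using assms(1) by (simp add: dirichlet_character_def)
  have nat: "\<theta> (n + int N * int k) = \<theta> n" for n k
  proof (induction k)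
    case (Suc k)
    have "n + int N * int (Suc k) = (n + int N * int k) + int N" by (simp add: algebra_simps)
    then show ?case using Suc by (simp only: per)
  qed auto
  have int: "\<theta> (n + int N * k) = \<theta> n" for n k
  proof (cases "k \<ge> 0")
    case True
    then show ?thesis using nat[of n "nat k"] by simp
  next
    case False
    then show ?thesis using nat[of "n + int N * k" "nat (-k)"] by simp
  qed
  obtain k where "b = a + int N * k" using assms(2) by (auto simp: cong_iff_lin)
  then show ?thesis by (simp add: int)
qed

lemma dirichlet_character_mod:
  assumes "dirichlet_character N \<theta>"
  shows "\<theta> (a mod int N) = \<theta> a"
  by (rule dirichlet_character_cong[OF assms]) (simp add: cong_def)

lemma dirichlet_character_1:
  assumes "dirichlet_character N \<theta>"
  shows "\<theta> 1 = 1"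
proof -
  have "\<theta> 1 * \<theta> 1 = \<theta> 1" using dirichlet_character_mult[OF assms, of 1 1] by simp
  moreover have "\<theta> 1 \<noteq> 0" using dirichlet_character_eq_0_iff[OF assms, of 1] by simp
  ultimately show ?thesis by simp
qed

text \<open>By Euler's theorem the value at a unit is a root of unity of order dividing
  \<open>totient N\<close>. The residue b replaces a because Euler's theorem is stated for natural
  numbers.\<close>

lemma norm_dirichlet_character:
  assumes "dirichlet_character N \<theta>"
  shows "norm (\<theta> a) = (if coprime a (int N) then 1 else 0)"
proof (cases "coprime a (int N)")
  case True
  have N: "N > 0" using assms by (rule dirichlet_character_pos)
  define b where "b = nat (a mod int N)"
  have b: "int b = a mod int N" using N by (simp add: b_def)
  then have "coprime (int b) (int N)" using True N by (metis coprime_mod_left_iff of_nat_0_less_iff less_irrefl)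
  then have "coprime b N" by simp
  then have "[b ^ totient N = 1] (mod N)" by (rule euler_theorem)
  then have "[int (b ^ totient N) = 1] (mod int N)" using cong_int_iff[of "b ^ totient N" 1 N] by simp
  then have "\<theta> (int (b ^ totient N)) = \<theta> 1" by (rule dirichlet_character_cong[OF assms])
  moreover have "\<theta> (int (b ^ n)) = \<theta> (int b) ^ n" for n
    by (induction n) (simp_all add: dirichlet_character_1[OF assms] dirichlet_character_mult[OF assms])
  moreover have "\<theta> (int b) = \<theta> a" by (simp add: b dirichlet_character_mod[OF assms])
  ultimately have "\<theta> a ^ totient N = 1" by (metis dirichlet_character_1[OF assms])
  then have "norm (\<theta> a) ^ totient N = 1" by (metis norm_power norm_one)
  moreover have "totient N > 0" using N by simp
  ultimately have "norm (\<theta> a) = 1"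
    by (metis norm_ge_zero power_eq_1_iff not_gr_zero abs_of_nonneg real_norm_def)
  then show ?thesis using True by simp
next
  case False
  then show ?thesis using dirichlet_character_eq_0_iff[OF assms] by simp
qed

text \<open>For a matrix of determinant 1 with M dividing c, the entries satisfy a d = 1 modulo M;
  this turns a value at a into a conjugated value at d in the transformation law.\<close>

lemma dirichlet_character_inverse:
  assumes "dirichlet_character N \<theta>" "[a * b = 1] (mod int N)"
  shows "\<theta> a = cnj (\<theta> b)"
proof -
  have "\<theta> a * \<theta> b = 1"
    using dirichlet_character_cong[OF assms] dirichlet_character_mult[OF assms(1)]
      dirichlet_character_1[OF assms(1)] by metis
  moreover have "norm (\<theta> b) = 1"
    using calculation norm_dirichlet_character[OF assms(1), of b] by (auto split: if_splits)
  then have "\<theta> b * cnj (\<theta> b) = 1" by (simp add: complex_norm_square[symmetric])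
  ultimately show ?thesis by (metis mult.assoc mult.commute mult.right_neutral)
qed

lemma dirichlet_character_conj [simp]:
  "dirichlet_character N (conj_char \<theta>) \<longleftrightarrow> dirichlet_character N \<theta>"
  unfolding dirichlet_character_def conj_char_def complex_cnj_mult[symmetric] complex_cnj_cancel_iff
  by simp

lemma conj_char_conj_char [simp]: "conj_char (conj_char \<theta>) = \<theta>"
  by (simp add: conj_char_def fun_eq_iff)

lemma dirichlet_character_trivial: "N > 0 \<Longrightarrow> dirichlet_character N (trivial_char N)"
  by (simp add: dirichlet_character_def trivial_char_def)
     (simp add: coprime_iff_gcd_eq_1)

section \<open>Conductors and primitive characters\<close>

text \<open>Units modulo m map onto units modulo m'. Take n + m' k with k the product of the primes
  of m that do not divide n: every prime of m then divides exactly one of n and m' k, hence not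
  their sum.\<close>

lemma exists_coprime_residue:
  fixes m m' :: nat and n :: int
  assumes "coprime n (int m')" "m' dvd m" "m > 0"
  shows "\<exists>n'. [n' = n] (mod int m') \<and> coprime n' (int m)"
proof -
  define k where "k = (\<Prod>p\<in>{p\<in>prime_factors m. \<not> int p dvd n}. p)"
  define n' where "n' = n + int m' * int k"
  have "coprime n' (int m)"
  proof (rule ccontr)
    assume "\<not> coprime n' (int m)"
    then obtain p where p: "prime p" "p dvd n'" "p dvd int m"
      using prime_factor_int[of "gcd n' (int m)"] assms(3)
      by (metis abs_gcd_int coprime_iff_gcd_eq_1 dvd_trans gcd_dvd1 gcd_dvd2)
    define q where "q = nat p"
    have pq: "p = int q" using p(1) by (simp add: q_def prime_ge_0_int)
    have q: "prime q" "q dvd m" using p pq by simp_all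
    have qm: "q \<in> prime_factors m" using q assms(3) by (simp add: prime_factors_dvd)
    show False
    proof (cases "int q dvd n")
      case True
      then have "int q dvd int m' * int k" using p(2) by (simp add: pq n'_def dvd_add_right_iff)
      then have "q dvd m' * k" by (metis of_nat_mult of_nat_dvd_iff)
      then consider "q dvd m'" | "q dvd k" using q(1) prime_dvd_mult_iff by blast
      then show False
      proof cases
        case 1
        then have "int q dvd 1" using True assms(1) by (metis coprime_common_divisor of_nat_dvd_iff)
        then show False using q(1) by (simp add: zdvd1_eq prime_gt_1_nat)
      next
        case 2
        then obtain r where r: "r \<in> prime_factors m" "\<not> int r dvd n" "q dvd r"
          using q(1) unfolding k_def by (subst (asm) prime_dvd_prod_iff) auto
        then have "q = r" using q(1) by (metis in_prime_factors_iff primes_dvd_imp_eq)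
        then show False using r True by simp
      qed
    next
      case False
      then have "q dvd k" unfolding k_def using qm by (intro dvd_prodI) auto
      then have "int q dvd int m' * int k" by simp
      then have "int q dvd n" using p(2) by (simp add: pq n'_def dvd_add_left_iff)
      then show False using False by simp
    qed
  qed
  moreover have "[n' = n] (mod int m')" by (simp add: n'_def cong_def)
  ultimately show ?thesis by blast
qed

text \<open>A value at a unit modulo m can be read off at a congruent argument coprime to N, where
  both characters agree with \<eta>. This makes the description operator in
  \<open>primitive_char\<close> meaningful.\<close>

lemma induces_unique:
  assumes "induces m \<eta>1 N \<eta>" "induces m \<eta>2 N \<eta>" "N > 0"
  shows "\<eta>1 = \<eta>2"
proof
  fix n
  have dc: "dirichlet_character m \<eta>1" "dirichlet_character m \<eta>2" "m dvd N"
    using assms by (auto simp: induces_def)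
  show "\<eta>1 n = \<eta>2 n"
  proof (cases "coprime n (int m)")
    case True
    then obtain n' where "[n' = n] (mod int m)" "coprime n' (int N)"
      using exists_coprime_residue[OF True dc(3) assms(3)] by blast
    then show ?thesis
      using assms dirichlet_character_cong[OF dc(1)] dirichlet_character_cong[OF dc(2)]
      unfolding induces_def by metis
  next
    case False
    then show ?thesis using dc dirichlet_character_eq_0_iff by metis
  qed
qed

lemma induces_conductor:
  assumes "dirichlet_character N \<eta>"
  shows "induces (conductor N \<eta>) (primitive_char N \<eta>) N \<eta>"
proof -
  have "induces N \<eta> N \<eta>" using assms by (simp add: induces_def)
  then have "\<exists>\<eta>'. induces (conductor N \<eta>) \<eta>' N \<eta>"
    unfolding conductor_def by (rule LeastI[of "\<lambda>m. \<exists>\<eta>'. induces m \<eta>' N \<eta>" N, OF exI])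
  then have "\<exists>!\<eta>'. induces (conductor N \<eta>) \<eta>' N \<eta>"
    using induces_unique dirichlet_character_pos[OF assms] by blast
  then show ?thesis unfolding primitive_char_def by (rule theI')
qed

lemma conductor_le: "induces m \<eta>' N \<eta> \<Longrightarrow> conductor N \<eta> \<le> m"
  unfolding conductor_def by (rule Least_le) blast

lemma conductor_conj [simp]: "conductor N (conj_char \<eta>) = conductor N \<eta>"
  and primitive_char_conj:
    "dirichlet_character N \<eta> \<Longrightarrow> primitive_char N (conj_char \<eta>) = conj_char (primitive_char N \<eta>)"
proof -
  have *: "induces m (conj_char \<eta>') N (conj_char \<eta>) \<longleftrightarrow> induces m \<eta>' N \<eta>" for m \<eta>' \<eta>
    by (simp add: induces_def) (simp add: conj_char_def)
  have "(\<exists>\<eta>'. induces m \<eta>' N (conj_char \<eta>)) \<longleftrightarrow> (\<exists>\<eta>'. induces m \<eta>' N \<eta>)" for m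
    by (metis * conj_char_conj_char)
  then show c: "conductor N (conj_char \<eta>) = conductor N \<eta>" by (simp add: conductor_def)
  assume d: "dirichlet_character N \<eta>"
  show "primitive_char N (conj_char \<eta>) = conj_char (primitive_char N \<eta>)"
    by (rule induces_unique[of "conductor N \<eta>" _ N "conj_char \<eta>"])
       (use induces_conductor[of N "conj_char \<eta>"] induces_conductor[OF d] d c * dirichlet_character_pos in auto)
qed

text \<open>This is how minimality of the conductor enters the Gauss sums. If the primitive
  character were 1 on all units congruent to 1 modulo m', it would factor through the residues
  modulo m' and induce \<eta> from the smaller modulus.\<close>

lemma primitive_char_nontrivial:
  assumes "dirichlet_character N \<eta>" "m' dvd conductor N \<eta>" "m' < conductor N \<eta>"
  shows "\<exists>a. [a = 1] (mod int m') \<and> coprime a (int (conductor N \<eta>)) \<and> primitive_char N \<eta> a \<noteq> 1"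
proof (rule ccontr)
  assume contra: "\<not> ?thesis"
  define m where "m = conductor N \<eta>"
  define \<theta> where "\<theta> = primitive_char N \<eta>"
  have ind: "induces m \<theta> N \<eta>" using induces_conductor[OF assms(1)] by (simp add: m_def \<theta>_def)
  then have dc: "dirichlet_character m \<theta>" and mN: "m dvd N" by (auto simp: induces_def)
  have m: "m > 0" using dc by (rule dirichlet_character_pos)
  have m'm: "m' dvd m" "m' > 0" using assms(2) m by (auto simp: m_def intro: dvd_pos_nat)
  have triv: "\<theta> a = 1" if "[a = 1] (mod int m')" "coprime a (int m)" for a
    using contra that by (auto simp: m_def \<theta>_def)
  \<comment> \<open>Multiplying by an inverse x of b modulo m reduces the comparison to a x, which
    is 1 modulo m', and to b x, which is 1 modulo m.\<close>
  have well: "\<theta> a = \<theta> b" if ab: "[a = b] (mod int m')" "coprime a (int m)" "coprime b (int m)" for a b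
  proof -
    obtain x where x: "[b * x = 1] (mod int m)"
      using ab(3) cong_solve_coprime_int by blast
    then have x': "coprime x (int m)" by (metis cong_imp_coprime coprime_1_left coprime_mult_left_iff cong_sym)
    have "[b * x = 1] (mod int m')" using x m'm(1) by (meson cong_dvd_modulus of_nat_dvd_iff)
    then have "[a * x = 1] (mod int m')" using ab(1) by (metis cong_scalar_right cong_trans)
    then have "\<theta> (a * x) = 1" using ab x' by (intro triv) auto
    moreover have "\<theta> (b * x) = 1"
      using dirichlet_character_cong[OF dc x] dirichlet_character_1[OF dc] by simp
    ultimately have "\<theta> a * \<theta> x = \<theta> b * \<theta> x" by (simp add: dirichlet_character_mult[OF dc])
    moreover have "\<theta> x \<noteq> 0" using x' dirichlet_character_eq_0_iff[OF dc] by simp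
    ultimately show ?thesis by simp
  qed
  \<comment> \<open>r n is some lift of n to a unit modulo m; by \<open>well\<close> the value of
    \<theta> there does not depend on the choice.\<close>
  define r where "r n = (SOME n'. [n' = n] (mod int m') \<and> coprime n' (int m))" for n
  have r: "[r n = n] (mod int m')" "coprime (r n) (int m)" if "coprime n (int m')" for n
    using someI_ex[OF exists_coprime_residue[OF that m'm(1) m]] by (simp_all add: r_def)
  define \<eta>' where "\<eta>' n = (if coprime n (int m') then \<theta> (r n) else 0)" for n
  have \<eta>': "\<eta>' n = \<theta> n'" if "coprime n (int m')" "[n' = n] (mod int m')" "coprime n' (int m)" for n n'
    using that r[OF that(1)] well[of "r n" n'] by (simp add: \<eta>'_def) (metis cong_sym cong_trans)
  have "dirichlet_character m' \<eta>'"
    unfolding dirichlet_character_def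
  proof (intro conjI allI)
    show "m' > 0" by (rule m'm)
    fix a b n :: int
    show "\<eta>' (a * b) = \<eta>' a * \<eta>' b"
    proof (cases "coprime a (int m') \<and> coprime b (int m')")
      case True
      then have "\<eta>' (a * b) = \<theta> (r a * r b)"
        using r by (intro \<eta>') (auto intro: cong_mult)
      then show ?thesis using True by (simp add: \<eta>'_def dirichlet_character_mult[OF dc])
    next
      case False
      then show ?thesis by (auto simp: \<eta>'_def)
    qed
    have cop: "coprime (n + int m') (int m') \<longleftrightarrow> coprime n (int m')" by (simp add: coprime_iff_gcd_eq_1)
    show "\<eta>' (n + int m') = \<eta>' n"
    proof (cases "coprime n (int m')")
      case True
      have "[r n = n + int m'] (mod int m')" using r(1)[OF True] by (simp add: cong_def)
      then show ?thesis using True r(2)[OF True] cop by (subst \<eta>'[of "n + int m'" "r n"]) (auto simp: \<eta>'_def)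
    next
      case False
      then show ?thesis using cop by (simp add: \<eta>'_def)
    qed
    show "\<eta>' n \<noteq> 0 \<longleftrightarrow> coprime n (int m')"
      using r(2)[of n] dirichlet_character_eq_0_iff[OF dc] by (auto simp: \<eta>'_def)
  qed
  moreover have "\<eta> n = \<eta>' n" if "coprime n (int N)" for n
  proof -
    have "coprime n (int m)" using that mN by (meson coprime_divisors dvd_refl of_nat_dvd_iff)
    moreover have "coprime n (int m')" using calculation m'm by (meson coprime_divisors dvd_refl of_nat_dvd_iff)
    ultimately show ?thesis using ind that \<eta>'[of n n] by (simp add: induces_def)
  qed
  ultimately have "induces m' \<eta>' N \<eta>" using m'm(1) mN by (auto simp: induces_def intro: dvd_trans)
  then show False using conductor_le assms(3) by (metis not_le)
qed

section \<open>Exponential sums over residues\<close>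

lemma bij_betw_mult_mod:
  fixes a :: int
  assumes "coprime a (int N)" "N > 0"
  shows "bij_betw (\<lambda>b. (a * b) mod int N) {0..<int N} {0..<int N}"
proof -
  have "inj_on (\<lambda>b. (a * b) mod int N) {0..<int N}"
  proof (rule inj_onI)
    fix x y assume xy: "x \<in> {0..<int N}" "y \<in> {0..<int N}" "(a * x) mod int N = (a * y) mod int N"
    then have "[x = y] (mod int N)" using assms(1) by (metis cong_def cong_mult_lcancel)
    then show "x = y" using xy by (simp add: cong_def)
  qed
  moreover have "(\<lambda>b. (a * b) mod int N) ` {0..<int N} \<subseteq> {0..<int N}" using assms(2) by auto
  ultimately show ?thesis by (simp add: bij_betw_def endo_inj_surj)
qed

lemma sum_mult_residues:
  fixes f :: "int \<Rightarrow> 'a :: comm_monoid_add"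
  assumes "\<And>n. f (n mod int N) = f n" "coprime a (int N)" "N > 0"
  shows "(\<Sum>b\<in>{0..<int N}. f (a * b)) = (\<Sum>b\<in>{0..<int N}. f b)"
proof -
  have "(\<Sum>b\<in>{0..<int N}. f b) = (\<Sum>b\<in>{0..<int N}. f ((a * b) mod int N))"
    by (rule sum.reindex_bij_betw[OF bij_betw_mult_mod[OF assms(2,3)], symmetric])
  then show ?thesis by (simp add: assms(1))
qed

definition unity_exp :: "complex \<Rightarrow> complex" where
  "unity_exp x = exp (2 * of_real pi * \<i> * x)"

lemma unity_exp_add: "unity_exp (x + y) = unity_exp x * unity_exp y"
  by (simp add: unity_exp_def distrib_left exp_add)

lemma unity_exp_of_int [simp]: "unity_exp (of_int n) = 1"
  unfolding unity_exp_def by (simp add: exp_eq_1)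

lemma unity_exp_eq_1D:
  assumes "unity_exp (of_real x) = 1"
  shows "x \<in> \<int>"
proof -
  from assms obtain n where "2 * pi * x = of_int (2 * n) * pi"
    unfolding unity_exp_def exp_eq_1 by auto
  then have "x = of_int n" by simp
  then show ?thesis by simp
qed

lemma unity_exp_power: "unity_exp x ^ n = unity_exp (of_nat n * x)"
  by (simp add: unity_exp_def exp_of_nat_mult[symmetric] mult_ac)

lemma unity_exp_mod:
  assumes "N > 0"
  shows "unity_exp (of_int (a mod int N) / of_nat N) = unity_exp (of_int a / of_nat N)"
proof -
  have "of_int a = (of_int (a mod int N) + of_nat N * of_int (a div int N) :: complex)"
    by (metis add.commute mult_div_mod_eq of_int_add of_int_mult of_int_of_nat_eq)
  then have "of_int a / of_nat N = (of_int (a mod int N) / of_nat N + of_int (a div int N) :: complex)"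
    using assms by (simp add: field_simps)
  then show ?thesis by (simp add: unity_exp_add)
qed

lemma sum_unity_exp:
  assumes "d > 0"
  shows "(\<Sum>j\<in>{0..<int d}. unity_exp (of_int (n * j) / of_nat d)) = (if int d dvd n then of_nat d else 0)"
proof -
  let ?x = "unity_exp (of_int n / of_nat d)"
  have img: "{0..<int d} = int ` {..<d}"
    by (metis atLeast0LessThan image_int_atLeastLessThan of_nat_0)
  have "(\<Sum>j\<in>{0..<int d}. unity_exp (of_int (n * j) / of_nat d)) = (\<Sum>j<d. ?x ^ j)"
    unfolding img by (subst sum.reindex) (auto simp: unity_exp_power mult_ac)
  also have "\<dots> = (if int d dvd n then of_nat d else 0)"
  proof (cases "int d dvd n")
    case True
    then obtain k where "n = int d * k" by auto
    then have "?x = 1" using assms by simp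
    then show ?thesis using True by simp
  next
    case False
    have "?x \<noteq> 1"
    proof
      assume "?x = 1"
      then have "real_of_int n / real d \<in> \<int>" by (intro unity_exp_eq_1D) simp
      then obtain k where "real_of_int n / real d = of_int k" by (auto elim: Ints_cases)
      then have "real_of_int n = of_int (int d * k)" using assms by (simp add: field_simps)
      then have "n = int d * k" by linarith
      then show False using False by simp
    qed
    moreover have "?x ^ d = 1" using assms by (simp add: unity_exp_power)
    ultimately show ?thesis using False by (simp add: sum_gp_strict)
  qed
  finally show ?thesis .
qed

text \<open>For n coprime to m substitute n b for b. Otherwise let g = gcd(n, m) > 1 and take a unit
  a that is 1 modulo m / g with \<theta> a different from 1: replacing b by a b leaves the
  exponentials unchanged but multiplies the sum by \<theta> a, so the sum is 0, and so is \<theta>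
  n.\<close>

lemma sum_primitive_char_unity_exp:
  fixes n :: int
  assumes "dirichlet_character N \<eta>"
  defines "m \<equiv> conductor N \<eta>" and "\<theta> \<equiv> primitive_char N \<eta>"
  shows "(\<Sum>b\<in>{0..<int m}. \<theta> b * unity_exp (of_int (n * b) / of_nat m)) =
           cnj (\<theta> n) * (\<Sum>b\<in>{0..<int m}. \<theta> b * unity_exp (of_int b / of_nat m))"
proof -
  have dc: "dirichlet_character m \<theta>" using induces_conductor[OF assms(1)] by (simp add: induces_def m_def \<theta>_def)
  have m: "m > 0" using dc by (rule dirichlet_character_pos)
  have ue: "unity_exp (of_int (n * (b mod int m)) / of_nat m) = unity_exp (of_int (n * b) / of_nat m)" for b n
    by (metis unity_exp_mod[OF m] mod_mult_right_eq)
  show ?thesis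
  proof (cases "coprime n (int m)")
    case True
    have "\<theta> n * (\<Sum>b\<in>{0..<int m}. \<theta> b * unity_exp (of_int (n * b) / of_nat m)) =
        (\<Sum>b\<in>{0..<int m}. \<theta> (n * b) * unity_exp (of_int (n * b) / of_nat m))"
      by (simp add: sum_distrib_left dirichlet_character_mult[OF dc] mult_ac)
    also have "\<dots> = (\<Sum>b\<in>{0..<int m}. \<theta> b * unity_exp (of_int b / of_nat m))"
      using True m by (intro sum_mult_residues) (simp_all add: dirichlet_character_mod[OF dc] unity_exp_mod[OF m])
    finally have *: "\<theta> n * (\<Sum>b\<in>{0..<int m}. \<theta> b * unity_exp (of_int (n * b) / of_nat m)) =
        (\<Sum>b\<in>{0..<int m}. \<theta> b * unity_exp (of_int b / of_nat m))" .
    have "cnj (\<theta> n) * \<theta> n = 1" using norm_dirichlet_character[OF dc, of n] True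
      by (simp add: complex_norm_square[symmetric] mult.commute)
    then have "(\<Sum>b\<in>{0..<int m}. \<theta> b * unity_exp (of_int (n * b) / of_nat m)) =
        cnj (\<theta> n) * (\<theta> n * (\<Sum>b\<in>{0..<int m}. \<theta> b * unity_exp (of_int (n * b) / of_nat m)))"
      by (simp only: mult.assoc[symmetric] mult_1)
    then show ?thesis by (simp only: *)
  next
    case False
    define g where "g = nat (gcd n (int m))"
    have g: "int g = gcd n (int m)" by (simp add: g_def)
    have g1: "g > 1" using False g m by (metis coprime_iff_gcd_eq_1 gcd_eq_0_iff gcd_ge_0_int less_one linorder_neqE_nat of_nat_0_less_iff less_irrefl of_nat_1 of_nat_eq_0_iff)
    have "int g dvd int m" using g by simp
    then have gm: "g dvd m" by simp
    then obtain m' where m': "m = g * m'" by auto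
    then have "m' < m" "m' > 0" using g1 m by auto
    then obtain a where a: "[a = 1] (mod int m')" "coprime a (int m)" "\<theta> a \<noteq> 1"
      using primitive_char_nontrivial[OF assms(1), of m'] m' unfolding m_def \<theta>_def by auto
    obtain n1 where n1: "n = int g * n1" using g by (metis dvdE gcd_dvd1)
    obtain r where r: "a = 1 + int m' * r" using a(1) by (metis cong_iff_lin cong_sym)
    have eq: "unity_exp (of_int (n * (a * b)) / of_nat m) = unity_exp (of_int (n * b) / of_nat m)" for b
    proof -
      have "n * (a * b) = n * b + int m * (n1 * r * b)" by (simp add: n1 r m' algebra_simps)
      then have "(of_int (n * (a * b)) / of_nat m :: complex) = of_int (n * b) / of_nat m + of_int (n1 * r * b)"
        using m by (simp add: field_simps)
      then show ?thesis by (simp only: unity_exp_add unity_exp_of_int mult_1_right)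
    qed
    let ?S = "\<Sum>b\<in>{0..<int m}. \<theta> b * unity_exp (of_int (n * b) / of_nat m)"
    have "?S = (\<Sum>b\<in>{0..<int m}. \<theta> (a * b) * unity_exp (of_int (n * (a * b)) / of_nat m))"
      using a m by (intro sum_mult_residues[symmetric]) (simp_all add: dirichlet_character_mod[OF dc] ue del: of_int_mult)
    also have "\<dots> = \<theta> a * ?S"
      by (simp only: eq dirichlet_character_mult[OF dc] sum_distrib_left mult.assoc)
    finally have "?S = 0" using a(3) by simp
    then show ?thesis using False dirichlet_character_eq_0_iff[OF dc] by simp
  qed
qed

section \<open>Moebius inversion and Gauss sums of imprimitive characters\<close>

text \<open>Squarefree divisors correspond to sets of prime factors, so the sum is the expanded
  product of -1 + 1 over the primes of n; it is 0 unless that product is empty.\<close>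

lemma sum_moebius:
  assumes "n > 0"
  shows "(\<Sum>d | d dvd n. moebius d) = (if n = 1 then 1 else 0)"
proof -
  let ?P = "prime_factors n"
  have pf: "prime_factors (\<Prod>S) = S" if "S \<subseteq> ?P" for S :: "nat set"
  proof -
    have fin: "finite S" using that by (rule finite_subset) simp
    have "prime_factorization (\<Prod>S) = (\<Sum>p\<in>S. prime_factorization p)"
      using that by (subst prime_factorization_prod[OF fin]) (auto dest!: in_prime_factors_imp_prime simp: prime_gt_0_nat)
    also have "\<dots> = (\<Sum>p\<in>S. {#p#})"
      using that by (intro sum.cong refl prime_factorization_prime) auto
    finally show ?thesis using fin by (simp add: set_mset_sum)
  qed
  have sq: "squarefree (\<Prod>S)" if "S \<subseteq> ?P" for S :: "nat set"
  proof -
    have fin: "finite S" using that by (rule finite_subset) simp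
    show ?thesis using that
      by (intro squarefree_prod_coprime squarefree_prime) (auto intro!: primes_coprime)
  qed
  have dv: "\<Prod>S dvd n" if "S \<subseteq> ?P" for S :: "nat set"
  proof -
    have "\<Prod>S dvd \<Prod>?P" using that by (intro prod_dvd_prod_subset) auto
    also have "\<Prod>?P dvd (\<Prod>p\<in>?P. p ^ multiplicity p n)"
      by (intro prod_dvd_prod) (auto intro!: dvd_power simp: prime_factors_multiplicity)
    also have "\<dots> = n" using assms by (simp add: prod_prime_factors)
    finally show ?thesis .
  qed
  have inv: "\<Prod>(prime_factors d) = d" if "squarefree d" for d :: nat
  proof -
    have "d > 0" using that by (auto intro!: Nat.gr0I)
    then have "d = (\<Prod>p\<in>prime_factors d. p ^ multiplicity p d)" by (simp add: prod_prime_factors)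
    also have "\<dots> = (\<Prod>p\<in>prime_factors d. p)"
    proof (intro prod.cong refl)
      fix p assume "p \<in> prime_factors d"
      then have "multiplicity p d \<le> 1" "multiplicity p d > 0"
        using that \<open>d > 0\<close> by (auto simp: squarefree_factorial_semiring'' prime_factors_multiplicity)
      then have "multiplicity p d = 1" by linarith
      then show "p ^ multiplicity p d = p" by simp
    qed
    finally show ?thesis by simp
  qed
  have "(\<Sum>d | d dvd n. moebius d) = (\<Sum>d | d dvd n \<and> squarefree d. moebius d)"
    using assms by (intro sum.mono_neutral_right) (auto simp: moebius_def)
  also have "\<dots> = (\<Sum>S\<in>Pow ?P. (-1) ^ card S)"
    using assms
    by (intro sum.reindex_bij_witness[of _ "\<lambda>S. \<Prod>S" prime_factors])
       (auto simp: pf sq dv inv moebius_def dest!: dvd_prime_factors[rotated])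
  also have "\<dots> = (\<Prod>p\<in>?P. (-1) + 1)" by (subst prod_add) simp_all
  also have "\<dots> = (if ?P = {} then 1 else 0)" by (simp add: card_gt_0_iff)
  also have "?P = {} \<longleftrightarrow> n = 1" using assms by (auto simp: prime_factorization_empty_iff)
  finally show ?thesis by simp
qed

lemma int_div_less:
  fixes a m d :: int
  assumes "m > 0" "a < m * d"
  shows "a div m < d"
proof (rule ccontr)
  assume "\<not> a div m < d"
  then have "m * d \<le> m * (a div m)" using assms by (intro mult_left_mono) auto
  also have "\<dots> \<le> a" using assms(1) by (metis mult_div_mod_eq le_add_same_cancel1 pos_mod_sign)
  finally show False using assms by simp
qed

lemma sum_residues_split:
  fixes f :: "int \<Rightarrow> 'a :: comm_monoid_add"
  assumes "m > 0"
  shows "(\<Sum>a\<in>{0..<int (m * d)}. f a) = (\<Sum>b\<in>{0..<int m}. \<Sum>j\<in>{0..<int d}. f (b + int m * j))"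
proof -
  have "(\<Sum>b\<in>{0..<int m}. \<Sum>j\<in>{0..<int d}. f (b + int m * j)) =
      (\<Sum>(b,j)\<in>{0..<int m} \<times> {0..<int d}. f (b + int m * j))"
    by (simp add: sum.cartesian_product)
  also have "\<dots> = (\<Sum>a\<in>{0..<int (m * d)}. f a)"
  proof (rule sum.reindex_bij_witness[of _ "\<lambda>a. (a mod int m, a div int m)" "\<lambda>(b,j). b + int m * j"], goal_cases)
    case (2 x)
    obtain b j where x: "x = (b, j)" by force
    have b: "0 \<le> b" "b < int m" "0 \<le> j" "j \<le> int d - 1" using 2 x by auto
    have "int m * j \<le> int m * (int d - 1)" using b by (intro mult_left_mono) auto
    then have "b + int m * j < int m * int d" using b by (simp add: algebra_simps)
    then show ?case using b by (simp add: x)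
  next
    case (4 a)
    then show ?case using assms by (auto simp: pos_imp_zdiv_nonneg_iff int_div_less)
  qed (use assms in \<open>auto simp: split: prod.splits\<close>)
  finally show ?thesis by (rule sym)
qed

text \<open>The character is \<theta> times the indicator of being coprime to l, since N = m l.
  Moebius inversion writes the indicator as a sum over e dividing l and a. For l = e d and a = e b,
  the residues b modulo m d split into residues modulo m and modulo d; the second sum is d or 0
  according to whether d divides n, and the first is a Gauss sum of the primitive character.\<close>

theorem sum_dirichlet_character_unity_exp:
  fixes n :: nat
  assumes "dirichlet_character N \<eta>"
  defines "l \<equiv> conductor_index N \<eta>" and "\<theta> \<equiv> primitive_char N \<eta>"
  shows "(\<Sum>a\<in>{0..<int N}. \<eta> a * unity_exp (of_int (int n * a) / of_nat N)) =
           primitive_gauss_sum N \<eta> *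
           (\<Sum>d | d dvd gcd l n. of_nat d * of_int (moebius (l div d)) * \<theta> (int (l div d)) * cnj (\<theta> (int (n div d))))"
proof -
  define m where "m = conductor N \<eta>"
  have ind: "induces m \<theta> N \<eta>" using induces_conductor[OF assms(1)] by (simp add: m_def \<theta>_def)
  have dc: "dirichlet_character m \<theta>" and mN: "m dvd N" using ind by (auto simp: induces_def)
  have m: "m > 0" using dc by (rule dirichlet_character_pos)
  have N: "N > 0" using assms(1) by (rule dirichlet_character_pos)
  have Nm: "N = m * l" using mN m by (simp add: l_def conductor_index_def m_def)
  have l: "l > 0" using N Nm by simp
  have fin [simp]: "finite {d. d dvd l}" using l by simp
  have codiv: "l div (l div d) = d" "l div d dvd l" if "d dvd l" for d
    using that l by (auto elim!: dvdE)
  let ?e = "\<lambda>a d. unity_exp (of_int (int n * a) / of_nat d)"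
  have W: "primitive_gauss_sum N \<eta> = (\<Sum>b\<in>{0..<int m}. \<theta> b * unity_exp (of_int b / of_nat m))"
  proof -
    let ?g = "\<lambda>b. \<theta> b * unity_exp (of_int b / of_nat m)"
    have per: "?g (b mod int m) = ?g b" for b
      by (simp add: dirichlet_character_mod[OF dc] unity_exp_mod[OF m])
    have "primitive_gauss_sum N \<eta> = (\<Sum>n=1..m. ?g (int n))"
      by (simp add: primitive_gauss_sum_def m_def \<theta>_def unity_exp_def)
    also have "\<dots> = (\<Sum>b\<in>{0..<int m}. ?g b)"
    proof (rule sum.reindex_bij_witness[of _ "\<lambda>b. if b = 0 then m else nat b" "\<lambda>n. int n mod int m"], goal_cases)
      case (1 a) then show ?case using m by (cases "a = m") auto
    next
      case (2 a) then show ?case using m by auto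
    next
      case (3 a) then show ?case using m by auto
    next
      case (4 a) then show ?case using m by auto
    next
      case (5 a) then show ?case by (simp only: per)
    qed
    finally show ?thesis .
  qed
  \<comment> \<open>Where a is coprime to l but not to m, the right-hand side vanishes because
    \<theta> a = 0.\<close>
  have eta: "\<eta> a = (\<Sum>e | e dvd l. if int e dvd a then of_int (moebius e) * \<theta> a else 0)" for a
  proof -
    define g where "g = nat (gcd a (int l))"
    have g: "int g = gcd a (int l)" by (simp add: g_def)
    have g0: "g > 0" using l by (simp add: g_def)
    have gd: "e dvd l \<and> int e dvd a \<longleftrightarrow> e dvd g" for e
      by (metis g gcd_greatest_iff of_nat_dvd_iff)
    have "(\<Sum>e | e dvd l. if int e dvd a then of_int (moebius e) * \<theta> a else 0) =
        (\<Sum>e | e dvd g. of_int (moebius e) * \<theta> a)"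
      by (rule sum.mono_neutral_cong_right) (auto simp: gd[symmetric])
    also have "\<dots> = of_int (\<Sum>e | e dvd g. moebius e) * \<theta> a"
      by (simp add: sum_distrib_right)
    also have "\<dots> = (if g = 1 then \<theta> a else 0)" using g0 by (simp add: sum_moebius)
    also have "\<dots> = \<eta> a"
    proof (cases "coprime a (int N)")
      case True
      then have "coprime a (int l)" by (simp add: Nm)
      then have "g = 1" by (simp add: g_def)
      then show ?thesis using ind True by (simp add: induces_def)
    next
      case False
      then have "\<not> coprime a (int l) \<or> \<not> coprime a (int m)" by (auto simp: Nm)
      then have "g \<noteq> 1 \<or> \<theta> a = 0"
        using g dirichlet_character_eq_0_iff[OF dc] by (metis coprime_iff_gcd_eq_1 of_nat_1)
      then show ?thesis using False dirichlet_character_eq_0_iff[OF assms(1)] by auto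
    qed
    finally show ?thesis by (rule sym)
  qed
  have inner: "(\<Sum>a\<in>{0..<int N}. (if int e dvd a then of_int (moebius e) * \<theta> a else 0) * ?e a N) =
      (if d dvd n then of_nat d * of_int (moebius e) * \<theta> (int e) * cnj (\<theta> (int (n div d))) * primitive_gauss_sum N \<eta> else 0)"
    if ed: "l = e * d" for e d
  proof -
    have ed0: "e > 0" "d > 0" using l ed by (auto intro!: Nat.gr0I)
    have "(\<Sum>a\<in>{0..<int N}. (if int e dvd a then of_int (moebius e) * \<theta> a else 0) * ?e a N) =
        (\<Sum>a\<in>{a\<in>{0..<int N}. int e dvd a}. of_int (moebius e) * \<theta> a * ?e a N)"
      by (rule sum.mono_neutral_cong_right) auto
    also have "\<dots> = (\<Sum>b\<in>{0..<int (m * d)}. of_int (moebius e) * \<theta> (int e * b) * ?e (int e * b) N)"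
      by (rule sum.reindex_bij_witness[of _ "\<lambda>b. int e * b" "\<lambda>a. a div int e"])
         (use ed0 in \<open>auto simp: Nm ed mult_ac pos_imp_zdiv_nonneg_iff elim!: dvdE\<close>)
    also have "\<dots> = of_int (moebius e) * \<theta> (int e) * (\<Sum>b\<in>{0..<int (m * d)}. \<theta> b * ?e b (m * d))"
      using ed0 by (simp add: sum_distrib_left dirichlet_character_mult[OF dc] Nm ed field_simps)
    also have "(\<Sum>b\<in>{0..<int (m * d)}. \<theta> b * ?e b (m * d)) =
        (\<Sum>b\<in>{0..<int m}. \<Sum>j\<in>{0..<int d}. \<theta> (b + int m * j) * ?e (b + int m * j) (m * d))"
      by (rule sum_residues_split[OF m])
    also have "\<dots> = (\<Sum>b\<in>{0..<int m}. \<Sum>j\<in>{0..<int d}. \<theta> b * ?e b (m * d) * ?e j d)"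
    proof (intro sum.cong refl)
      fix b j
      have "\<theta> (b + int m * j) = \<theta> b" by (rule dirichlet_character_cong[OF dc]) (simp add: cong_def)
      moreover have "?e (b + int m * j) (m * d) = ?e b (m * d) * ?e j d"
        unfolding unity_exp_add[symmetric] using m ed0 by (simp add: field_simps)
      ultimately show "\<theta> (b + int m * j) * ?e (b + int m * j) (m * d) = \<theta> b * ?e b (m * d) * ?e j d" by simp
    qed
    also have "\<dots> = (\<Sum>b\<in>{0..<int m}. \<theta> b * ?e b (m * d)) * (if int d dvd int n then of_nat d else 0)"
      by (subst sum_unity_exp[OF ed0(2), symmetric]) (simp add: sum_distrib_left sum_distrib_right, rule sum.swap)
    also have "of_int (moebius e) * \<theta> (int e) * \<dots> =
      (if d dvd n then of_nat d * of_int (moebius e) * \<theta> (int e) * cnj (\<theta> (int (n div d))) * primitive_gauss_sum N \<eta> else 0)"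
    proof (cases "d dvd n")
      case True
      then obtain n' where n': "n = d * n'" by auto
      have "(\<Sum>b\<in>{0..<int m}. \<theta> b * ?e b (m * d)) = (\<Sum>b\<in>{0..<int m}. \<theta> b * unity_exp (of_int (int n' * b) / of_nat m))"
        using ed0 by (simp add: n')
      also have "\<dots> = cnj (\<theta> (int n')) * primitive_gauss_sum N \<eta>"
        unfolding W unfolding m_def \<theta>_def by (rule sum_primitive_char_unity_exp[OF assms(1)])
      finally show ?thesis using True ed0 by (simp add: n')
    qed simp
    finally show ?thesis .
  qed
  have "(\<Sum>a\<in>{0..<int N}. \<eta> a * ?e a N) =
      (\<Sum>e | e dvd l. \<Sum>a\<in>{0..<int N}. (if int e dvd a then of_int (moebius e) * \<theta> a else 0) * ?e a N)"
    by (subst eta, subst sum_distrib_right, rule sum.swap)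
  also have "\<dots> = (\<Sum>d | d dvd l. \<Sum>a\<in>{0..<int N}. (if int (l div d) dvd a then of_int (moebius (l div d)) * \<theta> a else 0) * ?e a N)"
    by (rule sum.reindex_bij_witness[of _ "\<lambda>d. l div d" "\<lambda>d. l div d"]) (simp_all add: codiv cong: if_cong)
  also have "\<dots> = (\<Sum>d | d dvd l. if d dvd n then of_nat d * of_int (moebius (l div d)) * \<theta> (int (l div d)) * cnj (\<theta> (int (n div d))) * primitive_gauss_sum N \<eta> else 0)"
    by (intro sum.cong refl inner) auto
  also have "\<dots> = (\<Sum>d | d dvd gcd l n. of_nat d * of_int (moebius (l div d)) * \<theta> (int (l div d)) * cnj (\<theta> (int (n div d))) * primitive_gauss_sum N \<eta>)"
    by (rule sum.mono_neutral_cong_right) auto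
  finally show ?thesis by (simp add: sum_distrib_left mult_ac)
qed

section \<open>Lattice sums along a line\<close>

lemma norm_unity_exp: "norm (unity_exp z) = exp (- 2 * pi * Im z)"
  by (simp add: unity_exp_def norm_exp_eq_Re)

lemma has_field_derivative_unity_exp [derivative_intros]:
  assumes "(f has_field_derivative f') (at z within A)"
  shows "((\<lambda>z. unity_exp (f z)) has_field_derivative (2 * of_real pi * \<i> * f' * unity_exp (f z))) (at z within A)"
  unfolding unity_exp_def by (rule derivative_eq_intros assms refl | simp)+

lemma upper_half_plane_nonint:
  assumes "Im z > 0"
  shows "z \<notin> \<int>\<^sub>\<le>\<^sub>0" "1 - z \<notin> \<int>\<^sub>\<le>\<^sub>0" "z + of_int n \<noteq> 0" "cnj z + of_int n \<noteq> 0"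
  using assms by (auto elim!: nonpos_Ints_cases simp: complex_eq_iff)

section \<open>Reflection formulas and the cotangent series\<close>

text \<open>The logarithmic derivative of the reflection formula of Gamma. Both sides of that
  formula are differentiated as they stand and divided afterwards, so that no branch of the
  logarithm is chosen.\<close>

lemma Digamma_reflection:
  assumes "Im z > 0"
  shows "Digamma z - Digamma (1 - z) = - of_real pi * cot (of_real pi * z)"
proof -
  note nz = upper_half_plane_nonint[OF assms]
  have G: "Gamma z \<noteq> 0" "Gamma (1 - z) \<noteq> 0" using nz by (simp_all add: Gamma_eq_zero_iff)
  have "Gamma z * Gamma (1 - z) = of_real pi / sin (of_real pi * z)" by (rule Gamma_reflection_complex)
  then have s: "sin (of_real pi * z) \<noteq> 0" using G by auto
  have 1: "((\<lambda>z. Gamma z * Gamma (1 - z)) has_field_derivative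
      Gamma z * Gamma (1 - z) * (Digamma z - Digamma (1 - z))) (at z)"
    by (rule derivative_eq_intros nz refl | simp add: algebra_simps)+
  have "((\<lambda>z. of_real pi / sin (of_real pi * z)) has_field_derivative
      - (of_real pi * (of_real pi * cos (of_real pi * z))) / (sin (of_real pi * z))^2) (at z)"
    by (rule derivative_eq_intros refl s | simp add: power2_eq_square mult_ac)+
  then have "((\<lambda>z. Gamma z * Gamma (1 - z)) has_field_derivative
      - (of_real pi * (of_real pi * cos (of_real pi * z))) / (sin (of_real pi * z))^2) (at z)"
    by (simp add: Gamma_reflection_complex)
  from DERIV_unique[OF 1 this] have
    "of_real pi / sin (of_real pi * z) * (Digamma z - Digamma (1 - z)) =
      - (of_real pi * (of_real pi * cos (of_real pi * z))) / (sin (of_real pi * z))^2"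
    by (simp add: Gamma_reflection_complex)
  then show ?thesis using s by (simp add: cot_def power2_eq_square divide_simps)
    (metis mult_cancel_left mult_minus_right of_real_eq_0_iff pi_neq_zero)
qed

lemma unity_exp_sums:
  assumes "Im z > 0"
  shows "(\<lambda>n. unity_exp (of_nat (Suc n) * z)) sums (unity_exp z / (1 - unity_exp z))"
proof -
  have "norm (unity_exp z) < 1" using assms by (simp add: norm_unity_exp)
  then have "(\<lambda>n. unity_exp z * unity_exp z ^ n) sums (unity_exp z * (1 / (1 - unity_exp z)))"
    by (intro sums_mult geometric_sums)
  moreover have "unity_exp z * unity_exp z ^ n = unity_exp (of_nat (Suc n) * z)" for n
    by (simp only: unity_exp_power[symmetric] power_Suc)
  ultimately show ?thesis by simp
qed

lemma cot_eq_unity_exp: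
  assumes "Im z > 0"
  shows "of_real pi * cot (of_real pi * z) = - of_real pi * \<i> * (1 + 2 * (unity_exp z / (1 - unity_exp z)))"
proof -
  define u where "u = exp (\<i> * (of_real pi * z))"
  have u0: "u \<noteq> 0" by (simp add: u_def)
  have e: "unity_exp z = u^2" by (simp add: unity_exp_def u_def power2_eq_square exp_add[symmetric] algebra_simps)
  have "norm (unity_exp z) < 1" using assms by (simp add: norm_unity_exp)
  then have ne: "1 - u^2 \<noteq> 0" using e by auto
  have m: "exp (- (\<i> * (of_real pi * z))) = inverse u" by (simp add: u_def exp_minus)
  have "cot (of_real pi * z) = ((u + inverse u) / 2) / ((u - inverse u) / (2 * \<i>))"
    unfolding cot_def sin_exp_eq cos_exp_eq by (simp add: u_def[symmetric] m)
  also have "\<dots> = \<i> * (u^2 + 1) / (u^2 - 1)"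
    using u0 ne by (simp add: divide_simps power2_eq_square)
  also have "of_real pi * \<dots> = - of_real pi * \<i> * (1 + 2 * (u^2 / (1 - u^2)))"
    using ne by (simp add: divide_simps) (auto simp: algebra_simps)
  finally show ?thesis by (simp add: e)
qed

text \<open>Negative integers are indexed as - (n + 1) because z - (n + 1) = - (1 - z + n), the
  shape in which the terms of \<open>Digamma (1 - z)\<close> and \<open>Polygamma n (1 - z)\<close>
  occur.\<close>

lemma has_sum_int_from_nat:
  fixes f :: "int \<Rightarrow> 'a :: banach"
  assumes "summable (\<lambda>n. norm (f (int n)))" "summable (\<lambda>n. norm (f (- int (Suc n))))"
  shows "(f has_sum ((\<Sum>n. f (int n)) + (\<Sum>n. f (- int (Suc n))))) UNIV"
    and "(\<lambda>n. norm (f n)) summable_on UNIV"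
proof -
  have split: "UNIV = range int \<union> range (\<lambda>n. - int (Suc n))"
  proof -
    have "x \<in> range int \<union> range (\<lambda>n. - int (Suc n))" for x
    proof (cases "x \<ge> 0")
      case True then show ?thesis by (metis UnI1 nonneg_int_cases rangeI)
    next
      case False
      then have "x = - int (Suc (nat (- x - 1)))" by simp
      then show ?thesis by blast
    qed
    then show ?thesis by blast
  qed
  have "(f has_sum (\<Sum>n. f (int n))) (range int)"
    by (subst has_sum_reindex) (auto simp: inj_on_def o_def intro!: norm_summable_imp_has_sum assms summable_sums summable_norm_cancel[OF assms(1)])
  moreover have "(f has_sum (\<Sum>n. f (- int (Suc n)))) (range (\<lambda>n. - int (Suc n)))"
    by (subst has_sum_reindex) (auto simp: inj_on_def o_def simp del: of_nat_Suc intro!: norm_summable_imp_has_sum assms summable_sums summable_norm_cancel[OF assms(2)])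
  moreover have "range int \<inter> range (\<lambda>n. - int (Suc n)) = {}" by auto
  ultimately show "(f has_sum ((\<Sum>n. f (int n)) + (\<Sum>n. f (- int (Suc n))))) UNIV"
    unfolding split by (rule has_sum_Un_disjoint)
  have "(\<lambda>n. norm (f n)) summable_on (range int)"
    by (subst summable_on_reindex) (auto simp: inj_on_def o_def intro!: norm_summable_imp_summable_on assms)
  moreover have "(\<lambda>n. norm (f n)) summable_on (range (\<lambda>n. - int (Suc n)))"
    using assms(2) by (subst summable_on_reindex) (auto simp: inj_on_def o_def simp del: of_nat_Suc intro!: norm_summable_imp_summable_on)
  ultimately show "(\<lambda>n. norm (f n)) summable_on UNIV"
    unfolding split by (rule summable_on_union)
qed


section \<open>Series in powers of the nome\<close>

text \<open>This growth class holds all Fourier coefficients below. It ensures convergence on the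
  whole half-plane and is stable under multiplication by n, that is, under differentiation. With
  \<open>Suc n\<close> instead of n the bound does not force a 0 = 0.\<close>

definition poly_bounded :: "(nat \<Rightarrow> complex) \<Rightarrow> bool" where
  "poly_bounded a \<longleftrightarrow> (\<exists>B p. \<forall>n. norm (a n) \<le> B * real (Suc n) ^ p)"

lemma summable_power_times_geometric:
  fixes x :: real
  assumes "norm x < 1"
  shows "summable (\<lambda>n. real n ^ p * x ^ n)" "summable (\<lambda>n. real (Suc n) ^ p * x ^ n)"
proof -
  have *: "summable (\<lambda>n. real n ^ p * x ^ n)" if "norm x < 1" for x :: real
    using that
  proof (induction p arbitrary: x)
    case 0
    then show ?case by (simp add: summable_geometric)
  next
    case (Suc p)
    \<comment> \<open>The formal derivative of a power series converges inside the same disc and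
      supplies one more factor n.\<close>
    have "summable (\<lambda>n. diffs (\<lambda>n. real n ^ p) n * x ^ n)"
      using Suc.prems Suc.IH by (intro termdiff_converges[where K = 1]) auto
    then have "summable (\<lambda>n. x * (real (Suc n) ^ Suc p * x ^ n))"
      by (intro summable_mult) (simp add: diffs_def)
    then have "summable (\<lambda>n. real (Suc n) ^ Suc p * x ^ Suc n)" by (simp add: mult_ac)
    then show ?case by (subst (asm) summable_Suc_iff)
  qed
  show "summable (\<lambda>n. real n ^ p * x ^ n)" by (rule *[OF assms])
  have "summable (\<lambda>n. diffs (\<lambda>n. real n ^ p) n * x ^ n)"
    using assms * by (intro termdiff_converges[where K = 1]) auto
  then have 1: "summable (\<lambda>n. real (Suc n) * real (Suc n) ^ p * x ^ n)" by (simp add: diffs_def)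
  have "summable (\<lambda>n. norm (real (Suc n) ^ p * x ^ n))"
  proof (rule summable_comparison_test)
    show "\<exists>N. \<forall>n\<ge>N. norm (norm (real (Suc n) ^ p * x ^ n)) \<le> real (Suc n) * real (Suc n) ^ p * norm x ^ n"
    proof (intro exI[of _ 0] allI impI)
      fix n
      have "real (Suc n) ^ p \<le> real (Suc n) * real (Suc n) ^ p"
        using mult_right_mono[of 1 "real (Suc n)" "real (Suc n) ^ p"] by simp
      then show "norm (norm (real (Suc n) ^ p * x ^ n)) \<le> real (Suc n) * real (Suc n) ^ p * norm x ^ n"
        unfolding real_norm_def abs_abs abs_mult power_abs abs_of_nat
        by (intro mult_right_mono) simp_all
    qed
    have "summable (\<lambda>n. diffs (\<lambda>n. real n ^ p) n * norm x ^ n)"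
      using assms * by (intro termdiff_converges[where K = 1]) auto
    then show "summable (\<lambda>n. real (Suc n) * real (Suc n) ^ p * norm x ^ n)" by (simp add: diffs_def)
  qed
  then show "summable (\<lambda>n. real (Suc n) ^ p * x ^ n)" by (rule summable_norm_cancel)
qed

lemma summable_poly_bounded:
  assumes "poly_bounded a" "norm x < 1"
  shows "summable (\<lambda>n. norm (a n * x ^ n))"
proof -
  obtain B p where B: "\<And>n. norm (a n) \<le> B * real (Suc n) ^ p" using assms(1) by (auto simp: poly_bounded_def)
  show ?thesis
  proof (rule summable_comparison_test)
    show "\<exists>N. \<forall>n\<ge>N. norm (norm (a n * x ^ n)) \<le> B * (real (Suc n) ^ p * norm x ^ n)"
      using B by (intro exI[of _ 0] allI impI) (auto simp: norm_mult norm_power mult.assoc[symmetric] intro!: mult_right_mono)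
    show "summable (\<lambda>n. B * (real (Suc n) ^ p * norm x ^ n))"
      using assms(2) by (intro summable_mult summable_power_times_geometric) auto
  qed
qed

text \<open>The variable is q^(1/N), the local parameter at infinity for lattice weights that are
  periodic only modulo N.\<close>

definition nome_series :: "nat \<Rightarrow> (nat \<Rightarrow> complex) \<Rightarrow> complex \<Rightarrow> complex" where
  "nome_series N a z = (\<Sum>n. a n * unity_exp (of_nat n * z / of_nat N))"

lemma nome_power: "unity_exp (of_nat n * z / of_nat N) = unity_exp (z / of_nat N) ^ n"
  by (simp add: unity_exp_power)

lemma norm_nome_less_1: "N > 0 \<Longrightarrow> Im z > 0 \<Longrightarrow> norm (unity_exp (z / of_nat N)) < 1"
  by (simp add: norm_unity_exp)

lemma nome_series_summable:
  assumes "poly_bounded a" "N > 0" "Im z > 0"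
  shows "summable (\<lambda>n. norm (a n * unity_exp (of_nat n * z / of_nat N)))"
  unfolding nome_power using assms by (intro summable_poly_bounded norm_nome_less_1)

lemma nome_series_sums:
  assumes "poly_bounded a" "N > 0" "Im z > 0"
  shows "(\<lambda>n. a n * unity_exp (of_nat n * z / of_nat N)) sums nome_series N a z"
  unfolding nome_series_def by (rule summable_sums[OF summable_norm_cancel[OF nome_series_summable[OF assms]]])

lemma nome_series_has_sum:
  assumes "poly_bounded a" "N > 0" "Im z > 0"
  shows "((\<lambda>n. a n * unity_exp (of_nat n * z / of_nat N)) has_sum nome_series N a z) UNIV"
  using nome_series_summable[OF assms] nome_series_sums[OF assms] by (rule norm_summable_imp_has_sum)

lemma poly_bounded_mult_of_nat:
  assumes "poly_bounded a"
  shows "poly_bounded (\<lambda>n. c * of_nat n * a n)"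
proof -
  obtain B p where B: "\<And>n. norm (a n) \<le> B * real (Suc n) ^ p" using assms(1) by (auto simp: poly_bounded_def)
  have "norm (c * of_nat n * a n) \<le> (norm c * B) * real (Suc n) ^ Suc p" for n
  proof -
    have "norm (c * of_nat n * a n) \<le> norm c * real (Suc n) * (B * real (Suc n) ^ p)"
      unfolding norm_mult using B by (intro mult_mono) auto
    then show ?thesis by (simp add: mult_ac)
  qed
  then show ?thesis unfolding poly_bounded_def by blast
qed

lemma nome_series_deriv:
  assumes "poly_bounded a" "N > 0" "Im z > 0"
  shows "(nome_series N a has_field_derivative
           nome_series N (\<lambda>n. 2 * of_real pi * \<i> / of_nat N * of_nat n * a n) z) (at z within A)"
proof -
  let ?q = "\<lambda>z. unity_exp (z / of_nat N)"
  have s: "summable (\<lambda>n. a n * x ^ n)" if "norm x < 1" for x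
    using summable_poly_bounded[OF assms(1) that] by (rule summable_norm_cancel)
  have q: "norm (?q z) < 1" using assms by (intro norm_nome_less_1)
  have "((\<lambda>x. \<Sum>n. a n * x ^ n) has_field_derivative (\<Sum>n. diffs a n * ?q z ^ n)) (at (?q z))"
    using s q by (rule termdiffs_strong')
  moreover have "(?q has_field_derivative (2 * of_real pi * \<i> / of_nat N * ?q z)) (at z within A)"
    by (rule derivative_eq_intros refl | simp add: assms)+
  ultimately have D: "((\<lambda>z. \<Sum>n. a n * ?q z ^ n) has_field_derivative
      (\<Sum>n. diffs a n * ?q z ^ n) * (2 * of_real pi * \<i> / of_nat N * ?q z)) (at z within A)"
    by (rule DERIV_chain2)
  have "summable (\<lambda>n. diffs a n * ?q z ^ n)" using termdiff_converges[OF q s] .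
  then have "(\<lambda>n. of_nat n * a n * ?q z ^ (n - Suc 0)) sums (\<Sum>n. diffs a n * ?q z ^ n)"
    by (rule diffs_equiv)
  from sums_mult2[OF this, of "2 * of_real pi * \<i> / of_nat N * ?q z"]
  have "(\<lambda>n. 2 * of_real pi * \<i> / of_nat N * of_nat n * a n * ?q z ^ n) sums
     ((\<Sum>n. diffs a n * ?q z ^ n) * (2 * of_real pi * \<i> / of_nat N * ?q z))"
  proof (rule sums_cong[THEN iffD1, rotated])
    fix n show "of_nat n * a n * ?q z ^ (n - Suc 0) * (2 * of_real pi * \<i> / of_nat N * ?q z) =
      2 * of_real pi * \<i> / of_nat N * of_nat n * a n * ?q z ^ n"
      by (cases n) auto
  qed
  then have t: "nome_series N (\<lambda>n. 2 * of_real pi * \<i> / of_nat N * of_nat n * a n) z =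
      (\<Sum>n. diffs a n * ?q z ^ n) * (2 * of_real pi * \<i> / of_nat N * ?q z)"
    unfolding nome_series_def nome_power by (simp only: sums_iff)
  have e: "nome_series N a = (\<lambda>z. \<Sum>n. a n * ?q z ^ n)"
    by (simp only: fun_eq_iff nome_series_def nome_power) simp
  show ?thesis using D unfolding t unfolding e .
qed

text \<open>The polylogarithm of order - p at q. The term n = 0 is removed explicitly because
  \<open>0 ^ 0 = 1\<close>.\<close>

definition power_nome_series :: "nat \<Rightarrow> complex \<Rightarrow> complex" where
  "power_nome_series p = nome_series 1 (\<lambda>n. if n = 0 then 0 else of_nat n ^ p)"

lemma poly_bounded_power: "poly_bounded (\<lambda>n. if n = 0 then 0 else of_nat n ^ p)"
  unfolding poly_bounded_def
  by (intro exI[of _ 1] exI[of _ p]) (auto simp: norm_power intro!: power_mono)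

lemma power_nome_series_deriv:
  assumes "Im z > 0"
  shows "(power_nome_series p has_field_derivative 2 * of_real pi * \<i> * power_nome_series (Suc p) z) (at z within A)"
proof -
  have "nome_series 1 (\<lambda>n. 2 * of_real pi * \<i> / of_nat 1 * of_nat n * (if n = 0 then 0 else of_nat n ^ p)) z =
      2 * of_real pi * \<i> * power_nome_series (Suc p) z"
    unfolding power_nome_series_def nome_series_def
    using nome_series_summable[OF poly_bounded_power zero_less_one assms, of "Suc p", THEN summable_norm_cancel]
    by (subst suminf_mult[symmetric]) (auto intro!: suminf_cong)
  with nome_series_deriv[OF poly_bounded_power zero_less_one assms, of p A]
  show ?thesis by (simp only: power_nome_series_def)
qed

lemma power_nome_series_0:
  assumes "Im z > 0"
  shows "power_nome_series 0 z = unity_exp z / (1 - unity_exp z)"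
proof -
  have "(\<lambda>n. (if n = 0 then 0 else of_nat n ^ 0) * unity_exp (of_nat n * z / of_nat 1)) sums (unity_exp z / (1 - unity_exp z))"
    using unity_exp_sums[OF assms]
      sums_Suc_iff[of "\<lambda>n. (if n = 0 then 0 else of_nat n ^ 0) * unity_exp (of_nat n * z / of_nat 1)"
        "unity_exp z / (1 - unity_exp z)"] by simp
  then show ?thesis by (simp add: power_nome_series_def nome_series_def sums_iff)
qed

text \<open>The case n = 0 is the cotangent series. Each differentiation multiplies the n-th term of
  the series by 2 pi i n and annihilates the constant pi i, so that constant survives for n = 0
  only.\<close>

lemma Polygamma_reflection:
  assumes "Im z > 0"
  shows "Polygamma n z + (-1) ^ Suc n * Polygamma n (1 - z) =
       (if n = 0 then of_real pi * \<i> else 0) + (2 * of_real pi * \<i>) ^ Suc n * power_nome_series n z"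
  using assms
proof (induction n arbitrary: z)
  case 0
  have "Digamma z - Digamma (1 - z) = - (of_real pi * cot (of_real pi * z))"
    using Digamma_reflection[OF 0] by simp
  also have "\<dots> = of_real pi * \<i> * (1 + 2 * power_nome_series 0 z)"
    by (simp only: cot_eq_unity_exp[OF 0] power_nome_series_0[OF 0]) simp
  finally show ?case by (simp add: algebra_simps)
next
  case (Suc n)
  note nz = upper_half_plane_nonint[OF Suc.prems]
  have "((\<lambda>z. Polygamma n z + (-1) ^ Suc n * Polygamma n (1 - z)) has_field_derivative
     Polygamma (Suc n) z + (-1) ^ Suc (Suc n) * Polygamma (Suc n) (1 - z)) (at z)"
    by (rule derivative_eq_intros nz refl | simp)+
  moreover have "((\<lambda>z. (if n = 0 then of_real pi * \<i> else 0) + (2 * of_real pi * \<i>) ^ Suc n * power_nome_series n z)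
      has_field_derivative (2 * of_real pi * \<i>) ^ Suc (Suc n) * power_nome_series (Suc n) z) (at z)"
    by (rule derivative_eq_intros power_nome_series_deriv Suc.prems refl | simp)+
  then have "((\<lambda>z. Polygamma n z + (-1) ^ Suc n * Polygamma n (1 - z)) has_field_derivative
     (2 * of_real pi * \<i>) ^ Suc (Suc n) * power_nome_series (Suc n) z) (at z)"
  proof (rule has_field_derivative_transform_within_open)
    show "open {z. Im z > 0}" by (rule open_halfspace_Im_gt)
  qed (use Suc.prems Suc.IH in auto)
  ultimately show ?case using DERIV_unique by fastforce
qed

section \<open>Absolute convergence along a line and the Lipschitz formula\<close>

text \<open>The imaginary part bounds |c| by |w| / y; the real part then bounds |d|. Adding both
  estimates gives the constant K.\<close>

lemma norm_lattice_point_lower_bound: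
  assumes "Im z > 0"
  obtains e where "e > 0" "\<And>c d :: real. e * (\<bar>c\<bar> + \<bar>d\<bar>) \<le> norm (of_real c * z + of_real d)"
proof -
  define y K where "y = Im z" and "K = 1 + \<bar>Re z\<bar> / y + 1 / y"
  have y: "y > 0" using assms by (simp add: y_def)
  have K: "K > 0" using y by (simp add: K_def add_pos_nonneg)
  have "\<bar>c\<bar> + \<bar>d\<bar> \<le> K * norm (of_real c * z + of_real d)" for c d :: real
  proof -
    define n where "n = norm (of_real c * z + of_real d)"
    have "\<bar>c * y\<bar> \<le> n" using abs_Im_le_cmod[of "of_real c * z + of_real d"] by (simp add: n_def y_def)
    then have c: "\<bar>c\<bar> \<le> n / y" using y by (simp add: abs_mult field_simps)
    have "\<bar>c * Re z + d\<bar> \<le> n" using abs_Re_le_cmod[of "of_real c * z + of_real d"] by (simp add: n_def)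
    then have "\<bar>d\<bar> \<le> n + \<bar>c\<bar> * \<bar>Re z\<bar>" by (simp add: abs_mult[symmetric])
    also have "\<dots> \<le> n + n / y * \<bar>Re z\<bar>" using c by (intro add_left_mono mult_right_mono) auto
    finally show ?thesis using c unfolding K_def n_def[symmetric] by (simp add: algebra_simps)
  qed
  then show ?thesis using K by (intro that[of "1 / K"]) (simp_all add: field_simps)
qed

lemma summable_on_int_inverse_square: "(\<lambda>d::int. 1 / (1 + \<bar>real_of_int d\<bar>)^2) summable_on UNIV"
proof -
  have "summable (\<lambda>n. 1 / (1 + real n)^2)"
  proof -
    have "summable (\<lambda>n. inverse (real n ^ 2))" by (rule inverse_power_summable) simp
    then have "summable (\<lambda>n. inverse (real (Suc n) ^ 2))" by (subst summable_Suc_iff)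
    then show ?thesis by (simp add: field_simps)
  qed
  moreover have "summable (\<lambda>n. 1 / (1 + real (Suc n))^2)"
    using calculation by (subst summable_Suc_iff)
  ultimately show ?thesis
    using has_sum_int_from_nat(2)[of "\<lambda>d::int. 1 / (1 + \<bar>real_of_int d\<bar>)^2"] by simp
qed

lemma inverse_power_abs_summable:
  assumes "Im z > 0" "j \<ge> 2" "\<And>d. norm (f d) \<le> C / norm (z + of_int d) ^ j"
  shows "(\<lambda>d::int. norm (f d)) summable_on UNIV"
proof -
  obtain e where e: "e > 0" "\<And>c d :: real. e * (\<bar>c\<bar> + \<bar>d\<bar>) \<le> norm (of_real c * z + of_real d)"
    using norm_lattice_point_lower_bound[OF assms(1)] by blast
  have "z \<noteq> 0" using assms(1) by auto
  then have "norm z ^ j > 0" by simp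
  then have C: "C \<ge> 0"
    using order_trans[OF norm_ge_zero assms(3)[of 0]] by (simp add: zero_le_divide_iff)
  have "norm (f d) \<le> C / e ^ j * (1 / (1 + \<bar>real_of_int d\<bar>)^2)" for d
  proof -
    have "norm (f d) \<le> C / norm (z + of_int d) ^ j" by (rule assms(3))
    also have "\<dots> \<le> C / (e * (1 + \<bar>real_of_int d\<bar>)) ^ j"
      using C e(1) e(2)[of 1 "real_of_int d"] assms(1)
      by (intro divide_left_mono power_mono mult_pos_pos zero_less_power) (auto simp: complex_eq_iff)
    also have "\<dots> = C / e ^ j * (1 / (1 + \<bar>real_of_int d\<bar>) ^ j)" by (simp add: power_mult_distrib)
    also have "\<dots> \<le> C / e ^ j * (1 / (1 + \<bar>real_of_int d\<bar>)^2)"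
      using C e(1) assms(2) by (intro mult_left_mono divide_left_mono power_increasing) auto
    finally show ?thesis .
  qed
  moreover have "(\<lambda>d. C / e ^ j * (1 / (1 + \<bar>real_of_int d\<bar>)^2)) summable_on UNIV"
    by (intro summable_on_cmult_right summable_on_int_inverse_square)
  ultimately show ?thesis
    using summable_on_comparison_test[of "\<lambda>d. C / e ^ j * (1 / (1 + \<bar>real_of_int d\<bar>)^2)" UNIV "\<lambda>d. norm (f d)"]
      norm_ge_zero by blast
qed

lemma summable_on_int_imp_summable:
  fixes g :: "int \<Rightarrow> real"
  assumes "g summable_on UNIV"
  shows "summable (\<lambda>n. g (int n))" "summable (\<lambda>n. g (- int (Suc n)))"
proof -
  have "g summable_on range int" "g summable_on range (\<lambda>n. - int (Suc n))"
    using assms by (auto intro: summable_on_subset_banach)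
  then have "(g \<circ> int) summable_on UNIV" "(g \<circ> (\<lambda>n. - int (Suc n))) summable_on UNIV"
    by (simp_all add: summable_on_reindex[symmetric] inj_on_def del: of_nat_Suc)
  then show "summable (\<lambda>n. g (int n))" "summable (\<lambda>n. g (- int (Suc n)))"
    by (auto dest!: summable_on_imp_summable simp: o_def)
qed

text \<open>The halves d >= 0 and d < 0 are the series of \<open>Polygamma n z\<close> and
  \<open>Polygamma n (1 - z)\<close>, which the reflection formula combines. From n = 1 on both
  halves converge absolutely.\<close>

lemma Lipschitz_formula:
  assumes "Im z > 0" "n \<ge> 1"
  shows "((\<lambda>d::int. 1 / (z + of_int d) ^ Suc n) has_sum
      ((- (2 * of_real pi * \<i>)) ^ Suc n / fact n * power_nome_series n z)) UNIV"
proof -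
  let ?f = "\<lambda>d::int. 1 / (z + of_int d) ^ Suc n"
  have abs: "(\<lambda>d. norm (?f d)) summable_on UNIV"
    using assms by (intro inverse_power_abs_summable[OF assms(1), of "Suc n" _ 1]) (auto simp: norm_divide norm_power norm_mult)
  note s = summable_on_int_imp_summable[OF abs]
  have P: "Polygamma n w = (-1) ^ Suc n * fact n * (\<Sum>k. inverse ((w + of_nat k) ^ Suc n))" for w :: complex
    using assms(2) by (simp add: Polygamma_def)
  have 1: "(\<Sum>k. ?f (int k)) = (-1) ^ Suc n / fact n * Polygamma n z"
  proof -
    have "(-1) ^ Suc n / fact n * ((-1) ^ Suc n * fact n * X) = X" for X :: complex
      by (cases "even n") auto
    then show ?thesis by (simp only: P) (simp add: divide_inverse)
  qed
  have 2: "(\<Sum>k. ?f (- int (Suc k))) = 1 / fact n * Polygamma n (1 - z)"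
  proof -
    have "?f (- int (Suc k)) = (-1) ^ Suc n * inverse ((1 - z + of_nat k) ^ Suc n)" for k
    proof -
      have "z + of_int (- int (Suc k)) = - (1 - z + of_nat k)" by simp
      then have "?f (- int (Suc k)) = 1 / ((-1) ^ Suc n * (1 - z + of_nat k) ^ Suc n)"
        by (simp only: power_minus[of "1 - z + of_nat k" "Suc n"])
      also have "1 / ((-1) ^ m * X) = (-1) ^ m * inverse X" for m and X :: complex
        by (cases "even m") (auto simp: divide_inverse)
      finally show ?thesis .
    qed
    note eq = this
    have "summable (\<lambda>k. inverse ((1 - z + of_nat k) ^ Suc n))"
    proof -
      have "summable (\<lambda>k. (-1) ^ Suc n * ?f (- int (Suc k)))"
        by (intro summable_mult summable_norm_cancel[OF s(2)])
      then show ?thesis unfolding eq by (cases "even n") simp_all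
    qed
    then show ?thesis unfolding eq by (subst suminf_mult) (simp_all add: P)
  qed
  have "(?f has_sum ((\<Sum>k. ?f (int k)) + (\<Sum>k. ?f (- int (Suc k))))) UNIV"
    using s by (rule has_sum_int_from_nat)
  also have "(\<Sum>k. ?f (int k)) + (\<Sum>k. ?f (- int (Suc k))) =
      (-1) ^ Suc n / fact n * (Polygamma n z + (-1) ^ Suc n * Polygamma n (1 - z))"
    unfolding 1 2 by (simp add: algebra_simps flip: power_mult_distrib add_divide_distrib)
  also have "\<dots> = (- (2 * of_real pi * \<i>)) ^ Suc n / fact n * power_nome_series n z"
    unfolding Polygamma_reflection[OF assms(1)] using assms(2)
    by (simp only: power_minus[of "2 * of_real pi * \<i>"]) simp
  finally show ?thesis .
qed

lemma has_sum_diff: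
  fixes f g :: "'a \<Rightarrow> 'b :: real_normed_vector"
  assumes "(f has_sum S) A" "(g has_sum T) A"
  shows "((\<lambda>x. f x - g x) has_sum (S - T)) A"
  using has_sum_add[of f A S "\<lambda>x. - g x" "- T"] assms by (simp add: has_sum_uminus)

text \<open>Collecting the coefficient of the conjugate of q^n, the powers of 4 pi y give a partial
  sum of the exponential series at 4 pi n y. This is the polynomial factor of an incomplete gamma
  function, and the reason why \<open>beta\<close> appears in the expansion.\<close>

definition line_sum :: "nat \<Rightarrow> complex \<Rightarrow> complex" where
  "line_sum j w = 2 * of_real pi * \<i> * (-1) ^ j / (2 * \<i> * of_real (Im w)) ^ Suc j *
     (1 + power_nome_series 0 w + (\<Sum>i\<le>j. of_real ((4 * pi * Im w) ^ i / fact i) * cnj (power_nome_series i w)))"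

text \<open>Induction by partial fractions: with u and v the two factors and \<delta> = v - u = 2 i
  y, which does not depend on d, 1 / (v u^(j+2)) = (1 / u^(j+2) - 1 / (v u^(j+1))) / \<delta>. The
  first part is a conjugated Lipschitz formula, the second the induction hypothesis.\<close>

theorem has_sum_line_sum:
  assumes "Im w > 0"
  shows "((\<lambda>d::int. 1 / ((w + of_int d) * (cnj w + of_int d) ^ Suc j)) has_sum line_sum j w) UNIV"
proof (induction j)
  case 0
  let ?f = "\<lambda>d::int. 1 / ((w + of_int d) * (cnj w + of_int d) ^ Suc 0)"
  define \<delta> where "\<delta> = 2 * \<i> * of_real (Im w)"
  have \<delta>: "\<delta> = w - cnj w" "\<delta> \<noteq> 0" using assms by (simp_all add: \<delta>_def complex_eq_iff)
  note nz = upper_half_plane_nonint[OF assms]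
  have cn: "norm (cnj w + of_int d) = norm (w + of_int d)" for d
    by (metis complex_cnj_add complex_cnj_of_int complex_mod_cnj)
  have abs: "(\<lambda>d. norm (?f d)) summable_on UNIV"
    by (rule inverse_power_abs_summable[OF assms, of 2 _ 1]) (simp_all add: norm_divide norm_mult cn power2_eq_square)
  note s = summable_on_int_imp_summable[OF abs]
  define g where "g n = inverse (1 - w + of_nat n) - inverse (w + of_nat n)" for n
  define D where "D = Digamma w - Digamma (1 - w)"
  have D: "g sums D"
  proof -
    have "(\<lambda>k. inverse (of_nat (Suc k)) - inverse (u + of_nat k)) sums (Digamma u + euler_mascheroni)" if "u \<notin> \<int>\<^sub>\<le>\<^sub>0" for u :: complex
      using summable_Digamma[of u] that by (auto simp: Digamma_def summable_sums)
    from sums_diff[OF this[OF nz(1)] this[OF nz(2)]] show ?thesis by (simp add: g_def[abs_def] D_def)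
  qed
  \<comment> \<open>The two partial fractions of 1 / (u v) have divergent sums. Pairing d = n with d
    = - (n + 1) combines them into g and its conjugate, whose terms decay quadratically and sum to
    differences of Digamma values.\<close>
  have "?f (int n) + ?f (- int (Suc n)) = (g n - cnj (g n)) / \<delta>" for n
  proof -
    have a: "?f d = (1 / (cnj w + of_int d) - 1 / (w + of_int d)) / \<delta>" for d
      using nz(3)[of d] nz(4)[of d] \<delta> by (simp add: divide_simps)
    have b: "w + of_int (- int (Suc n)) = - (1 - w + of_nat n)" "cnj w + of_int (- int (Suc n)) = - (1 - cnj w + of_nat n)"
      by simp_all
    have "(1 / p - 1 / q) / \<delta> + (1 / (- A) - 1 / (- B)) / \<delta> =
        ((inverse B - inverse q) - (inverse A - inverse p)) / \<delta>" for p q A B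
      by (simp add: divide_inverse algebra_simps)
    then show ?thesis unfolding a unfolding b by (simp only:) (simp add: g_def)
  qed
  moreover have "(\<lambda>n. (g n - cnj (g n)) / \<delta>) sums ((D - cnj D) / \<delta>)"
    using D by (intro sums_divide sums_diff) (simp_all add: sums_cnj)
  moreover have "(\<Sum>n. ?f (int n)) + (\<Sum>n. ?f (- int (Suc n))) = (\<Sum>n. ?f (int n) + ?f (- int (Suc n)))"
    by (rule suminf_add[OF summable_norm_cancel[OF s(1)] summable_norm_cancel[OF s(2)]])
  ultimately have "(\<Sum>n. ?f (int n)) + (\<Sum>n. ?f (- int (Suc n))) = (D - cnj D) / \<delta>"
    by (simp add: sums_iff)
  also have "D = of_real pi * \<i> + 2 * of_real pi * \<i> * power_nome_series 0 w"
    using Polygamma_reflection[OF assms, of 0] by (simp add: D_def)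
  also have "(\<dots> - cnj \<dots>) / \<delta> = line_sum 0 w"
    using assms by (auto simp: line_sum_def \<delta>_def field_simps)
  finally show ?case using has_sum_int_from_nat(1)[of ?f] s by simp
next
  case (Suc j)
  define \<delta> where "\<delta> = 2 * \<i> * of_real (Im w)"
  have \<delta>: "\<delta> = w - cnj w" "\<delta> \<noteq> 0" using assms by (simp_all add: \<delta>_def complex_eq_iff)
  note nz = upper_half_plane_nonint[OF assms]
  have "((\<lambda>d::int. cnj (1 / (w + of_int d) ^ Suc (Suc j))) has_sum
      cnj ((- (2 * of_real pi * \<i>)) ^ Suc (Suc j) / fact (Suc j) * power_nome_series (Suc j) w)) UNIV"
    unfolding has_sum_cnj_iff by (rule Lipschitz_formula[OF assms]) simp
  then have "((\<lambda>d::int. 1 / \<delta> * (cnj (1 / (w + of_int d) ^ Suc (Suc j)) - 1 / ((w + of_int d) * (cnj w + of_int d) ^ Suc j))) has_sum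
     1 / \<delta> * (cnj ((- (2 * of_real pi * \<i>)) ^ Suc (Suc j) / fact (Suc j) * power_nome_series (Suc j) w) - line_sum j w)) UNIV"
    using Suc.IH by (intro has_sum_cmult_right has_sum_diff)
  also have "(\<lambda>d::int. 1 / \<delta> * (cnj (1 / (w + of_int d) ^ Suc (Suc j)) - 1 / ((w + of_int d) * (cnj w + of_int d) ^ Suc j))) =
     (\<lambda>d::int. 1 / ((w + of_int d) * (cnj w + of_int d) ^ Suc (Suc j)))"
  proof
    fix d :: int
    have "1 / \<delta> * (1 / (u * u ^ Suc j) - 1 / (v * u ^ Suc j)) = 1 / (v * (u * u ^ Suc j))"
      if "\<delta> = v - u" "u \<noteq> 0" "v \<noteq> 0" for u v
      using that \<delta>(2) by (simp add: divide_simps)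
    from this[of "w + of_int d" "cnj w + of_int d"]
    show "1 / \<delta> * (cnj (1 / (w + of_int d) ^ Suc (Suc j)) - 1 / ((w + of_int d) * (cnj w + of_int d) ^ Suc j)) =
       1 / ((w + of_int d) * (cnj w + of_int d) ^ Suc (Suc j))"
      using nz \<delta> by simp
  qed
  also have "1 / \<delta> * (cnj ((- (2 * of_real pi * \<i>)) ^ Suc (Suc j) / fact (Suc j) * power_nome_series (Suc j) w) - line_sum j w)
     = line_sum (Suc j) w"
  proof -
    define P where "P = 2 * of_real pi * \<i>"
    define X where "X = 1 + power_nome_series 0 w + (\<Sum>i\<le>j. of_real ((4 * pi * Im w) ^ i / fact i) * cnj (power_nome_series i w))"
    define Q where "Q = cnj (power_nome_series (Suc j) w) / fact (Suc j)"
    have r: "of_real (4 * pi * Im w) = - (\<delta> * P)" by (simp add: \<delta>_def P_def)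
    have L: "line_sum j w = P * (-1) ^ j / \<delta> ^ Suc j * X"
      by (simp add: line_sum_def X_def \<delta>_def P_def)
    have "line_sum (Suc j) w = P * (-1) ^ Suc j / \<delta> ^ Suc (Suc j) * (X + of_real (4 * pi * Im w) ^ Suc j * Q)"
      by (simp add: line_sum_def X_def \<delta>_def P_def Q_def add.assoc)
    also have "\<dots> = 1 / \<delta> * (P ^ Suc (Suc j) * Q - P * (-1) ^ j / \<delta> ^ Suc j * X)"
      unfolding r power_minus[of "\<delta> * P"] using \<delta>(2)
      by (simp add: power_mult_distrib field_simps flip: power_add)
    also have "P ^ Suc (Suc j) * Q = cnj ((- P) ^ Suc (Suc j) / fact (Suc j) * power_nome_series (Suc j) w)"
      by (simp add: Q_def P_def)
    finally show ?thesis by (simp only: L P_def)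
  qed
  finally show ?case .
qed

section \<open>Wirtinger derivatives\<close>

text \<open>Every real linear map of the plane has this form with unique A and B, the derivatives by
  z and by its conjugate. Encoding them in \<open>has_derivative\<close> reduces the product and
  chain rules to those of real derivatives.\<close>

definition has_wirtinger :: "(complex \<Rightarrow> complex) \<Rightarrow> complex \<Rightarrow> complex \<Rightarrow> complex \<Rightarrow> bool" where
  "has_wirtinger f A B z \<longleftrightarrow> (f has_derivative (\<lambda>h. A * h + B * cnj h)) (at z)"

lemma has_wirtinger_unique:
  assumes "has_wirtinger f A B z" "has_wirtinger f A' B' z"
  shows "A = A'" "B = B'"
proof -
  have eq: "(\<lambda>h. A * h + B * cnj h) = (\<lambda>h. A' * h + B' * cnj h)"
    using assms has_derivative_unique unfolding has_wirtinger_def by blast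
  have 1: "A + B = A' + B'" using fun_cong[OF eq, of 1] by simp
  have "\<i> * (A - B) = \<i> * (A' - B')" using fun_cong[OF eq, of \<i>] by (simp add: algebra_simps)
  then have 2: "A - B = A' - B'" by simp
  have "2 * A = (A + B) + (A - B)" "2 * A' = (A' + B') + (A' - B')" by simp_all
  then have "2 * A = 2 * A'" by (simp only: 1 2)
  then show "A = A'" by simp
  then show "B = B'" using 1 by simp
qed

lemma has_wirtinger_holomorphic:
  "(f has_field_derivative A) (at z) \<Longrightarrow> has_wirtinger f A 0 z"
  by (simp add: has_wirtinger_def has_field_derivative_def)

lemma has_wirtinger_const: "has_wirtinger (\<lambda>_. c) 0 0 z"
  by (simp add: has_wirtinger_def)

lemma has_wirtinger_add:
  "has_wirtinger f A B z \<Longrightarrow> has_wirtinger g A' B' z \<Longrightarrow> has_wirtinger (\<lambda>z. f z + g z) (A + A') (B + B') z"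
  unfolding has_wirtinger_def by (drule (1) has_derivative_add) (simp add: algebra_simps)

lemma has_wirtinger_mult:
  "has_wirtinger f A B z \<Longrightarrow> has_wirtinger g A' B' z \<Longrightarrow>
     has_wirtinger (\<lambda>z. f z * g z) (f z * A' + A * g z) (f z * B' + B * g z) z"
  unfolding has_wirtinger_def by (drule (1) has_derivative_mult) (simp add: algebra_simps)

lemma has_wirtinger_cmult: "has_wirtinger f A B z \<Longrightarrow> has_wirtinger (\<lambda>z. c * f z) (c * A) (c * B) z"
  using has_wirtinger_mult[OF has_wirtinger_const[of c z]] by simp

lemma has_wirtinger_cnj:
  assumes "has_wirtinger f A B z"
  shows "has_wirtinger (\<lambda>z. cnj (f z)) (cnj B) (cnj A) z"
proof -
  have "((\<lambda>z. cnj (f z)) has_derivative (\<lambda>h. cnj (A * h + B * cnj h))) (at z)"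
    using assms bounded_linear.has_derivative[OF bounded_linear_cnj] unfolding has_wirtinger_def by blast
  then show ?thesis unfolding has_wirtinger_def by (simp add: add.commute)
qed

lemma has_wirtinger_transform:
  assumes "has_wirtinger f A B z" "open S" "z \<in> S" "\<And>x. x \<in> S \<Longrightarrow> f x = g x"
  shows "has_wirtinger g A B z"
  using assms unfolding has_wirtinger_def by (blast intro: has_derivative_transform_within_open)

text \<open>A holomorphic inner map contributes the conjugate of its derivative to the second
  component. For a Moebius map that derivative is 1 / j^2, the source of two of the automorphy
  factors of the shadow.\<close>

lemma has_wirtinger_compose:
  assumes "has_wirtinger f A B (g z)" "(g has_field_derivative D) (at z)"
  shows "has_wirtinger (\<lambda>z. f (g z)) (A * D) (B * cnj D) z"
proof -
  have "((f \<circ> g) has_derivative ((\<lambda>h. A * h + B * cnj h) \<circ> (\<lambda>h. D * h))) (at z)"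
    using assms unfolding has_wirtinger_def has_field_derivative_def by (intro diff_chain_at) auto
  then show ?thesis by (simp add: has_wirtinger_def o_def algebra_simps)
qed

lemma has_wirtinger_partial:
  assumes "has_wirtinger f A B z"
  shows "partial_x f z = A + B" "partial_y f z = \<i> * (A - B)" "partial_zbar f z = B"
proof -
  have d: "(f has_derivative (\<lambda>h. A * h + B * cnj h)) (at z)" using assms by (simp add: has_wirtinger_def)
  have *: "((\<lambda>s::real. f (z + c * of_real s)) has_vector_derivative (A * c + B * cnj c)) (at 0)" for c
  proof -
    have "((\<lambda>s::real. z + c * of_real s) has_derivative (\<lambda>s. c * of_real s)) (at 0)"
      by (auto intro!: derivative_eq_intros)
    moreover have "(f has_derivative (\<lambda>h. A * h + B * cnj h)) (at (z + c * of_real 0))" using d by simp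
    ultimately have "((f \<circ> (\<lambda>s::real. z + c * of_real s)) has_derivative ((\<lambda>h. A * h + B * cnj h) \<circ> (\<lambda>s. c * of_real s))) (at 0)"
      by (rule diff_chain_at)
    then show ?thesis unfolding has_vector_derivative_def o_def
      by (simp add: scaleR_conv_of_real algebra_simps)
  qed
  show x: "partial_x f z = A + B"
    unfolding partial_x_def using *[of 1] by (simp add: vector_derivative_at)
  show y: "partial_y f z = \<i> * (A - B)"
    unfolding partial_y_def using *[of \<i>] by (simp add: vector_derivative_at algebra_simps)
  show "partial_zbar f z = B"
    unfolding partial_zbar_def x y by (simp add: algebra_simps flip: mult.assoc)
qed

text \<open>The flat Laplacian is four times a mixed derivative. It is kept as 2 (A2 + B1), with
  both orders of differentiation, so that no symmetry of second derivatives has to be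
  proved.\<close>

lemma laplacian_eq:
  assumes "open U" "z \<in> U" "\<And>z. z \<in> U \<Longrightarrow> has_wirtinger f (A z) (B z) z"
    "has_wirtinger A A1 A2 z" "has_wirtinger B B1 B2 z"
  shows "laplacian w f z = of_real (Im z) ^ 2 * (2 * (A2 + B1)) - 2 * \<i> * of_int w * of_real (Im z) * B z"
proof -
  have m: "has_wirtinger (\<lambda>z. - B z) (- B1) (- B2) z"
    using has_wirtinger_cmult[OF assms(5), of "-1"] by simp
  have "has_wirtinger (\<lambda>z. A z + B z) (A1 + B1) (A2 + B2) z"
    by (intro has_wirtinger_add assms)
  then have "has_wirtinger (partial_x f) (A1 + B1) (A2 + B2) z"
    by (rule has_wirtinger_transform[OF _ assms(1,2)]) (simp only: has_wirtinger_partial(1)[OF assms(3)])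
  moreover have "has_wirtinger (\<lambda>z. \<i> * (A z + - B z)) (\<i> * (A1 + - B1)) (\<i> * (A2 + - B2)) z"
    by (intro has_wirtinger_cmult has_wirtinger_add assms m)
  then have "has_wirtinger (partial_y f) (\<i> * (A1 - B1)) (\<i> * (A2 - B2)) z"
  proof -
    assume "has_wirtinger (\<lambda>z. \<i> * (A z + - B z)) (\<i> * (A1 + - B1)) (\<i> * (A2 + - B2)) z"
    then have "has_wirtinger (partial_y f) (\<i> * (A1 + - B1)) (\<i> * (A2 + - B2)) z"
      by (rule has_wirtinger_transform[OF _ assms(1,2)]) (simp add: has_wirtinger_partial(2)[OF assms(3)])
    then show ?thesis by simp
  qed
  ultimately have "partial_x (partial_x f) z + partial_y (partial_y f) z =
      (A1 + B1 + (A2 + B2)) + \<i> * (\<i> * (A1 - B1) - \<i> * (A2 - B2))"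
    by (simp only: has_wirtinger_partial)
  also have "\<dots> = 2 * (A2 + B1)" by (simp add: algebra_simps)
  moreover have "partial_x f z + \<i> * partial_y f z = 2 * B z"
    by (simp add: has_wirtinger_partial[OF assms(3)[OF assms(2)]] algebra_simps)
  ultimately show ?thesis by (simp add: laplacian_def)
qed

section \<open>Real analytic functions\<close>

lemma real_analytic_on_add:
  assumes "real_analytic_on f U" "real_analytic_on g U"
  shows "real_analytic_on (\<lambda>z. f z + g z) U"
  unfolding real_analytic_on_def
proof
  fix z assume z: "z \<in> U"
  obtain r u where u: "r > 0" "\<And>s t. \<bar>s\<bar> < r \<Longrightarrow> \<bar>t\<bar> < r \<Longrightarrow>
        ((\<lambda>(m, n). u (m, n) * of_real s ^ m * of_real t ^ n) has_sum f (z + Complex s t)) UNIV"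
    using assms(1) z unfolding real_analytic_on_def by blast
  obtain r' v where v: "r' > 0" "\<And>s t. \<bar>s\<bar> < r' \<Longrightarrow> \<bar>t\<bar> < r' \<Longrightarrow>
        ((\<lambda>(m, n). v (m, n) * of_real s ^ m * of_real t ^ n) has_sum g (z + Complex s t)) UNIV"
    using assms(2) z unfolding real_analytic_on_def by blast
  have "((\<lambda>(m, n). (u (m, n) + v (m, n)) * of_real s ^ m * of_real t ^ n) has_sum
      f (z + Complex s t) + g (z + Complex s t)) UNIV" if "\<bar>s\<bar> < min r r'" "\<bar>t\<bar> < min r r'" for s t
    using has_sum_add[OF u(2)[of s t] v(2)[of s t]] that by (simp add: case_prod_unfold algebra_simps)
  then show "\<exists>r>0. \<exists>u. \<forall>s t. \<bar>s\<bar> < r \<longrightarrow> \<bar>t\<bar> < r \<longrightarrow>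
      ((\<lambda>(m, n). u (m, n) * of_real s ^ m * of_real t ^ n) has_sum f (z + Complex s t) + g (z + Complex s t)) UNIV"
    using u(1) v(1) by (intro exI[of _ "min r r'"] conjI exI[of _ "\<lambda>x. u x + v x"]) (auto simp: case_prod_unfold)
qed

lemma real_analytic_on_cmult:
  assumes "real_analytic_on f U"
  shows "real_analytic_on (\<lambda>z. c * f z) U"
  unfolding real_analytic_on_def
proof
  fix z assume z: "z \<in> U"
  obtain r u where u: "r > 0" "\<And>s t. \<bar>s\<bar> < r \<Longrightarrow> \<bar>t\<bar> < r \<Longrightarrow>
        ((\<lambda>(m, n). u (m, n) * of_real s ^ m * of_real t ^ n) has_sum f (z + Complex s t)) UNIV"
    using assms(1) z unfolding real_analytic_on_def by blast
  have "((\<lambda>(m, n). (c * u (m, n)) * of_real s ^ m * of_real t ^ n) has_sum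
      c * f (z + Complex s t)) UNIV" if "\<bar>s\<bar> < r" "\<bar>t\<bar> < r" for s t
    using has_sum_cmult_right[OF u(2)[of s t], of c] that by (simp add: case_prod_unfold mult.assoc)
  then show "\<exists>r>0. \<exists>u. \<forall>s t. \<bar>s\<bar> < r \<longrightarrow> \<bar>t\<bar> < r \<longrightarrow>
      ((\<lambda>(m, n). u (m, n) * of_real s ^ m * of_real t ^ n) has_sum c * f (z + Complex s t)) UNIV"
    using u(1) by (intro exI[of _ r] conjI exI[of _ "\<lambda>x. c * u x"]) (auto simp: case_prod_unfold)
qed

lemma real_analytic_on_cnj:
  assumes "real_analytic_on f U"
  shows "real_analytic_on (\<lambda>z. cnj (f z)) U"
  unfolding real_analytic_on_def
proof
  fix z assume z: "z \<in> U"
  obtain r u where u: "r > 0" "\<And>s t. \<bar>s\<bar> < r \<Longrightarrow> \<bar>t\<bar> < r \<Longrightarrow>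
        ((\<lambda>(m, n). u (m, n) * of_real s ^ m * of_real t ^ n) has_sum f (z + Complex s t)) UNIV"
    using assms(1) z unfolding real_analytic_on_def by blast
  have "((\<lambda>(m, n). cnj (u (m, n)) * of_real s ^ m * of_real t ^ n) has_sum
      cnj (f (z + Complex s t))) UNIV" if "\<bar>s\<bar> < r" "\<bar>t\<bar> < r" for s t
    using u(2)[of s t, THEN has_sum_cnj_iff[THEN iffD2]] that by (simp add: case_prod_unfold)
  then show "\<exists>r>0. \<exists>u. \<forall>s t. \<bar>s\<bar> < r \<longrightarrow> \<bar>t\<bar> < r \<longrightarrow>
      ((\<lambda>(m, n). u (m, n) * of_real s ^ m * of_real t ^ n) has_sum cnj (f (z + Complex s t))) UNIV"
    using u(1) by (intro exI[of _ r] conjI exI[of _ "\<lambda>x. cnj (u x)"]) (auto simp: case_prod_unfold)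
qed

lemma real_analytic_on_const: "real_analytic_on (\<lambda>_. c) U"
  unfolding real_analytic_on_def
proof (intro ballI exI[of _ 1] conjI exI[of _ "\<lambda>x. if x = (0,0) then c else 0"] allI impI)
  fix s t :: real
  show "((\<lambda>(m, n). (if (m, n) = (0, 0) then c else 0) * of_real s ^ m * of_real t ^ n) has_sum c) UNIV"
    by (rule has_sum_finite_neutralI[of "{(0,0)}"]) (auto split: if_splits)
qed simp

lemma real_analytic_on_mult_Im:
  assumes "real_analytic_on f U"
  shows "real_analytic_on (\<lambda>z. of_real (Im z) * f z) U"
  unfolding real_analytic_on_def
proof
  fix z assume z: "z \<in> U"
  obtain r u where u: "r > 0" "\<And>s t. \<bar>s\<bar> < r \<Longrightarrow> \<bar>t\<bar> < r \<Longrightarrow>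
        ((\<lambda>(m, n). u (m, n) * of_real s ^ m * of_real t ^ n) has_sum f (z + Complex s t)) UNIV"
    using assms(1) z unfolding real_analytic_on_def by blast
  \<comment> \<open>Since Im (z + s + i t) = Im z + t, the coefficients are scaled by Im z and added
    to their shift in the second index.\<close>
  define u' where "u' = (\<lambda>(m, n). of_real (Im z) * u (m, n) + (if n = 0 then 0 else u (m, n - 1)))"
  have "((\<lambda>(m, n). u' (m, n) * of_real s ^ m * of_real t ^ n) has_sum
      of_real (Im (z + Complex s t)) * f (z + Complex s t)) UNIV" if st: "\<bar>s\<bar> < r" "\<bar>t\<bar> < r" for s t
  proof -
    let ?g = "\<lambda>(m, n). u (m, n) * of_real s ^ m * of_real t ^ n"
    let ?h = "\<lambda>(m, n). (if n = 0 then 0 else u (m, n - 1)) * of_real s ^ m * of_real t ^ n"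
    have g: "(?g has_sum f (z + Complex s t)) UNIV" using u(2) st .
    have "(?h has_sum of_real t * f (z + Complex s t)) (range (\<lambda>(m, n). (m, Suc n)))"
    proof (subst has_sum_reindex)
      show "inj (\<lambda>(m, n). (m, Suc n))" by (auto simp: inj_on_def)
      have "(?h \<circ> (\<lambda>(m, n). (m, Suc n))) = (\<lambda>x. of_real t * ?g x)" by (auto simp: fun_eq_iff)
      then show "(?h \<circ> (\<lambda>(m, n). (m, Suc n)) has_sum of_real t * f (z + Complex s t)) UNIV"
        using has_sum_cmult_right[OF g] by simp
    qed
    also have "?this \<longleftrightarrow> (?h has_sum of_real t * f (z + Complex s t)) UNIV"
    proof (rule has_sum_cong_neutral)
      fix x :: "nat \<times> nat" assume "x \<in> UNIV - range (\<lambda>(m, n). (m, Suc n))"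
      then have "snd x = 0" by (cases x, cases "snd x") (auto simp: image_iff)
      then show "?h x = 0" by (cases x) auto
    qed auto
    finally have "((\<lambda>x. of_real (Im z) * ?g x + ?h x) has_sum
        of_real (Im z) * f (z + Complex s t) + of_real t * f (z + Complex s t)) UNIV"
      by (intro has_sum_add has_sum_cmult_right g)
    then show ?thesis by (simp add: case_prod_unfold u'_def algebra_simps cong: if_cong)
  qed
  then show "\<exists>r>0. \<exists>u. \<forall>s t. \<bar>s\<bar> < r \<longrightarrow> \<bar>t\<bar> < r \<longrightarrow>
      ((\<lambda>(m, n). u (m, n) * of_real s ^ m * of_real t ^ n) has_sum of_real (Im (z + Complex s t)) * f (z + Complex s t)) UNIV"
    using u(1) by blast
qed

text \<open>Expand (s + i t)^N by the binomial theorem in the Taylor series. The double series is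
  dominated by the Taylor series at |s| + |t|, hence converges absolutely if |s| + |t| < R;
  restricting both to R / 2 guarantees this.\<close>

lemma holomorphic_imp_real_analytic_on:
  assumes "f holomorphic_on U" "open U"
  shows "real_analytic_on f U"
  unfolding real_analytic_on_def
proof
  fix z assume z: "z \<in> U"
  obtain R where R: "R > 0" "ball z R \<subseteq> U" using assms(2) z open_contains_ball by blast
  define a where "a n = (deriv ^^ n) f z / fact n" for n
  have hol: "f holomorphic_on ball z R" using assms(1) R(2) by (rule holomorphic_on_subset)
  have a: "(\<lambda>n. a n * w ^ n) sums f (z + w)" if "norm w < R" for w
    using holomorphic_power_series[OF hol, of "z + w"] that by (simp add: a_def dist_norm)
  define u where "u = (\<lambda>(m, n). a (m + n) * of_nat ((m + n) choose m) * \<i> ^ n)"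
  have "((\<lambda>(m, n). u (m, n) * of_real s ^ m * of_real t ^ n) has_sum f (z + Complex s t)) UNIV"
    if st: "\<bar>s\<bar> < R / 2" "\<bar>t\<bar> < R / 2" for s t
  proof -
    let ?g = "\<lambda>(N, m). a N * of_nat (N choose m) * of_real s ^ m * (\<i> * of_real t) ^ (N - m)"
    have sum1: "(\<Sum>m\<le>N. ?g (N, m)) = a N * (of_real s + \<i> * of_real t) ^ N" for N
      by (simp add: binomial_ring sum_distrib_left mult_ac)
    have sum2: "(\<Sum>m\<le>N. norm (?g (N, m))) = norm (a N * of_real (\<bar>s\<bar> + \<bar>t\<bar>) ^ N)" for N
    proof -
      have "(\<Sum>m\<le>N. norm (?g (N, m))) = norm (a N) * (\<Sum>m\<le>N. of_nat (N choose m) * \<bar>s\<bar> ^ m * \<bar>t\<bar> ^ (N - m))"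
        by (simp add: norm_mult norm_power sum_distrib_left mult_ac)
      then show ?thesis by (simp add: binomial_ring[symmetric] norm_mult norm_power del: of_real_add)
    qed
    have st': "\<bar>s\<bar> + \<bar>t\<bar> < R" using st by linarith
    have summ: "summable (\<lambda>N. norm (a N * of_real (\<bar>s\<bar> + \<bar>t\<bar>) ^ N))"
    proof (rule powser_insidea)
      \<comment> \<open>The midpoint of |s| + |t| and R: a larger point at which the power series
        still converges.\<close>
      define K where "K = (\<bar>s\<bar> + \<bar>t\<bar> + R) / 2"
      have K: "\<bar>s\<bar> + \<bar>t\<bar> < K" "K < R" using st' by (auto simp: K_def)
      show "summable (\<lambda>n. a n * of_real K ^ n)" using a[of "of_real K"] K by (auto simp: sums_iff)
      show "norm (of_real (\<bar>s\<bar> + \<bar>t\<bar>) :: complex) < norm (of_real K :: complex)" using K unfolding norm_of_real by simp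
    qed
    have "(\<lambda>x. norm (?g x)) summable_on (SIGMA N:UNIV. {..N})"
    proof (rule Infinite_Sum.abs_summable_on_Sigma_iff[of ?g UNIV atMost, THEN iffD2], intro conjI ballI)
      have "(\<lambda>N. norm (norm (a N * of_real (\<bar>s\<bar> + \<bar>t\<bar>) ^ N))) summable_on UNIV"
        using summ by (intro norm_summable_imp_summable_on) simp
      then show "(\<lambda>N. norm (\<Sum>\<^sub>\<infinity>m\<in>{..N}. norm (?g (N, m)))) summable_on UNIV"
        by (simp only: infsum_finite finite_atMost sum2)
    qed simp
    then have "?g summable_on (SIGMA N:UNIV. {..N})" by (rule abs_summable_summable)
    moreover have "((\<lambda>N. a N * (of_real s + \<i> * of_real t) ^ N) has_sum f (z + Complex s t)) UNIV"
    proof (rule norm_summable_imp_has_sum)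
      have n: "norm (of_real s + \<i> * of_real t) \<le> \<bar>s\<bar> + \<bar>t\<bar>"
        by (rule order_trans[OF norm_triangle_ineq]) (simp add: norm_mult)
      then show "(\<lambda>N. a N * (of_real s + \<i> * of_real t) ^ N) sums f (z + Complex s t)"
        using a[of "of_real s + \<i> * of_real t"] st' by (simp add: Complex_eq)
      show "summable (\<lambda>N. norm (a N * (of_real s + \<i> * of_real t) ^ N))"
        using n by (intro summable_comparison_test[OF _ summ])
          (auto simp: norm_mult norm_power intro!: exI[of _ 0] mult_left_mono power_mono simp del: of_real_add)
    qed
    ultimately have "(?g has_sum f (z + Complex s t)) (SIGMA N:UNIV. {..N})"
    proof -
      assume s: "?g summable_on (SIGMA N:UNIV. {..N})"
        and h: "((\<lambda>N. a N * (of_real s + \<i> * of_real t) ^ N) has_sum f (z + Complex s t)) UNIV"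
      show ?thesis
      proof (rule has_sum_SigmaI[OF _ h s])
        show "((\<lambda>m. ?g (N, m)) has_sum a N * (of_real s + \<i> * of_real t) ^ N) {..N}" for N
          using has_sum_finite[of "{..N}" "\<lambda>m. ?g (N, m)"] unfolding sum1 by simp
      qed
    qed
    also have "?this \<longleftrightarrow> ((\<lambda>(m, n). u (m, n) * of_real s ^ m * of_real t ^ n) has_sum f (z + Complex s t)) UNIV"
      by (rule has_sum_reindex_bij_witness[of _ "\<lambda>(m, n). (m + n, m)" "\<lambda>(N, m). (m, N - m)"])
         (auto simp: u_def power_mult_distrib)
    finally show ?thesis .
  qed
  then show "\<exists>r>0. \<exists>u. \<forall>s t. \<bar>s\<bar> < r \<longrightarrow> \<bar>t\<bar> < r \<longrightarrow>
      ((\<lambda>(m, n). u (m, n) * of_real s ^ m * of_real t ^ n) has_sum f (z + Complex s t)) UNIV"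
    using R(1) by (intro exI[of _ "R / 2"]) auto
qed

lemma real_analytic_on_Im_power: "real_analytic_on f U \<Longrightarrow> real_analytic_on (\<lambda>z. of_real (Im z) ^ n * f z) U"
proof (induction n)
  case (Suc n)
  then show ?case using real_analytic_on_mult_Im[of "\<lambda>z. of_real (Im z) ^ n * f z" U] by (simp add: mult.assoc)
qed simp

lemma real_analytic_on_sum:
  "finite I \<Longrightarrow> (\<And>i. i \<in> I \<Longrightarrow> real_analytic_on (f i) U) \<Longrightarrow> real_analytic_on (\<lambda>z. \<Sum>i\<in>I. f i z) U"
  by (induction I rule: finite_induct) (auto intro: real_analytic_on_add real_analytic_on_const[of 0])

section \<open>Harmonic functions built from two holomorphic functions\<close>

lemma diff_cnj_eq: "z - cnj z = 2 * \<i> * of_real (Im z)"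
  by (simp add: complex_eq_iff)

text \<open>When each H (j + 1) is the derivative of H j, this is formally a Taylor polynomial:
  expand the conjugate of H 0 as a function of the conjugate of z, centred there, and evaluate at z.
  As for every Taylor polynomial, differentiating by the centre leaves a single top term.\<close>

definition antiholo_part :: "nat \<Rightarrow> (nat \<Rightarrow> complex \<Rightarrow> complex) \<Rightarrow> complex \<Rightarrow> complex" where
  "antiholo_part K H z = (\<Sum>j\<le>K. (z - cnj z) ^ j / fact j * cnj (H j z))"

definition harmonic_poly ::
  "nat \<Rightarrow> complex \<Rightarrow> (complex \<Rightarrow> complex) \<Rightarrow> (nat \<Rightarrow> complex \<Rightarrow> complex) \<Rightarrow> complex \<Rightarrow> complex" where
  "harmonic_poly K C P H z = P z + C * of_real (Im z) ^ Suc K + antiholo_part K H z"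

lemma open_upper_half_plane [simp]: "open upper_half_plane"
  unfolding upper_half_plane_def by (rule open_halfspace_Im_gt)

lemma has_wirtinger_power:
  assumes "has_wirtinger f A B z"
  shows "has_wirtinger (\<lambda>z. f z ^ Suc j) (of_nat (Suc j) * f z ^ j * A) (of_nat (Suc j) * f z ^ j * B) z"
proof (induction j)
  case (Suc j)
  from has_wirtinger_mult[OF assms this] show ?case by (simp add: algebra_simps)
qed (use assms in simp)

lemma has_wirtinger_diff_cnj_power:
  "has_wirtinger (\<lambda>z. (z - cnj z) ^ Suc j / fact (Suc j)) ((z - cnj z) ^ j / fact j) (- ((z - cnj z) ^ j / fact j)) z"
proof -
  have "has_wirtinger (\<lambda>z. z - cnj z) 1 (-1) z"
    unfolding has_wirtinger_def by (auto intro!: derivative_eq_intros bounded_linear.has_derivative[OF bounded_linear_cnj])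
  from has_wirtinger_cmult[OF has_wirtinger_power[OF this, of j], of "1 / fact (Suc j)"]
  have "has_wirtinger (\<lambda>z. 1 / fact (Suc j) * (z - cnj z) ^ Suc j)
     (1 / fact (Suc j) * (of_nat (Suc j) * (z - cnj z) ^ j * 1)) (1 / fact (Suc j) * (of_nat (Suc j) * (z - cnj z) ^ j * - 1)) z" .
  moreover have "1 / fact (Suc j) * (of_nat (Suc j) * X) = X / fact j" for X :: complex
    by (simp add: divide_simps del: of_nat_Suc)
  ultimately show ?thesis by (simp add: mult.assoc del: power_Suc fact_Suc of_nat_Suc)
qed

lemma has_wirtinger_Im_power:
  "has_wirtinger (\<lambda>z. of_real (Im z) ^ Suc j) (of_nat (Suc j) * of_real (Im z) ^ j / (2 * \<i>))
     (- (of_nat (Suc j) * of_real (Im z) ^ j / (2 * \<i>))) z"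
proof -
  have "(\<lambda>h. of_real (Im h)) = (\<lambda>h. 1 / (2 * \<i>) * h + - (1 / (2 * \<i>)) * cnj h)"
    by (auto simp: fun_eq_iff complex_eq_iff)
  moreover have "((\<lambda>z. of_real (Im z) :: complex) has_derivative (\<lambda>h. of_real (Im h))) (at z)"
    by (auto intro!: derivative_eq_intros)
  ultimately have "has_wirtinger (\<lambda>z. of_real (Im z)) (1 / (2 * \<i>)) (- (1 / (2 * \<i>))) z"
    by (simp only: has_wirtinger_def)
  from has_wirtinger_power[OF this, of j] show ?thesis by (simp add: mult_ac)
qed

lemma has_wirtinger_antiholo_part:
  assumes "\<And>j. (H j has_field_derivative H (Suc j) z) (at z)"
  shows "has_wirtinger (antiholo_part K H) (\<Sum>j<K. (z - cnj z) ^ j / fact j * cnj (H (Suc j) z))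
           ((z - cnj z) ^ K / fact K * cnj (H (Suc K) z)) z"
proof (induction K)
  case 0
  show ?case using has_wirtinger_cnj[OF has_wirtinger_holomorphic[OF assms[of 0]]]
    by (simp add: antiholo_part_def[abs_def])
next
  case (Suc K)
  have "antiholo_part (Suc K) H = (\<lambda>z. antiholo_part K H z + (z - cnj z) ^ Suc K / fact (Suc K) * cnj (H (Suc K) z))"
    by (simp add: antiholo_part_def[abs_def])
  moreover have "has_wirtinger (\<lambda>z. (z - cnj z) ^ Suc K / fact (Suc K) * cnj (H (Suc K) z))
      ((z - cnj z) ^ Suc K / fact (Suc K) * cnj 0 + (z - cnj z) ^ K / fact K * cnj (H (Suc K) z))
      ((z - cnj z) ^ Suc K / fact (Suc K) * cnj (H (Suc (Suc K)) z) + - ((z - cnj z) ^ K / fact K) * cnj (H (Suc K) z)) z"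
    by (intro has_wirtinger_mult has_wirtinger_cnj has_wirtinger_holomorphic assms has_wirtinger_diff_cnj_power)
  from has_wirtinger_add[OF Suc.IH this]
  have "has_wirtinger (\<lambda>z. antiholo_part K H z + (z - cnj z) ^ Suc K / fact (Suc K) * cnj (H (Suc K) z))
    (\<Sum>j<Suc K. (z - cnj z) ^ j / fact j * cnj (H (Suc j) z))
    ((z - cnj z) ^ Suc K / fact (Suc K) * cnj (H (Suc (Suc K)) z)) z"
    by (simp only: complex_cnj_zero mult_zero_right add_0 sum.lessThan_Suc mult_minus_left add.assoc
        add.commute[of "- _"] add.left_commute[of "- _"] right_minus add_0_right) simp
  ultimately show ?case by simp
qed

context
  fixes K :: nat and C :: complex and P P' :: "complex \<Rightarrow> complex" and H
  assumes P: "\<And>z. z \<in> upper_half_plane \<Longrightarrow> (P has_field_derivative P' z) (at z)"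
    and P': "P' holomorphic_on upper_half_plane"
    and H: "\<And>j z. z \<in> upper_half_plane \<Longrightarrow> (H j has_field_derivative H (Suc j) z) (at z)"
begin

lemma has_wirtinger_harmonic_poly:
  assumes "z \<in> upper_half_plane"
  shows "has_wirtinger (harmonic_poly K C P H)
     (P' z + C * (of_nat (Suc K) * of_real (Im z) ^ K / (2 * \<i>)) + (\<Sum>j<K. (z - cnj z) ^ j / fact j * cnj (H (Suc j) z)))
     (- (C * (of_nat (Suc K) * of_real (Im z) ^ K / (2 * \<i>))) + (z - cnj z) ^ K / fact K * cnj (H (Suc K) z)) z"
proof -
  have "has_wirtinger (\<lambda>z. P z + C * of_real (Im z) ^ Suc K + antiholo_part K H z)
     (P' z + C * (of_nat (Suc K) * of_real (Im z) ^ K / (2 * \<i>)) + (\<Sum>j<K. (z - cnj z) ^ j / fact j * cnj (H (Suc j) z)))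
     (0 + C * - (of_nat (Suc K) * of_real (Im z) ^ K / (2 * \<i>)) + (z - cnj z) ^ K / fact K * cnj (H (Suc K) z)) z"
    by (intro has_wirtinger_add has_wirtinger_cmult has_wirtinger_Im_power has_wirtinger_antiholo_part
        has_wirtinger_holomorphic P H assms)
  then show ?thesis by (simp add: harmonic_poly_def[abs_def])
qed

text \<open>After telescoping, the derivative by the conjugate of z is (Im z)^K times an
  antiholomorphic function. The factor (Im z)^(-K) in \<open>xi\<close> cancels the power, and
  conjugation makes the result holomorphic.\<close>

lemma xi_harmonic_poly:
  assumes "z \<in> upper_half_plane"
  shows "xi (- int K) (harmonic_poly K C P H) z =
    of_nat (Suc K) * cnj C + 2 * \<i> * (- 2 * \<i>) ^ K / fact K * H (Suc K) z"
proof -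
  have y: "Im z > 0" using assms by (simp add: upper_half_plane_def)
  define p :: complex where "p = (- 2 * \<i>) ^ K"
  have "cnj z - z = - 2 * \<i> * of_real (Im z)" by (simp add: complex_eq_iff)
  then have e: "(cnj z - z) ^ K = p * of_real (Im z) ^ K" by (simp only: p_def power_mult_distrib)
  have "xi (- int K) (harmonic_poly K C P H) z = 2 * \<i> * of_real (Im z) powi (- int K) *
     cnj (- (C * (of_nat (Suc K) * of_real (Im z) ^ K / (2 * \<i>))) + (z - cnj z) ^ K / fact K * cnj (H (Suc K) z))"
    by (simp only: xi_def has_wirtinger_partial(3)[OF has_wirtinger_harmonic_poly[OF assms]])
  also have "\<dots> = of_nat (Suc K) * cnj C + 2 * \<i> * (- 2 * \<i>) ^ K / fact K * H (Suc K) z"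
    unfolding p_def[symmetric] using y by (simp add: power_int_minus e field_simps)
  finally show ?thesis .
qed

text \<open>Since B is y^K times an antiholomorphic function, its derivative by z is K / (2 i y) B.
  So 4 y^2 times this derivative is - 2 i K y B, which cancels the first-order term of the Laplacian
  of weight - K.\<close>

lemma laplacian_harmonic_poly:
  assumes "z \<in> upper_half_plane"
  shows "laplacian (- int K) (harmonic_poly K C P H) z = 0"
proof -
  let ?A = "\<lambda>z. P' z + C * (of_nat (Suc K) * of_real (Im z) ^ K / (2 * \<i>)) + (\<Sum>j<K. (z - cnj z) ^ j / fact j * cnj (H (Suc j) z))"
  let ?B = "\<lambda>z. - (C * (of_nat (Suc K) * of_real (Im z) ^ K / (2 * \<i>))) + (z - cnj z) ^ K / fact K * cnj (H (Suc K) z)"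
  have "\<exists>A1. has_wirtinger P' A1 0 z"
    using P' assms holomorphic_derivI open_upper_half_plane has_wirtinger_holomorphic by metis
  then obtain P1 where P1: "has_wirtinger P' P1 0 z" by blast
  note HK = has_wirtinger_cnj[OF has_wirtinger_holomorphic[OF H[OF assms]]]
  note L = laplacian_eq[OF open_upper_half_plane assms has_wirtinger_harmonic_poly]
  show ?thesis
  \<comment> \<open>For K = 0 the powers y^K and (z - z')^K are constants; for K = Suc J the rule
    for a derivative of a positive power applies.\<close>
  proof (cases K)
    case 0
    have A: "has_wirtinger ?A P1 0 z"
      using has_wirtinger_add[OF P1 has_wirtinger_const[of "C * (of_nat (Suc 0) * 1 / (2 * \<i>))" z]] by (simp add: 0)
    have B: "has_wirtinger ?B 0 (cnj (H 2 z)) z"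
      using has_wirtinger_add[OF has_wirtinger_const[of "- (C * (of_nat (Suc 0) * 1 / (2 * \<i>)))" z] HK[of 1]]
      by (simp add: 0 numeral_2_eq_2)
    show ?thesis using L[OF _ A B] by (simp add: 0)
  next
    case (Suc J)
    define c where "c = C * of_nat (Suc K) / (2 * \<i>)"
    define D where "D = (z - cnj z) ^ J / fact J * cnj (H (Suc K) z)"
    let ?y' = "of_nat (Suc J) * of_real (Im z) ^ J / (2 * \<i>)"
    have eqA: "?A = (\<lambda>z. P' z + c * of_real (Im z) ^ Suc J + antiholo_part J (\<lambda>j. H (Suc j)) z)"
      by (simp add: Suc antiholo_part_def lessThan_Suc_atMost c_def fun_eq_iff)
    have A: "has_wirtinger ?A (P1 + c * ?y' + (\<Sum>j<J. (z - cnj z) ^ j / fact j * cnj (H (Suc (Suc j)) z)))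
        (0 + c * - ?y' + D) z"
      unfolding eqA unfolding D_def Suc
      by (intro has_wirtinger_add has_wirtinger_cmult has_wirtinger_Im_power P1 has_wirtinger_antiholo_part H assms)
    have eqB: "?B = (\<lambda>z. (- c) * of_real (Im z) ^ Suc J + (z - cnj z) ^ Suc J / fact (Suc J) * cnj (H (Suc K) z))"
      by (simp add: Suc c_def fun_eq_iff)
    have B: "has_wirtinger ?B ((- c) * ?y' + ((z - cnj z) ^ Suc J / fact (Suc J) * cnj 0 + D))
       ((- c) * - ?y' + ((z - cnj z) ^ Suc J / fact (Suc J) * cnj (H (Suc (Suc K)) z) + - ((z - cnj z) ^ J / fact J) * cnj (H (Suc K) z))) z"
      unfolding eqB D_def
      by (intro has_wirtinger_add has_wirtinger_cmult has_wirtinger_Im_power has_wirtinger_mult HK has_wirtinger_diff_cnj_power)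
    have D: "(z - cnj z) ^ K / fact K * cnj (H (Suc K) z) = 2 * \<i> * of_real (Im z) * D / of_nat (Suc J)"
    proof -
      have "\<delta> ^ K / fact K * X = \<delta> * (\<delta> ^ J / fact J * X) / of_nat (Suc J)" for \<delta> X :: complex
        unfolding Suc by (simp add: field_simps del: of_nat_Suc)
      then show ?thesis by (simp only: D_def diff_cnj_eq)
    qed
    have c: "C * (of_nat (Suc K) * of_real (Im z) ^ K / (2 * \<i>)) = c * of_real (Im z) ^ Suc J"
      by (simp add: c_def Suc)
    have nz: "of_nat (Suc J) \<noteq> (0::complex)" by (simp del: of_nat_Suc)
    have "laplacian (- int K) (harmonic_poly K C P H) z =
      of_real (Im z) ^ 2 * (2 * ((0 + c * - ?y' + D) + ((- c) * ?y' + ((z - cnj z) ^ Suc J / fact (Suc J) * cnj 0 + D)))) -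
       2 * \<i> * of_int (- int K) * of_real (Im z) * (- (c * of_real (Im z) ^ Suc J) + 2 * \<i> * of_real (Im z) * D / of_nat (Suc J))"
      using L[OF _ A B] by (simp only: D c)
    also have "of_int (- int K) = - (of_nat (Suc J) :: complex)" by (simp add: Suc)
    also have "of_real (Im z) ^ 2 * (2 * ((0 + c * - ?y' + D) + ((- c) * ?y' + ((z - cnj z) ^ Suc J / fact (Suc J) * cnj 0 + D)))) -
       2 * \<i> * - of_nat (Suc J) * of_real (Im z) * (- (c * of_real (Im z) ^ Suc J) + 2 * \<i> * of_real (Im z) * D / of_nat (Suc J)) = 0"
      using nz by (simp add: field_simps power2_eq_square del: of_nat_Suc)
    finally show ?thesis .
  qed
qed

lemma real_analytic_harmonic_poly: "real_analytic_on (harmonic_poly K C P H) upper_half_plane"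
proof -
  have "P holomorphic_on upper_half_plane"
    using P by (auto simp: holomorphic_on_open open_upper_half_plane)
  moreover have "H j holomorphic_on upper_half_plane" for j
    using H by (auto simp: holomorphic_on_open open_upper_half_plane)
  ultimately have "real_analytic_on (\<lambda>z. P z + C * (of_real (Im z) ^ Suc K * 1) +
     (\<Sum>j\<le>K. of_real (Im z) ^ j * ((2 * \<i>) ^ j / fact j * cnj (H j z)))) upper_half_plane"
    by (intro real_analytic_on_add real_analytic_on_sum real_analytic_on_cmult real_analytic_on_Im_power
        real_analytic_on_cnj holomorphic_imp_real_analytic_on real_analytic_on_const) auto
  then show ?thesis
    by (simp add: harmonic_poly_def[abs_def] antiholo_part_def diff_cnj_eq power_mult_distrib mult_ac)
qed

end

section \<open>Lattice sums\<close>

text \<open>The Weierstrass M-test, with n as the parameter, makes the finite partial sums converge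
  uniformly in n; this permits exchanging the limit in n with the limit over finite sets.\<close>

lemma infsum_dominated_convergence:
  fixes f :: "nat \<Rightarrow> 'a \<Rightarrow> complex"
  assumes "\<And>n x. x \<in> X \<Longrightarrow> norm (f n x) \<le> M x" "M summable_on X"
    "\<And>x. x \<in> X \<Longrightarrow> (\<lambda>n. f n x) \<longlonglongrightarrow> g x"
  shows "(\<lambda>n. \<Sum>\<^sub>\<infinity>x\<in>X. f n x) \<longlonglongrightarrow> (\<Sum>\<^sub>\<infinity>x\<in>X. g x)" "(\<lambda>x. norm (g x)) summable_on X"
proof -
  have bound: "norm (g x) \<le> M x" if "x \<in> X" for x
    using that assms(1) by (intro Lim_bounded[OF tendsto_norm[OF assms(3)[OF that]], of 0]) auto
  show sum: "(\<lambda>x. norm (g x)) summable_on X"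
    by (rule Infinite_Sum.abs_summable_on_comparison_test'[OF assms(2) bound])
  then have "g summable_on X" by (rule abs_summable_summable)
  then have g: "((\<lambda>F. \<Sum>x\<in>F. g x) \<longlongrightarrow> (\<Sum>\<^sub>\<infinity>x\<in>X. g x)) (finite_subsets_at_top X)"
    by (simp add: infsum_tendsto)
  have "uniform_limit UNIV (\<lambda>F n. \<Sum>x\<in>F. f n x) (\<lambda>n. \<Sum>\<^sub>\<infinity>x\<in>X. f n x) (finite_subsets_at_top X)"
    using assms(1,2) by (rule Weierstrass_m_test_general)
  moreover have "\<forall>\<^sub>F F in finite_subsets_at_top X. (\<lambda>n. \<Sum>x\<in>F. f n x) \<longlonglongrightarrow> (\<Sum>x\<in>F. g x)"
    using assms(3) by (intro eventually_finite_subsets_at_top_weakI tendsto_sum) auto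
  ultimately show "(\<lambda>n. \<Sum>\<^sub>\<infinity>x\<in>X. f n x) \<longlonglongrightarrow> (\<Sum>\<^sub>\<infinity>x\<in>X. g x)"
    using swap_uniform_limit'[OF _ g, of "\<lambda>F n. \<Sum>x\<in>F. f n x" sequentially UNIV] by simp
qed

text \<open>The summand 1 makes 1 / latw v ^ p meaningful at the origin, so bounds and summability
  can be stated for all pairs.\<close>

definition latw :: "int \<times> int \<Rightarrow> real" where
  "latw v = 1 + \<bar>real_of_int (fst v)\<bar> + \<bar>real_of_int (snd v)\<bar>"

lemma latw_ge_1: "latw v \<ge> 1" by (simp add: latw_def)

text \<open>As (1 + |c|) (1 + |d|) is at most the square of the weight, the inverse cube is at most
  a product of two one-variable functions with exponent 3/2 > 1.\<close>

lemma summable_on_latw_cube: "(\<lambda>v. 1 / latw v ^ 3) summable_on UNIV"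
proof -
  define h where "h c = (1 + \<bar>real_of_int c\<bar>) powr (-(3/2))" for c
  have s: "summable (\<lambda>n. real n powr (-(3/2)))" by (simp add: summable_real_powr_iff)
  have "summable (\<lambda>n. real (Suc n) powr (-(3/2)))" using s by (subst summable_Suc_iff)
  moreover have "summable (\<lambda>n. real (Suc (Suc n)) powr (-(3/2)))"
    using calculation by (subst summable_Suc_iff)
  ultimately have "(\<lambda>c. norm (h c)) summable_on UNIV"
    by (intro has_sum_int_from_nat(2)) (simp_all add: h_def add.commute)
  then have h: "h summable_on UNIV" by (simp add: h_def[abs_def])
  have "(\<lambda>x. h (fst x) * h (snd x)) summable_on UNIV \<times> UNIV"
  proof (rule summable_on_SigmaI[where g = "\<lambda>c. h c * infsum h UNIV"])
    show "((\<lambda>d. h (fst (c, d)) * h (snd (c, d))) has_sum h c * infsum h UNIV) UNIV" for c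
      using h by (simp add: has_sum_cmult_right)
    show "(\<lambda>c. h c * infsum h UNIV) summable_on UNIV" using h by (rule summable_on_cmult_left)
  qed (simp add: h_def)
  then have hh: "(\<lambda>x. h (fst x) * h (snd x)) summable_on UNIV" by simp
  have "1 / latw v ^ 3 \<le> h (fst v) * h (snd v)" for v
  proof -
    let ?a = "\<bar>real_of_int (fst v)\<bar>" and ?b = "\<bar>real_of_int (snd v)\<bar>"
    have "(1 + ?a) * (1 + ?b) \<le> latw v ^ 2"
      by (simp add: latw_def power2_eq_square algebra_simps)
    then have "(latw v ^ 2) powr (-(3/2)) \<le> ((1 + ?a) * (1 + ?b)) powr (-(3/2))"
      by (intro powr_mono2') auto
    moreover have "(latw v ^ 2) powr (-(3/2)) = 1 / latw v ^ 3"
    proof -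
      have l: "latw v > 0" using latw_ge_1[of v] by simp
      have "(latw v ^ 2) powr (-(3/2)) = (latw v powr 2) powr (-(3/2))" using l by simp
      also have "\<dots> = latw v powr (- 3)" by (simp only: powr_powr) simp
      also have "\<dots> = 1 / latw v ^ 3" using l by (simp add: powr_minus divide_inverse)
      finally show ?thesis .
    qed
    ultimately show ?thesis by (simp add: h_def powr_mult)
  qed
  then show ?thesis
    using latw_ge_1 by (intro summable_on_comparison_test[OF hh]) (auto simp: order_trans[OF zero_le_one])
qed

definition lat_point :: "complex \<Rightarrow> int \<times> int \<Rightarrow> complex" where
  "lat_point z v = of_int (fst v) * z + of_int (snd v)"

lemma lat_point_bounds:
  assumes "Im z > 0"
  obtains e where "e > 0" "\<And>v. v \<noteq> (0,0) \<Longrightarrow> e * latw v \<le> norm (lat_point z v)"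
proof -
  obtain e where e: "e > 0" "\<And>c d :: real. e * (\<bar>c\<bar> + \<bar>d\<bar>) \<le> norm (of_real c * z + of_real d)"
    using norm_lattice_point_lower_bound[OF assms] by blast
  have "e / 2 * latw v \<le> norm (lat_point z v)" if "v \<noteq> (0,0)" for v
  proof -
    have "\<bar>fst v\<bar> + \<bar>snd v\<bar> \<ge> 1" using that by (cases v) auto
    then have "\<bar>real_of_int (fst v)\<bar> + \<bar>real_of_int (snd v)\<bar> \<ge> 1" by linarith
    then have "e / 2 * latw v \<le> e * (\<bar>real_of_int (fst v)\<bar> + \<bar>real_of_int (snd v)\<bar>)"
      using mult_left_mono[of 1 "\<bar>real_of_int (fst v)\<bar> + \<bar>real_of_int (snd v)\<bar>" e] e(1)
      by (simp add: latw_def field_simps)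
    also have "\<dots> \<le> norm (lat_point z v)" using e(2)[of "real_of_int (fst v)" "real_of_int (snd v)"]
      by (simp add: lat_point_def)
    finally show ?thesis .
  qed
  then show ?thesis using e(1) by (intro that[of "e / 2"]) auto
qed

lemma lat_point_eq_0_iff:
  assumes "Im z > 0"
  shows "lat_point z v = 0 \<longleftrightarrow> v = (0, 0)"
  using assms by (cases v) (auto simp: lat_point_def complex_eq_iff)

text \<open>K stands for k - 2. At the origin the denominator is 0 and the term is 0 by convention,
  so sums over all pairs leave out the origin.\<close>

definition lat_term :: "nat \<Rightarrow> complex \<Rightarrow> int \<times> int \<Rightarrow> complex" where
  "lat_term K z v = of_real (Im z) ^ Suc K / (lat_point z v * cnj (lat_point z v) ^ Suc K)"

lemma lat_term_bound:
  assumes "Im z > 0"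
  obtains C where "C \<ge> 0" "\<And>v. norm (lat_term K z v) \<le> C / latw v ^ (K + 2)"
proof -
  obtain e where e: "e > 0" "\<And>v. v \<noteq> (0,0) \<Longrightarrow> e * latw v \<le> norm (lat_point z v)"
    using lat_point_bounds[OF assms] by blast
  define C where "C = Im z ^ Suc K / e ^ (K + 2)"
  have "norm (lat_term K z v) \<le> C / latw v ^ (K + 2)" for v
  proof (cases "v = (0, 0)")
    case True
    then show ?thesis using assms e(1) latw_ge_1[of v] by (simp add: lat_term_def lat_point_def C_def)
  next
    case False
    have l: "latw v > 0" using latw_ge_1[of v] by simp
    have "norm (lat_term K z v) = Im z ^ Suc K / norm (lat_point z v) ^ (K + 2)"
      using assms by (simp add: lat_term_def norm_divide norm_mult norm_power)
    also have "\<dots> \<le> Im z ^ Suc K / (e * latw v) ^ (K + 2)"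
      using False e l assms lat_point_eq_0_iff[OF assms]
      by (intro divide_left_mono power_mono mult_pos_pos zero_less_power) auto
    also have "\<dots> = C / latw v ^ (K + 2)" by (simp only: C_def power_mult_distrib) simp
    finally show ?thesis .
  qed
  moreover have "C \<ge> 0" using assms e(1) by (simp add: C_def)
  ultimately show ?thesis using that by blast
qed

lemma summable_on_bounded_by_latw_cube:
  assumes "\<And>v. norm (g v) \<le> C / latw v ^ 3"
  shows "(\<lambda>v. norm (g v)) summable_on A"
proof -
  have "(\<lambda>v. C * (1 / latw v ^ 3)) summable_on UNIV"
    by (intro summable_on_cmult_right summable_on_latw_cube)
  then have "(\<lambda>v. norm (g v)) summable_on UNIV"
    by (rule Infinite_Sum.abs_summable_on_comparison_test') (use assms in simp)
  then show ?thesis by (rule summable_on_subset_banach) simp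
qed

definition residue_box :: "nat \<Rightarrow> (int \<times> int) set" where "residue_box N = {0..<int N} \<times> {0..<int N}"

lemma finite_residue_box [simp]: "finite (residue_box N)" by (simp add: residue_box_def)

definition lat_shift :: "nat \<Rightarrow> int \<times> int \<Rightarrow> int \<times> int \<Rightarrow> int \<times> int" where
  "lat_shift N l r = (int N * fst l + fst r, int N * snd l + snd r)"

lemma has_sum_blocks:
  fixes g :: "int \<times> int \<Rightarrow> complex"
  assumes "(g has_sum S) UNIV" "N > 0"
  shows "((\<lambda>l. \<Sum>r\<in>residue_box N. g (lat_shift N l r)) has_sum S) UNIV"
proof (rule has_sum_SigmaD)
  show "((\<lambda>(l, r). g (lat_shift N l r)) has_sum S) (SIGMA l:UNIV. residue_box N)"
  proof (rule has_sum_reindex_bij_witness[THEN iffD2])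
    show "(g has_sum S) UNIV" by fact
    show "(\<lambda>(l, r). lat_shift N l r) ((\<lambda>v. ((fst v div int N, snd v div int N), (fst v mod int N, snd v mod int N))) v) = v" for v
      by (simp add: lat_shift_def)
  qed (use assms(2) in \<open>auto simp: lat_shift_def residue_box_def\<close>)
  show "((\<lambda>r. case (l, r) of (l, r) \<Rightarrow> g (lat_shift N l r)) has_sum (\<Sum>r\<in>residue_box N. g (lat_shift N l r))) (residue_box N)" for l
    by simp
qed

text \<open>Summing over blocks of residues makes the series converge absolutely for \<open>K = 0\<close> too,
  provided that the weights of a block add up to 0.\<close>

definition lat_sum :: "nat \<Rightarrow> nat \<Rightarrow> (int \<times> int \<Rightarrow> complex) \<Rightarrow> complex \<Rightarrow> complex" where
  "lat_sum N K \<phi> z = (\<Sum>\<^sub>\<infinity>l. \<Sum>r\<in>residue_box N. \<phi> r * lat_term K z (lat_shift N l r))"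

text \<open>These conditions are preserved by the modular group, so a statement at infinity about an
  arbitrary weight of this kind is a statement at every cusp. The parity condition makes the rows c
  and - c contribute equally.\<close>

locale lattice_weight =
  fixes N K :: nat and \<phi> :: "int \<times> int \<Rightarrow> complex"
  assumes N: "N > 0"
    and periodic: "\<And>a b m n. \<phi> (a + int N * m, b + int N * n) = \<phi> (a, b)"
    and parity: "\<And>a b. \<phi> (- a, - b) = (-1) ^ K * \<phi> (a, b)"
    and sum_residue_box_zero: "K = 0 \<Longrightarrow> (\<Sum>r\<in>residue_box N. \<phi> r) = 0"
begin

lemma \<phi>_shift [simp]: "\<phi> (lat_shift N l r) = \<phi> r"
  using periodic[of "fst r" "fst l" "snd r" "snd l"] by (simp add: lat_shift_def add.commute)

lemma \<phi>_bounded: obtains B where "B \<ge> 0" "\<And>v. norm (\<phi> v) \<le> B"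
proof -
  define B where "B = (\<Sum>r\<in>residue_box N. norm (\<phi> r))"
  have "norm (\<phi> v) \<le> B" for v
  proof -
    define r where "r = (fst v mod int N, snd v mod int N)"
    have "v = lat_shift N (fst v div int N, snd v div int N) r" by (simp add: lat_shift_def r_def)
    then have "\<phi> v = \<phi> r" by (metis \<phi>_shift)
    moreover have "r \<in> residue_box N" using N by (simp add: r_def residue_box_def)
    then have "norm (\<phi> r) \<le> B" unfolding B_def by (rule member_le_sum) auto
    ultimately show ?thesis by simp
  qed
  moreover have "B \<ge> 0" by (simp add: B_def sum_nonneg)
  ultimately show ?thesis using that by blast
qed

text \<open>For K > 0 the terms are at most a constant times the inverse cube of
  \<open>latw\<close>, so the sum over single lattice points converges absolutely and the blocks are
  a mere regrouping.\<close>

lemma lat_sum_summable_pos: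
  assumes "Im z > 0" "K > 0"
  shows "(\<lambda>v. norm (\<phi> v * lat_term K z v)) summable_on UNIV"
    and "((\<lambda>v. \<phi> v * lat_term K z v) has_sum lat_sum N K \<phi> z) UNIV"
    and "(\<lambda>l. norm (\<Sum>r\<in>residue_box N. \<phi> r * lat_term K z (lat_shift N l r))) summable_on UNIV"
proof -
  obtain C where C: "C \<ge> 0" "\<And>v. norm (lat_term K z v) \<le> C / latw v ^ (K + 2)"
    using lat_term_bound[OF assms(1)] by blast
  obtain B where B: "B \<ge> 0" "\<And>v. norm (\<phi> v) \<le> B" using \<phi>_bounded by blast
  have "norm (\<phi> v * lat_term K z v) \<le> B * C / latw v ^ 3" for v
  proof -
    have "C / latw v ^ (K + 2) \<le> C / latw v ^ 3"
      using C(1) latw_ge_1[of v] assms(2) by (intro divide_left_mono power_increasing mult_pos_pos) auto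
    then have "norm (lat_term K z v) \<le> C / latw v ^ 3" using C(2)[of v] by (rule order_trans[rotated])
    then have "norm (\<phi> v) * norm (lat_term K z v) \<le> B * (C / latw v ^ 3)"
      using B by (intro mult_mono) simp_all
    then show ?thesis by (simp add: norm_mult)
  qed
  then show s: "(\<lambda>v. norm (\<phi> v * lat_term K z v)) summable_on UNIV"
    by (rule summable_on_bounded_by_latw_cube)
  then have "(\<lambda>v. \<phi> v * lat_term K z v) summable_on UNIV" by (rule abs_summable_summable)
  then obtain S where S: "((\<lambda>v. \<phi> v * lat_term K z v) has_sum S) UNIV" by (auto simp: summable_on_def)
  from has_sum_blocks[OF this N] have S': "((\<lambda>l. \<Sum>r\<in>residue_box N. \<phi> r * lat_term K z (lat_shift N l r)) has_sum S) UNIV"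
    by simp
  then show "((\<lambda>v. \<phi> v * lat_term K z v) has_sum lat_sum N K \<phi> z) UNIV"
    using S by (simp add: lat_sum_def infsumI)
  show "(\<lambda>l. norm (\<Sum>r\<in>residue_box N. \<phi> r * lat_term K z (lat_shift N l r))) summable_on UNIV"
    by (rule summable_on_iff_abs_summable_on_complex[THEN iffD1, OF has_sum_imp_summable[OF S']])
qed

end

section \<open>Invariant regularisation in the case K = 0\<close>

definition lat_norm :: "complex \<Rightarrow> int \<times> int \<Rightarrow> real" where
  "lat_norm z v = (norm (lat_point z v))^2 / Im z"

text \<open>For Q > 0 this is 1 / Q - 1 / (Q + n + 1). Written as one fraction it also vanishes at
  the origin, where Q = 0, in agreement with \<open>lat_term\<close>; the difference of the two
  fractions would not.\<close>

definition reg_term :: "nat \<Rightarrow> complex \<Rightarrow> int \<times> int \<Rightarrow> real" where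
  "reg_term n z v = real (Suc n) / (lat_norm z v * (lat_norm z v + real (Suc n)))"

lemma lat_term_0_eq: "lat_term 0 z v = of_real (1 / lat_norm z v)"
  by (simp add: lat_term_def lat_norm_def complex_norm_square[symmetric])

lemma reg_term_tendsto: "(\<lambda>n. reg_term n z v) \<longlonglongrightarrow> 1 / lat_norm z v"
proof (cases "lat_norm z v = 0")
  case False
  have "(\<lambda>n. real (Suc n) / (q * (q + real (Suc n)))) \<longlonglongrightarrow> inverse q" if "q \<noteq> 0" for q :: real
    using that by real_asymp
  then show ?thesis using False by (simp add: reg_term_def inverse_eq_divide)
qed (simp add: reg_term_def)

text \<open>The bound is uniform in a, as dominated convergence in n requires: adding a to both
  arguments keeps their difference and enlarges their product.\<close>

lemma reg_diff_bound:
  fixes p q a :: real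
  assumes "p > 0" "q > 0" "a > 0"
  shows "\<bar>a / (p * (p + a)) - a / (q * (q + a))\<bar> \<le> 2 * \<bar>p - q\<bar> / (p * q)"
proof -
  have e: "a / (x * (x + a)) = 1 / x - 1 / (x + a)" if "x > 0" for x
    using that assms(3) by (simp add: divide_simps)
  have "\<bar>a / (p * (p + a)) - a / (q * (q + a))\<bar> = \<bar>(1 / p - 1 / q) - (1 / (p + a) - 1 / (q + a))\<bar>"
    using assms by (simp add: e)
  also have "\<dots> \<le> \<bar>1 / p - 1 / q\<bar> + \<bar>1 / (p + a) - 1 / (q + a)\<bar>" by (rule abs_triangle_ineq4)
  also have "\<bar>1 / p - 1 / q\<bar> = \<bar>p - q\<bar> / (p * q)"
    using assms by (simp add: divide_simps abs_mult abs_minus_commute)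
  also have "\<bar>1 / (p + a) - 1 / (q + a)\<bar> = \<bar>p - q\<bar> / ((p + a) * (q + a))"
    using assms by (simp add: divide_simps abs_mult abs_minus_commute)
  also have "\<dots> \<le> \<bar>p - q\<bar> / (p * q)"
    using assms by (intro divide_left_mono mult_mono) auto
  finally show ?thesis by simp
qed

text \<open>Inside a block w changes by a bounded amount, so Q = |w|^2 / y changes by at most a
  multiple of \<open>latw l\<close>, while the product of two values of Q is of fourth order. The
  block l = (0,0) is excluded because its base point is the origin, where Q = 0.\<close>

lemma reg_block_bound:
  assumes "Im z > 0" "N > 0"
  obtains C where "\<And>n l r. r \<in> residue_box N \<Longrightarrow> l \<noteq> (0,0) \<Longrightarrow>
      \<bar>reg_term n z (lat_shift N l r) - reg_term n z (lat_shift N l (0,0))\<bar> \<le> C / latw l ^ 3"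
proof -
  obtain e where e: "e > 0" "\<And>v. v \<noteq> (0,0) \<Longrightarrow> e * latw v \<le> norm (lat_point z v)"
    using lat_point_bounds[OF assms(1)] by blast
  define y where "y = Im z"
  have y: "y > 0" using assms by (simp add: y_def)
  define A where "A = 1 + 2 * real N"
  define B where "B = 1 + norm z"
  have A: "A \<ge> 1" and B: "B \<ge> 1" by (simp_all add: A_def B_def)
  \<comment> \<open>A compares \<open>latw\<close> at two points of one block, B bounds |w| by a
    multiple of \<open>latw\<close>, and N B bounds the change of w inside a block.\<close>
  define C where "C = 2 * (real N * B * (2 * B * A) / y) / (e^4 / y^2) * A^2"
  have main: "\<bar>reg_term n z v - reg_term n z v'\<bar> \<le> C / latw l ^ 3"
    if r: "r \<in> residue_box N" and l: "l \<noteq> (0,0)" and v: "v = lat_shift N l r" and v': "v' = lat_shift N l (0,0)" for n l r v v'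
  proof -
    have rr: "0 \<le> fst r" "fst r < int N" "0 \<le> snd r" "snd r < int N" using r by (auto simp: residue_box_def)
    have v'0: "v' \<noteq> (0,0)" using l assms(2) by (cases l) (auto simp: v' lat_shift_def)
    have nz: "int N * c + a \<noteq> 0" if "c \<noteq> 0" "0 \<le> a" "a < int N" for a c
    proof
      assume "int N * c + a = 0"
      then have "int N dvd a" by (metis dvd_add_right_iff dvd_triv_left dvd_0_right)
      then have "a = 0" using that zdvd_imp_le by fastforce
      then show False using \<open>int N * c + a = 0\<close> that assms(2) by simp
    qed
    have v0: "v \<noteq> (0,0)" using l nz rr by (cases l) (auto simp: v lat_shift_def)
    have dvv: "fst v = fst v' + fst r" "snd v = snd v' + snd r" by (simp_all add: v v' lat_shift_def)
    have lw1: "latw v \<le> A * latw v'" and lw2: "latw v' \<le> A * latw v"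
    proof -
      have "latw v \<le> latw v' + 2 * real N" "latw v' \<le> latw v + 2 * real N"
        using rr unfolding latw_def dvv by linarith+
      moreover have "x + 2 * real N \<le> A * x" if "x \<ge> 1" for x
        using mult_left_mono[OF that, of "2 * real N"] by (simp add: A_def algebra_simps)
      ultimately show "latw v \<le> A * latw v'" "latw v' \<le> A * latw v"
        using latw_ge_1 order_trans by blast+
    qed
    have lwl: "latw l \<le> latw v'"
    proof -
      have "\<bar>real_of_int c\<bar> \<le> \<bar>real_of_int (int N * c)\<bar>" for c
        using assms(2) mult_right_mono[of 1 "real N" "\<bar>real_of_int c\<bar>"] by (simp add: abs_mult)
      then show ?thesis by (simp add: latw_def v' lat_shift_def add_mono)
    qed
    define w w' where "w = lat_point z v" and "w' = lat_point z v'"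
    have nw: "norm (lat_point z u) \<le> B * latw u" for u
    proof -
      have "norm (lat_point z u) \<le> \<bar>real_of_int (fst u)\<bar> * norm z + \<bar>real_of_int (snd u)\<bar>"
        unfolding lat_point_def by (rule order_trans[OF norm_triangle_ineq]) (simp add: norm_mult)
      also have "\<dots> \<le> B * latw u"
        by (simp add: B_def latw_def algebra_simps add_nonneg_nonneg)
      finally show ?thesis .
    qed
    have diff: "norm (w - w') \<le> real N * B"
    proof -
      have "w - w' = of_int (fst r) * z + of_int (snd r)"
        by (simp add: w_def w'_def lat_point_def dvv algebra_simps)
      also have "norm \<dots> \<le> \<bar>real_of_int (fst r)\<bar> * norm z + \<bar>real_of_int (snd r)\<bar>"
        by (rule order_trans[OF norm_triangle_ineq]) (simp add: norm_mult)
      also have "\<dots> \<le> real N * norm z + real N"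
        using rr by (intro add_mono mult_right_mono) auto
      finally show ?thesis by (simp add: B_def algebra_simps)
    qed
    define Q Q' where "Q = lat_norm z v" and "Q' = lat_norm z v'"
    have Q: "Q \<ge> e^2 * latw v ^ 2 / y" "Q' \<ge> e^2 * latw v' ^ 2 / y"
      using e(1) e(2)[OF v0] e(2)[OF v'0] y latw_ge_1[of v] latw_ge_1[of v']
      unfolding Q_def Q'_def lat_norm_def y_def[symmetric] power_mult_distrib[symmetric]
      by (auto intro!: divide_right_mono power_mono)
    have pos: "e^2 * latw v ^ 2 / y > 0" "e^2 * latw v' ^ 2 / y > 0"
      using e(1) y latw_ge_1[of v] latw_ge_1[of v'] by (auto intro!: divide_pos_pos mult_pos_pos)
    have "\<bar>reg_term n z v - reg_term n z v'\<bar> \<le> 2 * \<bar>Q - Q'\<bar> / (Q * Q')"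
      unfolding reg_term_def Q_def[symmetric] Q'_def[symmetric]
      using Q pos by (intro reg_diff_bound) auto
    also have "\<dots> \<le> 2 * (real N * B * (2 * B * A * latw v') / y) / (Q * Q')"
    proof (intro divide_right_mono mult_left_mono)
      show "0 \<le> Q * Q'" using Q pos by (intro mult_nonneg_nonneg) auto
    show "\<bar>Q - Q'\<bar> \<le> real N * B * (2 * B * A * latw v') / y"
    proof -
      have "\<bar>(norm w)^2 - (norm w')^2\<bar> = \<bar>norm w - norm w'\<bar> * (norm w + norm w')"
        by (simp add: power2_eq_square square_diff_square_factored abs_mult mult.commute)
      also have "\<dots> \<le> norm (w - w') * (norm w + norm w')"
        by (intro mult_right_mono norm_triangle_ineq3) auto
      also have "\<dots> \<le> (real N * B) * (B * latw v + B * latw v')"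
        unfolding w_def w'_def using B latw_ge_1[of v] latw_ge_1[of v'] diff
        by (intro mult_mono add_mono nw) (auto simp: w_def w'_def)
      also have "\<dots> \<le> (real N * B) * (2 * B * A * latw v')"
      proof (intro mult_left_mono)
        have "B * latw v \<le> B * (A * latw v')" using B lw1 by (intro mult_left_mono) auto
        moreover have "B * latw v' \<le> B * (A * latw v')"
          using B A latw_ge_1[of v'] mult_right_mono[of 1 A "latw v'"] by (intro mult_left_mono) auto
        ultimately show "B * latw v + B * latw v' \<le> 2 * B * A * latw v'" by (simp add: mult.assoc)
      qed (use B in auto)
      finally show ?thesis using y
        by (simp add: Q_def Q'_def lat_norm_def w_def w'_def y_def diff_divide_distrib[symmetric] divide_right_mono)
    qed
    qed simp
    also have "2 * (real N * B * (2 * B * A * latw v') / y) / (Q * Q') \<le>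
       2 * (real N * B * (2 * B * A * latw v') / y) / ((e^2 * latw v ^ 2 / y) * (e^2 * latw v' ^ 2 / y))"
      using Q pos B A y latw_ge_1[of v']
      by (intro divide_left_mono mult_mono mult_pos_pos) (auto intro!: mult_nonneg_nonneg divide_nonneg_pos order_trans[OF zero_le_one])
    also have "\<dots> = 2 * (real N * B * (2 * B * A) / y) / (e^4 / y^2) / (latw v' * latw v ^ 2)"
      using y e(1) latw_ge_1[of v] latw_ge_1[of v'] by (simp add: field_simps power2_eq_square power4_eq_xxxx)
    also have "\<dots> \<le> 2 * (real N * B * (2 * B * A) / y) / (e^4 / y^2) / (latw l * (latw l / A) ^ 2)"
    proof (intro divide_left_mono mult_mono power_mono)
      show "latw l / A \<le> latw v" using A lwl lw2 by (simp add: field_simps)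
    qed (use A B y e(1) lwl latw_ge_1[of l] latw_ge_1[of v] latw_ge_1[of v'] in \<open>auto intro!: mult_pos_pos divide_pos_pos\<close>)
    also have "\<dots> = C / latw l ^ 3"
      using A latw_ge_1[of l] by (simp add: C_def field_simps power2_eq_square power3_eq_cube)
    finally show ?thesis .
  qed
  show ?thesis by (rule that[of C]) (rule main[OF _ _ refl refl])
qed

lemma reg_term_le: "Im z > 0 \<Longrightarrow> 0 \<le> reg_term n z v \<and> reg_term n z v \<le> 1 / lat_norm z v"
proof -
  assume z: "Im z > 0"
  have "0 \<le> a / (q * (q + a)) \<and> a / (q * (q + a)) \<le> 1 / q" if "q \<ge> 0" "a > 0" for q a :: real
    using that by (cases "q = 0") (auto simp: divide_simps)
  from this[of "lat_norm z v" "real (Suc n)"] z show ?thesis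
    by (simp add: reg_term_def lat_norm_def del: of_nat_Suc times_divide_eq_left times_divide_eq_right divide_divide_eq_right)
qed

text \<open>Here the constant may depend on n. The term is of order n / Q^2, so each regularised sum
  converges absolutely over single lattice points and may be permuted by the modular group.\<close>

lemma reg_term_bound:
  assumes "Im z > 0"
  obtains C where "\<And>v. \<bar>reg_term n z v\<bar> \<le> C / latw v ^ 3"
proof -
  obtain e where e: "e > 0" "\<And>v. v \<noteq> (0,0) \<Longrightarrow> e * latw v \<le> norm (lat_point z v)"
    using lat_point_bounds[OF assms] by blast
  define a where "a = real (Suc n)"
  have a: "a > 0" by (simp add: a_def)
  define C where "C = a / (e^2 / Im z)^2"
  have "\<bar>reg_term n z v\<bar> \<le> C / latw v ^ 3" for v
  proof (cases "v = (0,0)")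
    case True
    then show ?thesis using assms a by (simp add: reg_term_def lat_norm_def lat_point_def C_def latw_def)
  next
    case False
    define q where "q = e^2 / Im z * latw v ^ 2"
    have q: "q > 0" using e(1) assms latw_ge_1[of v] by (simp add: q_def)
    have "q \<le> lat_norm z v"
      using e(1) e(2)[OF False] assms latw_ge_1[of v]
      by (auto simp: q_def lat_norm_def power_mult_distrib[symmetric] intro!: divide_right_mono power_mono)
    then have "\<bar>reg_term n z v\<bar> \<le> a / (q * q)"
      using q a reg_term_le[OF assms, of n v] unfolding reg_term_def a_def[symmetric]
      by (simp, intro divide_left_mono mult_mono) auto
    also have "\<dots> = C / latw v ^ 4"
      by (simp add: q_def C_def power2_eq_square power4_eq_xxxx field_simps)
    also have "\<dots> \<le> C / latw v ^ 3"
      using a e(1) assms latw_ge_1[of v] by (intro divide_left_mono power_increasing) (auto simp: C_def)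
    finally show ?thesis .
  qed
  then show ?thesis using that by blast
qed

context lattice_weight
begin

lemma reg_sum_summable:
  assumes "Im z > 0"
  shows "(\<lambda>v. \<phi> v * of_real (reg_term n z v)) summable_on UNIV"
proof -
  obtain C where C: "\<And>v. \<bar>reg_term n z v\<bar> \<le> C / latw v ^ 3" using reg_term_bound[OF assms] by blast
  obtain B where B: "B \<ge> 0" "\<And>v. norm (\<phi> v) \<le> B" using \<phi>_bounded by blast
  have "norm (\<phi> v * of_real (reg_term n z v)) \<le> B * C / latw v ^ 3" for v
    using mult_mono[OF B(2)[of v] C[of v] B(1)] by (simp add: norm_mult)
  then have "(\<lambda>v. norm (\<phi> v * of_real (reg_term n z v))) summable_on UNIV"
    by (rule summable_on_bounded_by_latw_cube)
  then show ?thesis by (rule abs_summable_summable)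
qed

text \<open>Connects two summations: the regularised sums run over single points and are invariant,
  whereas \<open>lat_sum\<close> needs blocks. The regularised sums are regrouped into blocks, which
  are dominated uniformly in n.\<close>

lemma lat_sum_reg_limit:
  assumes "Im z > 0" "K = 0"
  shows "(\<lambda>n. \<Sum>\<^sub>\<infinity>v. \<phi> v * of_real (reg_term n z v)) \<longlonglongrightarrow> lat_sum N K \<phi> z"
    and "(\<lambda>l. norm (\<Sum>r\<in>residue_box N. \<phi> r * lat_term K z (lat_shift N l r))) summable_on UNIV"
proof -
  obtain C where C: "\<And>n l r. r \<in> residue_box N \<Longrightarrow> l \<noteq> (0,0) \<Longrightarrow>
      \<bar>reg_term n z (lat_shift N l r) - reg_term n z (lat_shift N l (0,0))\<bar> \<le> C / latw l ^ 3"
    using reg_block_bound[OF assms(1) N] by blast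
  let ?b = "\<lambda>n l. \<Sum>r\<in>residue_box N. \<phi> r * of_real (reg_term n z (lat_shift N l r))"
  \<comment> \<open>D bounds the block of the origin termwise by 1 / Q; E serves all other
    blocks.\<close>
  define D where "D = (\<Sum>r\<in>residue_box N. norm (\<phi> r) * (1 / lat_norm z r))"
  define E where "E = (\<Sum>r\<in>residue_box N. norm (\<phi> r) * C)"
  have bound: "norm (?b n l) \<le> (\<bar>D\<bar> + \<bar>E\<bar>) * (1 / latw l ^ 3)" for n l
  proof (cases "l = (0, 0)")
    case True
    have "norm (?b n l) \<le> (\<Sum>r\<in>residue_box N. norm (\<phi> r * of_real (reg_term n z (lat_shift N l r))))"
      by (rule norm_sum)
    also have "\<dots> \<le> D" unfolding D_def
    proof (rule sum_mono)
      fix r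
      have "lat_shift N l r = r" by (simp add: True lat_shift_def)
      then show "norm (\<phi> r * of_real (reg_term n z (lat_shift N l r))) \<le> norm (\<phi> r) * (1 / lat_norm z r)"
        using reg_term_le[OF assms(1), of n r] mult_left_mono[of "reg_term n z r" "1 / lat_norm z r" "norm (\<phi> r)"]
        by (simp add: norm_mult)
    qed
    finally show ?thesis by (simp add: True latw_def)
  next
    case False
    \<comment> \<open>Because the weights of a block add up to 0, the value at the base point can be
      subtracted from every term, leaving the differences estimated above.\<close>
    have "(\<Sum>r\<in>residue_box N. \<phi> r * of_real (reg_term n z (lat_shift N l (0,0)))) = 0"
      using sum_residue_box_zero[OF assms(2)] by (simp add: sum_distrib_right[symmetric])
    then have "?b n l = (\<Sum>r\<in>residue_box N. \<phi> r * of_real (reg_term n z (lat_shift N l r) - reg_term n z (lat_shift N l (0,0))))"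
      by (simp add: algebra_simps sum_subtractf)
    also have "norm \<dots> \<le> (\<Sum>r\<in>residue_box N. norm (\<phi> r) * (C / latw l ^ 3))"
      using C[OF _ False] by (intro sum_norm_le) (auto simp only: norm_mult norm_of_real intro!: mult_left_mono norm_ge_zero)
    also have "\<dots> = E * (1 / latw l ^ 3)" by (simp add: E_def sum_divide_distrib)
    also have "\<dots> \<le> (\<bar>D\<bar> + \<bar>E\<bar>) * (1 / latw l ^ 3)"
      using latw_ge_1[of l] by (intro mult_right_mono) auto
    finally show ?thesis .
  qed
  have summ: "(\<lambda>l. (\<bar>D\<bar> + \<bar>E\<bar>) * (1 / latw l ^ 3)) summable_on UNIV"
    by (intro summable_on_cmult_right summable_on_latw_cube)
  have lim: "(\<lambda>n. ?b n l) \<longlonglongrightarrow> (\<Sum>r\<in>residue_box N. \<phi> r * lat_term K z (lat_shift N l r))" for l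
    unfolding assms(2) lat_term_0_eq by (intro tendsto_intros reg_term_tendsto)
  have "(\<Sum>\<^sub>\<infinity>v. \<phi> v * of_real (reg_term n z v)) = (\<Sum>\<^sub>\<infinity>l. ?b n l)" for n
    using has_sum_blocks[OF has_sum_infsum[OF reg_sum_summable[OF assms(1), of n]] N]
    by (simp add: infsumI)
  then show "(\<lambda>n. \<Sum>\<^sub>\<infinity>v. \<phi> v * of_real (reg_term n z v)) \<longlonglongrightarrow> lat_sum N K \<phi> z"
    using infsum_dominated_convergence(1)[OF bound summ lim] by (simp add: lat_sum_def)
  show "(\<lambda>l. norm (\<Sum>r\<in>residue_box N. \<phi> r * lat_term K z (lat_shift N l r))) summable_on UNIV"
    using infsum_dominated_convergence(2)[OF bound summ lim] .
qed

lemma lat_sum_has_sum: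
  assumes "Im z > 0"
  shows "((\<lambda>l. \<Sum>r\<in>residue_box N. \<phi> r * lat_term K z (lat_shift N l r)) has_sum lat_sum N K \<phi> z) UNIV"
proof -
  have "(\<lambda>l. norm (\<Sum>r\<in>residue_box N. \<phi> r * lat_term K z (lat_shift N l r))) summable_on UNIV"
    using lat_sum_summable_pos(3)[OF assms] lat_sum_reg_limit(2)[OF assms] by (cases "K = 0") auto
  then show ?thesis unfolding lat_sum_def by (rule has_sum_infsum[OF abs_summable_summable])
qed

end

section \<open>The action of the modular group\<close>

text \<open>The row vector v times the matrix. The action is on the right, so that substituting the
  Moebius image for z amounts to replacing v by its image and dividing by the automorphy
  factor.\<close>

definition lat_act :: "int \<Rightarrow> int \<Rightarrow> int \<Rightarrow> int \<Rightarrow> int \<times> int \<Rightarrow> int \<times> int" where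
  "lat_act a b c d v = (fst v * a + snd v * c, fst v * b + snd v * d)"

lemma lat_act_inverse:
  assumes "a * d - b * c = 1"
  shows "lat_act d (- b) (- c) a (lat_act a b c d v) = v" "lat_act a b c d (lat_act d (- b) (- c) a v) = v"
proof -
  obtain x y where v: "v = (x, y)" by force
  have "(x * a + y * c) * d + (x * b + y * d) * (- c) = x * (a * d - b * c)"
    "(x * a + y * c) * (- b) + (x * b + y * d) * a = y * (a * d - b * c)"
    "(x * d + y * (- c)) * a + (x * (- b) + y * a) * c = x * (a * d - b * c)"
    "(x * d + y * (- c)) * b + (x * (- b) + y * a) * d = y * (a * d - b * c)"
    by (simp_all add: algebra_simps)
  then show "lat_act d (- b) (- c) a (lat_act a b c d v) = v" "lat_act a b c d (lat_act d (- b) (- c) a v) = v"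
    by (simp_all only: v lat_act_def fst_conv snd_conv assms mult_1_right)
qed

lemma bij_lat_act:
  assumes "a * d - b * c = 1"
  shows "bij (lat_act a b c d)"
  using lat_act_inverse[OF assms] by (intro bij_betw_byWitness[where f' = "lat_act d (- b) (- c) a"]) auto

lemma lat_act_shift:
  "lat_act a b c d (x + int N * m, y + int N * n) =
     (fst (lat_act a b c d (x, y)) + int N * fst (lat_act a b c d (m, n)),
      snd (lat_act a b c d (x, y)) + int N * snd (lat_act a b c d (m, n)))"
  by (simp add: lat_act_def algebra_simps)

context
  fixes a b c d :: int and z :: complex
  assumes det: "a * d - b * c = 1" and z: "Im z > 0"
begin

lemma moebius_denominator_nonzero: "of_int c * z + of_int d \<noteq> 0"
proof -
  have "(c, d) \<noteq> (0, 0)" using det by auto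
  then show ?thesis using lat_point_eq_0_iff[OF z, of "(c, d)"] by (simp add: lat_point_def)
qed

lemma Im_moebius:
  "Im ((of_int a * z + of_int b) / (of_int c * z + of_int d)) = Im z / (norm (of_int c * z + of_int d))^2"
proof -
  have "Im ((of_int a * z + of_int b) / (of_int c * z + of_int d)) =
    (real_of_int (a * d - b * c) * Im z) / (norm (of_int c * z + of_int d))^2"
    unfolding Im_divide cmod_power2 by (simp add: algebra_simps)
  then show ?thesis by (simp add: det)
qed

lemma Im_moebius_pos: "Im ((of_int a * z + of_int b) / (of_int c * z + of_int d)) > 0"
  unfolding Im_moebius using z moebius_denominator_nonzero by simp

lemma lat_point_moebius:
  "lat_point ((of_int a * z + of_int b) / (of_int c * z + of_int d)) v =
     lat_point z (lat_act a b c d v) / (of_int c * z + of_int d)"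
  using moebius_denominator_nonzero by (simp add: lat_point_def lat_act_def divide_simps) (simp add: algebra_simps)

text \<open>Passing to the image of z divides both |w|^2 and y by |j|^2, so Q, and every function of
  Q, is invariant.\<close>

lemma reg_term_moebius:
  "reg_term n ((of_int a * z + of_int b) / (of_int c * z + of_int d)) v = reg_term n z (lat_act a b c d v)"
  unfolding reg_term_def lat_norm_def lat_point_moebius Im_moebius
  using moebius_denominator_nonzero by (simp add: norm_divide power_divide)

text \<open>The power y^(K+1) contributes (j j')^(K+1) in the denominator and w w'^(K+1) contributes
  j j'^(K+1), where j' is the conjugate of j. The conjugates cancel and 1 / j^K remains, the factor
  of weight - K = 2 - k.\<close>

lemma lat_term_moebius:
  "(of_int c * z + of_int d) ^ K * lat_term K ((of_int a * z + of_int b) / (of_int c * z + of_int d)) v =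
     lat_term K z (lat_act a b c d v)"
proof -
  define j where "j = of_int c * z + of_int d"
  have j: "j \<noteq> 0" using moebius_denominator_nonzero by (simp add: j_def)
  have n: "of_real (norm j ^ 2) = j * cnj j" by (rule complex_norm_square)
  have "of_real (Im z / norm j ^ 2) = (of_real (Im z) / (j * cnj j) :: complex)" by (simp only: n[symmetric] of_real_divide)
  then show ?thesis
    unfolding lat_term_def lat_point_moebius Im_moebius unfolding j_def[symmetric] using j
    by (simp only:) (simp add: field_simps power_mult_distrib)
qed

end

text \<open>The only point beyond linearity is the block sum: reduced modulo N, the action of a
  matrix of determinant 1 permutes the residue box, with the inverse matrix as witness.\<close>

lemma (in lattice_weight) lattice_weight_act:
  assumes det: "a * d - b * c = 1"
  shows "lattice_weight N K (\<lambda>v. \<phi> (lat_act a b c d v))"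
proof
  show "N > 0" by (rule N)
  show "\<phi> (lat_act a b c d (x + int N * m, y + int N * n)) = \<phi> (lat_act a b c d (x, y))" for x y m n
    unfolding lat_act_shift periodic by simp
  show "\<phi> (lat_act a b c d (- x, - y)) = (-1) ^ K * \<phi> (lat_act a b c d (x, y))" for x y
    using parity[of "fst (lat_act a b c d (x, y))" "snd (lat_act a b c d (x, y))"]
    by (simp add: lat_act_def algebra_simps)
  assume "K = 0"
  define red where "red v = (fst v mod int N, snd v mod int N)" for v :: "int \<times> int"
  have red: "\<phi> (red v) = \<phi> v" for v
    using periodic[of "fst (red v)" "fst v div int N" "snd (red v)" "snd v div int N"]
    by (simp add: red_def)
  have red_act: "red (lat_act a' b' c' d' (red v)) = red (lat_act a' b' c' d' v)" for a' b' c' d' v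
  proof -
    have "(x mod n * p + y mod n * q) mod n = (x * p + y * q) mod n" for x y p q n :: int
      by (metis mod_add_eq mod_mult_left_eq)
    then show ?thesis by (simp add: red_def lat_act_def)
  qed
  have red_box: "red v \<in> residue_box N" for v using N by (simp add: red_def residue_box_def)
  have red_id: "red v = v" if "v \<in> residue_box N" for v using that by (cases v) (auto simp: red_def residue_box_def)
  have "(\<Sum>r\<in>residue_box N. \<phi> (lat_act a b c d r)) = (\<Sum>r\<in>residue_box N. \<phi> r)"
  proof (rule sum.reindex_bij_witness[of _ "\<lambda>v. red (lat_act d (- b) (- c) a v)" "\<lambda>v. red (lat_act a b c d v)"])
    fix r assume r: "r \<in> residue_box N"
    show "red (lat_act d (- b) (- c) a (red (lat_act a b c d r))) = r"
      "red (lat_act a b c d (red (lat_act d (- b) (- c) a r))) = r"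
      by (simp_all only: red_act lat_act_inverse[OF det] red_id[OF r])
    show "red (lat_act a b c d r) \<in> residue_box N" "red (lat_act d (- b) (- c) a r) \<in> residue_box N" by (rule red_box)+
    show "\<phi> (red (lat_act a b c d r)) = \<phi> (lat_act a b c d r)" by (rule red)
  qed
  then show "(\<Sum>r\<in>residue_box N. \<phi> (lat_act a b c d r)) = 0" using sum_residue_box_zero[OF \<open>K = 0\<close>] by simp
qed

text \<open>The inverse matrix acts on the weight because the summation variable v is replaced by
  its image under the matrix.\<close>

theorem (in lattice_weight) lat_sum_moebius:
  assumes det: "a * d - b * c = 1" and z: "Im z > 0"
  defines "z' \<equiv> (of_int a * z + of_int b) / (of_int c * z + of_int d)"
  shows "(of_int c * z + of_int d) ^ K * lat_sum N K \<phi> z' =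
           lat_sum N K (\<lambda>v. \<phi> (lat_act d (- b) (- c) a v)) z"
proof -
  have det': "d * a - (- b) * (- c) = 1" using det by (simp add: algebra_simps)
  interpret W: lattice_weight N K "\<lambda>v. \<phi> (lat_act d (- b) (- c) a v)"
    by (rule lattice_weight_act[OF det'])
  have z': "Im z' > 0" unfolding z'_def by (rule Im_moebius_pos[OF det z])
  note bij = bij_lat_act[OF det]
  show ?thesis
  proof (cases "K = 0")
    case False
    then have K: "K > 0" by simp
    have "((\<lambda>v. \<phi> (lat_act d (- b) (- c) a (lat_act a b c d v)) * lat_term K z (lat_act a b c d v)) has_sum
       lat_sum N K (\<lambda>v. \<phi> (lat_act d (- b) (- c) a v)) z) UNIV"
      using W.lat_sum_summable_pos(2)[OF z K] by (rule has_sum_reindex_bij_betw[OF bij, THEN iffD2])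
    then have 1: "((\<lambda>v. (of_int c * z + of_int d) ^ K * (\<phi> v * lat_term K z' v)) has_sum
       lat_sum N K (\<lambda>v. \<phi> (lat_act d (- b) (- c) a v)) z) UNIV"
      unfolding lat_act_inverse[OF det] lat_term_moebius[OF det z, symmetric] z'_def by (simp only: mult.left_commute)
    show ?thesis
      using has_sum_unique[OF has_sum_cmult_right[OF lat_sum_summable_pos(2)[OF z' K]] 1] .
  next
    case True
    have "(\<Sum>\<^sub>\<infinity>v. \<phi> v * of_real (reg_term n z' v)) = (\<Sum>\<^sub>\<infinity>v. \<phi> (lat_act d (- b) (- c) a v) * of_real (reg_term n z v))" for n
      unfolding infsum_reindex_bij_betw[OF bij, symmetric, of "\<lambda>v. \<phi> (lat_act d (- b) (- c) a v) * of_real (reg_term n z v)"]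
      by (simp add: lat_act_inverse[OF det] reg_term_moebius[OF det z] z'_def)
    then have "(\<lambda>n. \<Sum>\<^sub>\<infinity>v. \<phi> v * of_real (reg_term n z' v)) \<longlonglongrightarrow> lat_sum N K (\<lambda>v. \<phi> (lat_act d (- b) (- c) a v)) z"
      using W.lat_sum_reg_limit(1)[OF z True] by simp
    then have "lat_sum N K \<phi> z' = lat_sum N K (\<lambda>v. \<phi> (lat_act d (- b) (- c) a v)) z"
      using LIMSEQ_unique lat_sum_reg_limit(1)[OF z' True] by blast
    then show ?thesis using True by simp
  qed
qed

section \<open>Fourier expansion of the lattice sums\<close>

text \<open>Collects a double series over pairs (c, n) with exponent c n into a single series. No
  pair of positive integers has product 0, hence the separate value at m = 0, which every c
  divides.\<close>

definition divisor_conv :: "(nat \<times> nat \<Rightarrow> complex) \<Rightarrow> nat \<Rightarrow> complex" where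
  "divisor_conv g m = (if m = 0 then 0 else \<Sum>c | c dvd m. g (c, m div c))"

lemma divisor_conv_poly_bounded:
  assumes "B \<ge> 0" "\<And>c n. c \<ge> 1 \<Longrightarrow> n \<ge> 1 \<Longrightarrow> norm (g (c, n)) \<le> B * real (c * n) ^ p"
  shows "poly_bounded (divisor_conv g)"
proof -
  have "norm (divisor_conv g m) \<le> B * real (Suc m) ^ Suc p" for m
  proof (cases "m = 0")
    case True
    then show ?thesis using assms(1) by (simp add: divisor_conv_def)
  next
    case False
    have "norm (divisor_conv g m) \<le> (\<Sum>c | c dvd m. norm (g (c, m div c)))"
      using False by (simp add: divisor_conv_def norm_sum)
    also have "\<dots> \<le> (\<Sum>c | c dvd m. B * real m ^ p)"
    proof (rule sum_mono)
      fix c assume "c \<in> {c. c dvd m}"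
      then obtain n where n: "m = c * n" by auto
      then have "c \<ge> 1" "n \<ge> 1" using False by auto
      then show "norm (g (c, m div c)) \<le> B * real m ^ p" using assms(2)[of c n] by (simp add: n)
    qed
    also have "\<dots> = real (card {c. c dvd m}) * (B * real m ^ p)" by simp
    also have "\<dots> \<le> real m * (B * real m ^ p)"
    proof (intro mult_right_mono)
      have "{c. c dvd m} \<subseteq> {1..m}" using False by (auto simp: dvd_imp_le Suc_le_eq intro!: Nat.gr0I)
      from card_mono[OF _ this] show "real (card {c. c dvd m}) \<le> real m" by simp
    qed (use assms(1) in simp)
    also have "\<dots> = B * real m ^ Suc p" by simp
    also have "\<dots> \<le> B * real (Suc m) ^ Suc p" using assms(1) by (intro mult_left_mono power_mono) auto
    finally show ?thesis .
  qed
  then show ?thesis unfolding poly_bounded_def by blast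
qed

lemma has_sum_divisor_conv:
  assumes "B \<ge> 0" "\<And>c n. c \<ge> 1 \<Longrightarrow> n \<ge> 1 \<Longrightarrow> norm (g (c, n)) \<le> B * real (c * n) ^ p"
    and "N > 0" "Im z > 0"
  shows "((\<lambda>(c, n). g (c, n) * unity_exp (of_nat (c * n) * z / of_nat N)) has_sum
           nome_series N (divisor_conv g) z) ({1..} \<times> {1..})"
proof -
  let ?e = "\<lambda>m. unity_exp (of_nat m * z / of_nat N)"
  let ?f = "\<lambda>(m, c). g (c, m div c) * ?e m"
  \<comment> \<open>The convolution of the moduli grows polynomially too; its convergent series
    provides the absolute convergence needed to rearrange the pairs.\<close>
  define gn where "gn = (\<lambda>x. of_real (norm (g x)) :: complex)"
  have pn: "poly_bounded (divisor_conv gn)"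
    using assms by (intro divisor_conv_poly_bounded[of B _ p]) (auto simp: gn_def)
  have fin: "finite {c. c dvd m}" if "m \<in> {1..}" for m :: nat
    using that by simp
  have "(\<lambda>x. norm (?f x)) summable_on (SIGMA m:{1..}. {c. c dvd m})"
  proof (rule Infinite_Sum.abs_summable_on_Sigma_iff[of ?f "{1..}" "\<lambda>m. {c. c dvd m}", THEN iffD2], intro conjI ballI)
    fix m :: nat assume m: "m \<in> {1..}"
    show "(\<lambda>c. norm (?f (m, c))) summable_on {c. c dvd m}" using fin[OF m] by simp
  next
    have eq: "(\<Sum>\<^sub>\<infinity>c\<in>{c. c dvd m}. norm (?f (m, c))) = norm (divisor_conv gn m * ?e m)" if "m \<in> {1..}" for m
    proof -
      have "divisor_conv gn m = of_real (\<Sum>c | c dvd m. norm (g (c, m div c)))"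
        using that by (simp add: divisor_conv_def gn_def)
      then have "norm (divisor_conv gn m) = (\<Sum>c | c dvd m. norm (g (c, m div c)))"
        by (simp only: norm_of_real) (simp add: sum_nonneg)
      then show ?thesis using fin[OF that] by (simp add: norm_mult sum_distrib_right)
    qed
    have "(\<lambda>m. norm (divisor_conv gn m * ?e m)) summable_on UNIV"
      using nome_series_summable[OF pn assms(3,4)] by (intro norm_summable_imp_summable_on) simp
    then have "(\<lambda>m. norm (norm (divisor_conv gn m * ?e m))) summable_on {1..}"
      by (simp only: real_norm_def abs_norm_cancel) (rule summable_on_subset_banach, auto)
    then show "(\<lambda>m. norm (\<Sum>\<^sub>\<infinity>c\<in>{c. c dvd m}. norm (?f (m, c)))) summable_on {1..}"
      using eq by (subst summable_on_cong) auto
  qed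
  then have s: "?f summable_on (SIGMA m:{1..}. {c. c dvd m})" by (rule abs_summable_summable)
  have "((\<lambda>m. divisor_conv g m * ?e m) has_sum nome_series N (divisor_conv g) z) UNIV"
    using divisor_conv_poly_bounded[OF assms(1,2)] assms(3,4) by (intro nome_series_has_sum)
  also have "?this \<longleftrightarrow> ((\<lambda>m. divisor_conv g m * ?e m) has_sum nome_series N (divisor_conv g) z) {1..}"
    by (rule has_sum_cong_neutral) (auto simp: divisor_conv_def not_less_eq_eq)
  finally have h: "((\<lambda>m. divisor_conv g m * ?e m) has_sum nome_series N (divisor_conv g) z) {1..}" .
  have "(?f has_sum nome_series N (divisor_conv g) z) (SIGMA m:{1..}. {c. c dvd m})"
  proof (rule has_sum_SigmaI[OF _ h s])
    fix m :: nat assume m: "m \<in> {1..}"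
    show "((\<lambda>c. ?f (m, c)) has_sum divisor_conv g m * ?e m) {c. c dvd m}"
      using m fin[OF m] by (intro has_sum_finiteI) (auto simp: divisor_conv_def sum_distrib_right)
  qed
  also have "?this \<longleftrightarrow> ((\<lambda>(c, n). g (c, n) * ?e (c * n)) has_sum nome_series N (divisor_conv g) z) ({1..} \<times> {1..})"
    by (rule has_sum_reindex_bij_witness[of _ "\<lambda>(c, n). (c * n, c)" "\<lambda>(m, c). (c, m div c)"])
       (auto elim!: dvdE simp: Suc_le_eq)
  finally show ?thesis .
qed

lemma has_sum_sum:
  fixes f :: "'i \<Rightarrow> 'a \<Rightarrow> 'b :: topological_comm_monoid_add"
  assumes "finite I" "\<And>i. i \<in> I \<Longrightarrow> (f i has_sum S i) A"
  shows "((\<lambda>x. \<Sum>i\<in>I. f i x) has_sum (\<Sum>i\<in>I. S i)) A"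
  using assms by (induction I rule: finite_induct) (auto intro!: has_sum_add)

section \<open>From the lattice sum to its rows\<close>

text \<open>An unordered sum may be evaluated along any exhausting family of finite sets. Used to
  compare unordered sums with limits over rows up to a multiple of N.\<close>

lemma has_sum_imp_tendsto:
  assumes "(f has_sum S) A" "\<And>M. finite (g M)" "\<And>M. g M \<subseteq> A"
    and "\<And>x. x \<in> A \<Longrightarrow> eventually (\<lambda>M. x \<in> g M) F"
  shows "((\<lambda>M. sum f (g M)) \<longlongrightarrow> S) F"
proof -
  have "(sum f \<longlongrightarrow> S) (finite_subsets_at_top A)" using assms(1) by (simp add: has_sum_def)
  moreover have "filterlim g (finite_subsets_at_top A) F"
    unfolding filterlim_finite_subsets_at_top
  proof (intro allI impI)
    fix X assume X: "finite X \<and> X \<subseteq> A"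
    then have "eventually (\<lambda>M. \<forall>x\<in>X. x \<in> g M) F"
      using assms(4) by (intro eventually_ball_finite) auto
    then show "eventually (\<lambda>M. finite (g M) \<and> X \<subseteq> g M \<and> g M \<subseteq> A) F"
      by (rule eventually_mono) (use assms(2,3) in auto)
  qed
  ultimately show ?thesis by (rule filterlim_compose)
qed

lemma has_sum_int_blocks:
  fixes g :: "int \<Rightarrow> complex"
  assumes "(g has_sum S) UNIV" "N > 0"
  shows "((\<lambda>n. \<Sum>b\<in>{0..<int N}. g (int N * n + b)) has_sum S) UNIV"
proof (rule has_sum_SigmaD)
  show "((\<lambda>(n, b). g (int N * n + b)) has_sum S) (SIGMA n:UNIV. {0..<int N})"
  proof (rule has_sum_reindex_bij_witness[THEN iffD2])
    show "(g has_sum S) UNIV" by fact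
    show "(\<lambda>(n, b). int N * n + b) ((\<lambda>v. (v div int N, v mod int N)) v) = v" for v by simp
  qed (use assms(2) in auto)
  show "((\<lambda>b. case (n, b) of (n, b) \<Rightarrow> g (int N * n + b)) has_sum (\<Sum>b\<in>{0..<int N}. g (int N * n + b))) {0..<int N}" for n
    by simp
qed

definition lat_row :: "nat \<Rightarrow> (int \<times> int \<Rightarrow> complex) \<Rightarrow> complex \<Rightarrow> int \<Rightarrow> complex" where
  "lat_row K \<phi> z c = (\<Sum>\<^sub>\<infinity>d. \<phi> (c, d) * lat_term K z (c, d))"

text \<open>Whole blocks of residues cover - X up to X - 1, which is not symmetric; the negative
  side has one more row, hence the two different ranges.\<close>

lemma sum_symmetric_int_interval:
  fixes f :: "int \<Rightarrow> complex"
  assumes "\<And>c. f (- c) = f c" "X \<ge> 1"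
  shows "(\<Sum>c\<in>{- int X..<int X}. f c) = f 0 + (\<Sum>c\<in>{1..<X}. f (int c)) + (\<Sum>c\<in>{1..X}. f (int c))"
proof -
  have un: "{- int X..<int X} = {0} \<union> {1..<int X} \<union> {- int X..-1}" using assms(2) by auto
  have "(\<Sum>c\<in>{- int X..<int X}. f c) = f 0 + (\<Sum>c\<in>{1..<int X}. f c) + (\<Sum>c\<in>{- int X..-1}. f c)"
    unfolding un by ((subst sum.union_disjoint | force)+)
  also have "(\<Sum>c\<in>{1..<int X}. f c) = (\<Sum>c\<in>{1..<X}. f (int c))"
    by (rule sum.reindex_bij_witness[of _ int nat]) auto
  also have "(\<Sum>c\<in>{- int X..-1}. f c) = (\<Sum>c\<in>{1..X}. f (int c))"
    by (rule sum.reindex_bij_witness[of _ "\<lambda>c. - int c" "\<lambda>c. nat (- c)"]) (auto simp: assms(1))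
  finally show ?thesis .
qed

definition dft :: "nat \<Rightarrow> (int \<times> int \<Rightarrow> complex) \<Rightarrow> int \<Rightarrow> int \<Rightarrow> complex" where
  "dft N \<phi> c n = (\<Sum>b\<in>{0..<int N}. \<phi> (c, b) * unity_exp (of_int (n * b) / of_nat N))"

text \<open>The constant of \<open>line_sum\<close>, with the factor 1 / N that remains when the
  second coordinate is written as N n + b.\<close>

definition fourier_const :: "nat \<Rightarrow> nat \<Rightarrow> complex" where
  "fourier_const N K = 2 * of_real pi * \<i> * (-1) ^ K / (of_nat N * (2 * \<i>) ^ Suc K)"

lemma power_nome_series_has_sum:
  assumes "Im w > 0"
  shows "((\<lambda>n. of_nat n ^ i * unity_exp (of_nat n * w)) has_sum power_nome_series i w) {1..}"
proof -
  have "((\<lambda>n. (if n = 0 then 0 else of_nat n ^ i) * unity_exp (of_nat n * w / of_nat 1)) has_sum power_nome_series i w) UNIV"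
    unfolding power_nome_series_def using assms by (intro nome_series_has_sum poly_bounded_power) auto
  also have "?this \<longleftrightarrow> ((\<lambda>n. of_nat n ^ i * unity_exp (of_nat n * w)) has_sum power_nome_series i w) {1..}"
    by (rule has_sum_cong_neutral) (auto simp: not_less_eq_eq)
  finally show ?thesis .
qed

lemma cnj_unity_exp: "cnj (unity_exp (of_real x)) = unity_exp (- of_real x)"
  by (simp add: unity_exp_def exp_cnj)

context lattice_weight
begin

lemma lat_row_has_sum:
  assumes "Im z > 0"
  shows "((\<lambda>d. \<phi> (c, d) * lat_term K z (c, d)) has_sum lat_row K \<phi> z c) UNIV"
proof -
  obtain C where C: "C \<ge> 0" "\<And>v. norm (lat_term K z v) \<le> C / latw v ^ (K + 2)"
    using lat_term_bound[OF assms] by blast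
  obtain B where B: "B \<ge> 0" "\<And>v. norm (\<phi> v) \<le> B" using \<phi>_bounded by blast
  have bound: "norm (\<phi> (c, d) * lat_term K z (c, d)) \<le> B * C * (1 / (1 + \<bar>real_of_int d\<bar>)^2)" for d
  proof -
    have "norm (lat_term K z (c, d)) \<le> C / latw (c, d) ^ (K + 2)" by (rule C)
    also have "\<dots> \<le> C / latw (c, d) ^ 2"
      using C(1) latw_ge_1[of "(c, d)"] by (intro divide_left_mono power_increasing mult_pos_pos) auto
    also have "\<dots> \<le> C / (1 + \<bar>real_of_int d\<bar>)^2"
      using C(1) by (intro divide_left_mono power_mono mult_pos_pos) (auto simp: latw_def)
    finally have "norm (lat_term K z (c, d)) \<le> C / (1 + \<bar>real_of_int d\<bar>)^2" .
    from mult_mono[OF B(2)[of "(c, d)"] this B(1)] show ?thesis by (simp add: norm_mult)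
  qed
  have "(\<lambda>d. B * C * (1 / (1 + \<bar>real_of_int d\<bar>)^2)) summable_on UNIV"
    by (intro summable_on_cmult_right summable_on_int_inverse_square)
  from Infinite_Sum.abs_summable_on_comparison_test'[OF this bound]
  have "(\<lambda>d. \<phi> (c, d) * lat_term K z (c, d)) summable_on UNIV" by (rule abs_summable_summable)
  then show ?thesis unfolding lat_row_def by (rule has_sum_infsum)
qed

lemma lat_row_uminus:
  assumes "Im z > 0"
  shows "lat_row K \<phi> z (- c) = lat_row K \<phi> z c"
proof -
  have "((\<lambda>d. \<phi> (- c, - d) * lat_term K z (- c, - d)) has_sum lat_row K \<phi> z (- c)) UNIV"
    using lat_row_has_sum[OF assms, of "- c"]
    by (rule has_sum_reindex_bij_betw[of uminus, THEN iffD2, rotated]) (rule bij_uminus)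
  moreover have "\<phi> (- c, - d) * lat_term K z (- c, - d) = \<phi> (c, d) * lat_term K z (c, d)" for d
  proof -
    have "lat_point z (- c, - d) = - lat_point z (c, d)" by (simp add: lat_point_def)
    then have "lat_term K z (- c, - d) = (-1) ^ K * lat_term K z (c, d)"
      by (simp add: lat_term_def) (cases "even K"; simp)
    then show ?thesis by (simp add: parity)
  qed
  ultimately show ?thesis using lat_row_has_sum[OF assms, of c] has_sum_unique by simp blast
qed

text \<open>Rows are grouped N at a time: the block sums behind \<open>lat_sum\<close> determine
  summability for such groups, not for single rows when K = 0.\<close>

lemma lat_rows_has_sum:
  assumes "Im z > 0"
  shows "((\<lambda>m. \<Sum>a\<in>{0..<int N}. lat_row K \<phi> z (int N * m + a)) has_sum lat_sum N K \<phi> z) UNIV"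
proof (rule has_sum_SigmaD)
  show "((\<lambda>l. \<Sum>r\<in>residue_box N. \<phi> r * lat_term K z (lat_shift N l r)) has_sum lat_sum N K \<phi> z) (Sigma UNIV (\<lambda>_. UNIV))"
    using lat_sum_has_sum[OF assms] by simp
  fix m :: int
  have "((\<lambda>n. \<Sum>a\<in>{0..<int N}. \<Sum>b\<in>{0..<int N}. \<phi> (int N * m + a, int N * n + b) * lat_term K z (int N * m + a, int N * n + b))
     has_sum (\<Sum>a\<in>{0..<int N}. lat_row K \<phi> z (int N * m + a))) UNIV"
    by (intro has_sum_sum has_sum_int_blocks[OF lat_row_has_sum[OF assms] N]) simp
  moreover have "(\<Sum>a\<in>{0..<int N}. \<Sum>b\<in>{0..<int N}. \<phi> (int N * m + a, int N * n + b) * lat_term K z (int N * m + a, int N * n + b)) =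
     (\<Sum>r\<in>residue_box N. \<phi> r * lat_term K z (lat_shift N (m, n) r))" for n
  proof -
    have "\<phi> (int N * m + a, int N * n + b) = \<phi> (a, b)" for a b
      using periodic[of a m b n] by (simp add: add.commute)
    then show ?thesis
      unfolding residue_box_def sum.cartesian_product by (simp add: lat_shift_def case_prod_unfold)
  qed
  ultimately show "((\<lambda>n. \<Sum>r\<in>residue_box N. \<phi> r * lat_term K z (lat_shift N (m, n) r)) has_sum
     (\<Sum>a\<in>{0..<int N}. lat_row K \<phi> z (int N * m + a))) UNIV" by simp
qed

lemma lat_rows_tendsto:
  assumes "Im z > 0"
  shows "(\<lambda>M. (\<Sum>c\<in>{1..<N * M}. lat_row K \<phi> z (int c)) + (\<Sum>c\<in>{1..N * M}. lat_row K \<phi> z (int c)))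
            \<longlonglongrightarrow> lat_sum N K \<phi> z - lat_row K \<phi> z 0"
proof -
  let ?R = "lat_row K \<phi> z"
  have "(\<lambda>M. \<Sum>m\<in>{- int M..<int M}. \<Sum>a\<in>{0..<int N}. ?R (int N * m + a)) \<longlonglongrightarrow> lat_sum N K \<phi> z"
  proof (rule has_sum_imp_tendsto[OF lat_rows_has_sum[OF assms]])
    fix x :: int
    show "eventually (\<lambda>M. x \<in> {- int M..<int M}) sequentially"
      using eventually_ge_at_top[of "nat \<bar>x\<bar> + 1"] by eventually_elim auto
  qed auto
  from tendsto_diff[OF this tendsto_const[of "?R 0"]]
  show ?thesis
  proof (rule Lim_transform_eventually)
    show "eventually (\<lambda>M. (\<Sum>m\<in>{- int M..<int M}. \<Sum>a\<in>{0..<int N}. ?R (int N * m + a)) - ?R 0 =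
       (\<Sum>c\<in>{1..<N * M}. ?R (int c)) + (\<Sum>c\<in>{1..N * M}. ?R (int c))) sequentially"
      using eventually_ge_at_top[of 1]
    proof eventually_elim
      case (elim M)
      have "(\<Sum>m\<in>{- int M..<int M}. \<Sum>a\<in>{0..<int N}. ?R (int N * m + a)) =
        (\<Sum>(m, a)\<in>{- int M..<int M} \<times> {0..<int N}. ?R (int N * m + a))"
        by (simp add: sum.cartesian_product)
      also have "\<dots> = (\<Sum>c\<in>{- int (N * M)..<int (N * M)}. ?R c)"
      proof (rule sum.reindex_bij_witness[of _ "\<lambda>c. (c div int N, c mod int N)" "\<lambda>(m, a). int N * m + a"], goal_cases)
        case (2 x)
        obtain m a where x: "x = (m, a)" by force
        have ma: "- int M \<le> m" "m + 1 \<le> int M" "0 \<le> a" "a < int N" using 2 x by auto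
        have "int N * - int M \<le> int N * m" by (rule mult_left_mono) (use ma in auto)
        moreover have "int N * (m + 1) \<le> int N * int M" by (rule mult_left_mono) (use ma in auto)
        ultimately
        show ?case using ma by (simp add: x algebra_simps)
      next
        case (4 c)
        have "- int M \<le> c div int N"
        proof -
          have "int N * - int M \<le> c" using 4 by simp
          then have "(int N * - int M) div int N \<le> c div int N" using N by (intro zdiv_mono1) auto
          moreover have "(int N * - int M) div int N = - int M"
            by (rule nonzero_mult_div_cancel_left) (use N in simp)
          ultimately show ?thesis by simp
        qed
        moreover have "c div int N < int M" using 4 N by (intro int_div_less) auto
        ultimately show ?case using N by auto
      qed (use N in auto)
      also have "\<dots> = ?R 0 + (\<Sum>c\<in>{1..<N * M}. ?R (int c)) + (\<Sum>c\<in>{1..N * M}. ?R (int c))"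
        using N elim by (intro sum_symmetric_int_interval lat_row_uminus[OF assms]) simp
      finally show ?case by simp
    qed
  qed
qed

text \<open>The row c = 0: there w and its conjugate both equal d, so the row is this constant times
  (Im z)^(K+1). The term d = 0 vanishes by division by 0.\<close>

definition const_coeff :: complex where
  "const_coeff = (\<Sum>\<^sub>\<infinity>d. \<phi> (0, d) / of_int d ^ (K + 2))"

lemma lat_row_0: "lat_row K \<phi> z 0 = const_coeff * of_real (Im z) ^ Suc K"
proof -
  have "lat_row K \<phi> z 0 = (\<Sum>\<^sub>\<infinity>d. of_real (Im z) ^ Suc K * (\<phi> (0, d) / of_int d ^ (K + 2)))"
    unfolding lat_row_def by (intro infsum_cong) (simp add: lat_term_def lat_point_def)
  then show ?thesis by (simp only: infsum_cmult_right' const_coeff_def mult.commute)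
qed

lemma lat_line_has_sum:
  assumes "Im z > 0" "c \<ge> 1"
  defines "w \<equiv> \<lambda>b. (of_nat c * z + of_int b) / of_nat N"
  shows "((\<lambda>n. lat_term K z (int c, int N * n + b)) has_sum
     fourier_const N K / of_nat c ^ Suc K * (1 + power_nome_series 0 (w b) +
       (\<Sum>i\<le>K. of_real ((4 * pi * Im z / N) ^ i / fact i) * (of_nat c ^ i * cnj (power_nome_series i (w b)))))) UNIV"
proof -
  have Im: "Im (w b) = real c * Im z / real N" by (simp add: w_def)
  have pos: "Im (w b) > 0" unfolding Im using assms N by simp
  let ?k = "of_real (Im z) ^ Suc K / of_nat N ^ (K + 2) :: complex"
  have "((\<lambda>n. ?k * (1 / ((w b + of_int n) * (cnj (w b) + of_int n) ^ Suc K))) has_sum ?k * line_sum K (w b)) UNIV"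
    by (intro has_sum_cmult_right has_sum_line_sum pos)
  moreover have "?k * (1 / ((w b + of_int n) * (cnj (w b) + of_int n) ^ Suc K)) = lat_term K z (int c, int N * n + b)" for n
  proof -
    have "lat_point z (int c, int N * n + b) = of_nat N * (w b + of_int n)"
      using N by (simp add: lat_point_def w_def field_simps)
    then show ?thesis by (simp add: lat_term_def power_mult_distrib)
  qed
  moreover have "?k * line_sum K (w b) = fourier_const N K / of_nat c ^ Suc K * (1 + power_nome_series 0 (w b) +
       (\<Sum>i\<le>K. of_real ((4 * pi * Im z / N) ^ i / fact i) * (of_nat c ^ i * cnj (power_nome_series i (w b)))))"
  proof -
    have 1: "?k * (2 * of_real pi * \<i> * (-1) ^ K / (2 * \<i> * of_real (Im (w b))) ^ Suc K) = fourier_const N K / of_nat c ^ Suc K"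
    proof -
      define y where "y = (of_real (Im z) :: complex)"
      have y: "y \<noteq> 0" using assms by (simp add: y_def)
      have d: "2 * \<i> * of_real (Im (w b)) = 2 * \<i> * of_nat c * y / of_nat N" unfolding Im by (simp add: y_def)
      show ?thesis unfolding d y_def[symmetric] fourier_const_def using N assms(2) y
        by (simp add: power_mult_distrib power_divide field_simps)
    qed
    have 2: "of_real ((4 * pi * Im (w b)) ^ i / fact i) * X = of_real ((4 * pi * Im z / N) ^ i / fact i) * (of_nat c ^ i * X)" for i and X :: complex
      unfolding Im by (simp add: power_mult_distrib power_divide)
    show ?thesis unfolding line_sum_def 2 1[symmetric] by (simp only: mult.assoc[symmetric])
  qed
  ultimately show ?thesis by simp
qed

section \<open>Fourier coefficients of the rows\<close>

definition holo_pair :: "nat \<times> nat \<Rightarrow> complex" where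
  "holo_pair = (\<lambda>(c, n). fourier_const N K / of_nat c ^ Suc K * dft N \<phi> (int c) (int n))"

text \<open>The non-holomorphic part is described by the holomorphic series whose conjugate it
  contains. Hence the coefficient is conjugated and the frequency n is replaced by - n.\<close>

definition anti_pair :: "nat \<times> nat \<Rightarrow> complex" where
  "anti_pair = (\<lambda>(c, n). cnj (fourier_const N K / of_nat c ^ Suc K * dft N \<phi> (int c) (- int n)))"

lemma pair_bounds:
  "\<exists>B\<ge>0. \<forall>c\<ge>1. \<forall>n. norm (holo_pair (c, n)) \<le> B \<and> norm (anti_pair (c, n)) \<le> B"
proof -
  obtain B where B: "B \<ge> 0" "\<And>v. norm (\<phi> v) \<le> B" using \<phi>_bounded by blast
  have d: "norm (dft N \<phi> c n) \<le> real N * B" for c n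
  proof -
    have "norm (dft N \<phi> c n) \<le> (\<Sum>b\<in>{0..<int N}. B)"
      unfolding dft_def
    proof (rule sum_norm_le)
      fix b
      have "norm (unity_exp (of_int (n * b) / of_nat N)) = 1"
        by (simp add: norm_unity_exp complex_of_real_def[symmetric] Im_divide_of_nat)
      then show "norm (\<phi> (c, b) * unity_exp (of_int (n * b) / of_nat N)) \<le> B" using B(2) by (simp add: norm_mult)
    qed
    then show ?thesis by simp
  qed
  have "norm (fourier_const N K / of_nat c ^ Suc K * dft N \<phi> a n) \<le> norm (fourier_const N K) * (real N * B)" if "c \<ge> 1" for c :: nat and a n
  proof -
    have "norm (fourier_const N K / of_nat c ^ Suc K) \<le> norm (fourier_const N K)"
      using that one_le_power[of "real c" "Suc K"]
      by (simp add: norm_divide norm_mult norm_power divide_le_eq mult_left_le_one_le mult_le_cancel_left1 del: power_Suc)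
    then show ?thesis unfolding norm_mult using d by (intro mult_mono) auto
  qed
  note bound = this
  show ?thesis
  proof (intro exI[of _ "norm (fourier_const N K) * (real N * B)"] conjI allI impI)
    fix c n :: nat assume c: "c \<ge> 1"
    show "norm (holo_pair (c, n)) \<le> norm (fourier_const N K) * (real N * B)"
      unfolding holo_pair_def prod.case by (rule bound[OF c])
    show "norm (anti_pair (c, n)) \<le> norm (fourier_const N K) * (real N * B)"
      unfolding anti_pair_def prod.case complex_mod_cnj by (rule bound[OF c])
  qed (use B(1) in simp)
qed

definition holo_row :: "complex \<Rightarrow> nat \<Rightarrow> complex" where
  "holo_row z c = fourier_const N K / of_nat c ^ Suc K *
     (\<Sum>b\<in>{0..<int N}. \<phi> (int c, b) * power_nome_series 0 ((of_nat c * z + of_int b) / of_nat N))"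

definition anti_row :: "complex \<Rightarrow> nat \<Rightarrow> nat \<Rightarrow> complex" where
  "anti_row z i c = cnj (fourier_const N K) / of_nat c ^ Suc K *
     (\<Sum>b\<in>{0..<int N}. cnj (\<phi> (int c, b)) * (of_nat c ^ i * power_nome_series i ((of_nat c * z + of_int b) / of_nat N)))"

lemma row_nome:
  assumes "Im z > 0" "c \<ge> 1"
  shows "unity_exp (of_nat n * ((of_nat c * z + of_int b) / of_nat N)) =
     unity_exp (of_nat (c * n) * z / of_nat N) * unity_exp (of_int (int n * b) / of_nat N)"
  unfolding unity_exp_add[symmetric] using N by (simp add: field_simps)

lemma row_Im_pos:
  assumes "Im z > 0" "c \<ge> 1"
  shows "Im ((of_nat c * z + of_int b) / of_nat N) > 0"
  using assms N by simp

lemma holo_row_has_sum: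
  assumes "Im z > 0" "c \<ge> 1"
  shows "((\<lambda>n. holo_pair (c, n) * unity_exp (of_nat (c * n) * z / of_nat N)) has_sum holo_row z c) {1..}"
proof -
  have "((\<lambda>n. fourier_const N K / of_nat c ^ Suc K * (\<Sum>b\<in>{0..<int N}. \<phi> (int c, b) *
       (of_nat n ^ 0 * unity_exp (of_nat n * ((of_nat c * z + of_int b) / of_nat N))))) has_sum holo_row z c) {1..}"
    unfolding holo_row_def
    by (intro has_sum_cmult_right has_sum_sum power_nome_series_has_sum row_Im_pos assms) simp
  then show ?thesis
    unfolding row_nome[OF assms] by (simp add: holo_pair_def dft_def sum_distrib_left sum_distrib_right mult_ac)
qed

lemma anti_row_has_sum:
  assumes "Im z > 0" "c \<ge> 1"
  shows "((\<lambda>n. of_nat (c * n) ^ i * anti_pair (c, n) * unity_exp (of_nat (c * n) * z / of_nat N)) has_sum anti_row z i c) {1..}"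
proof -
  have 1: "((\<lambda>n. cnj (fourier_const N K) / of_nat c ^ Suc K * (\<Sum>b\<in>{0..<int N}. cnj (\<phi> (int c, b)) * (of_nat c ^ i *
       (of_nat n ^ i * unity_exp (of_nat n * ((of_nat c * z + of_int b) / of_nat N)))))) has_sum anti_row z i c) {1..}"
    unfolding anti_row_def
    by (intro has_sum_cmult_right has_sum_sum power_nome_series_has_sum row_Im_pos assms) simp
  have e: "cnj (unity_exp (of_int (- int n * b) / of_nat N)) = unity_exp (of_int (int n * b) / of_nat N)" for n b
    using cnj_unity_exp[of "real_of_int (- int n * b) / real N"] by simp
  have "cnj (dft N \<phi> (int c) (- int n)) = (\<Sum>b\<in>{0..<int N}. cnj (\<phi> (int c, b)) * unity_exp (of_int (int n * b) / of_nat N))" for n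
    by (simp only: dft_def cnj_sum complex_cnj_mult e)
  then show ?thesis using 1
    unfolding row_nome[OF assms] by (simp add: anti_pair_def sum_distrib_left sum_distrib_right sum_divide_distrib power_mult_distrib mult_ac)
qed

lemma lat_row_eq:
  assumes "Im z > 0" "c \<ge> 1"
  shows "lat_row K \<phi> z (int c) = fourier_const N K / of_nat c ^ Suc K * (\<Sum>b\<in>{0..<int N}. \<phi> (int c, b)) + holo_row z c +
     (\<Sum>i\<le>K. of_real ((4 * pi * Im z / N) ^ i / fact i) * cnj (anti_row z i c))"
proof -
  let ?w = "\<lambda>b. (of_nat c * z + of_int b) / of_nat N"
  let ?L = "\<lambda>b. fourier_const N K / of_nat c ^ Suc K * (1 + power_nome_series 0 (?w b) +
       (\<Sum>i\<le>K. of_real ((4 * pi * Im z / N) ^ i / fact i) * (of_nat c ^ i * cnj (power_nome_series i (?w b)))))"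
  have "((\<lambda>n. \<Sum>b\<in>{0..<int N}. \<phi> (int c, int N * n + b) * lat_term K z (int c, int N * n + b)) has_sum lat_row K \<phi> z (int c)) UNIV"
    by (rule has_sum_int_blocks[OF lat_row_has_sum[OF assms(1)] N])
  moreover have "\<phi> (int c, int N * n + b) = \<phi> (int c, b)" for n b
    using periodic[of "int c" 0 b n] by (simp add: add.commute)
  moreover have "((\<lambda>n. \<Sum>b\<in>{0..<int N}. \<phi> (int c, b) * lat_term K z (int c, int N * n + b)) has_sum (\<Sum>b\<in>{0..<int N}. \<phi> (int c, b) * ?L b)) UNIV"
    by (intro has_sum_sum has_sum_cmult_right lat_line_has_sum assms) simp
  ultimately have "lat_row K \<phi> z (int c) = (\<Sum>b\<in>{0..<int N}. \<phi> (int c, b) * ?L b)"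
    using has_sum_unique by simp blast
  also have "\<dots> = fourier_const N K / of_nat c ^ Suc K * (\<Sum>b\<in>{0..<int N}. \<phi> (int c, b)) + holo_row z c +
     (\<Sum>b\<in>{0..<int N}. \<Sum>i\<le>K. of_real ((4 * pi * Im z / N) ^ i / fact i) *
        (fourier_const N K / of_nat c ^ Suc K * (\<phi> (int c, b) * (of_nat c ^ i * cnj (power_nome_series i (?w b))))))"
    by (simp add: holo_row_def distrib_left distrib_right sum.distrib sum_distrib_left sum_divide_distrib mult_ac)
  also have "(\<Sum>b\<in>{0..<int N}. \<Sum>i\<le>K. of_real ((4 * pi * Im z / N) ^ i / fact i) *
        (fourier_const N K / of_nat c ^ Suc K * (\<phi> (int c, b) * (of_nat c ^ i * cnj (power_nome_series i (?w b)))))) =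
     (\<Sum>i\<le>K. of_real ((4 * pi * Im z / N) ^ i / fact i) * cnj (anti_row z i c))"
    by (subst sum.swap) (simp add: anti_row_def sum_distrib_left)
  finally show ?thesis .
qed

lemma has_sum_pairs_imp_tendsto:
  fixes f :: "nat \<times> nat \<Rightarrow> complex"
  assumes "(f has_sum S) ({1..} \<times> {1..})" "\<And>c. c \<ge> 1 \<Longrightarrow> ((\<lambda>n. f (c, n)) has_sum r c) {1..}"
  shows "(\<lambda>M. \<Sum>c\<in>{1..<N * M}. r c) \<longlonglongrightarrow> S" "(\<lambda>M. \<Sum>c\<in>{1..N * M}. r c) \<longlonglongrightarrow> S"
proof -
  have r: "(r has_sum S) {1..}" by (rule has_sum_SigmaD[OF assms(1)]) (use assms(2) in auto)
  have ev: "eventually (\<lambda>M. x < N * M) sequentially" for x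
    using eventually_gt_at_top[of x]
  proof eventually_elim
    case (elim M)
    also have "M \<le> N * M" using N by simp
    finally show ?case .
  qed
  show "(\<lambda>M. \<Sum>c\<in>{1..<N * M}. r c) \<longlonglongrightarrow> S"
    by (rule has_sum_imp_tendsto[OF r]) (use ev in auto)
  show "(\<lambda>M. \<Sum>c\<in>{1..N * M}. r c) \<longlonglongrightarrow> S"
    by (rule has_sum_imp_tendsto[OF r]) (auto intro: eventually_mono[OF ev less_imp_le])
qed

text \<open>Stems from the summand 1 in \<open>line_sum\<close>. For K = 0 the bound on it decays
  only like 1 / c, so the sum over rows cannot be rearranged freely.\<close>

definition row_const :: "nat \<Rightarrow> complex" where
  "row_const c = fourier_const N K / of_nat c ^ Suc K * (\<Sum>b\<in>{0..<int N}. \<phi> (int c, b))"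

text \<open>The limit exists by \<open>lat_sum_eq_aux\<close>, since all other parts of the
  expansion of the rows converge.\<close>

definition limit_const :: complex where
  "limit_const = lim (\<lambda>M. (\<Sum>c\<in>{1..<N * M}. row_const c) + (\<Sum>c\<in>{1..N * M}. row_const c))"

definition holo_coeff :: "nat \<Rightarrow> complex" where "holo_coeff = divisor_conv holo_pair"
definition anti_coeff :: "nat \<Rightarrow> complex" where "anti_coeff = divisor_conv anti_pair"

definition anti_series :: "nat \<Rightarrow> complex \<Rightarrow> complex" where
  "anti_series i = nome_series N (\<lambda>m. of_nat m ^ i * anti_coeff m)"

lemma poly_bounded_holo_coeff: "poly_bounded holo_coeff"
proof -
  obtain B where "B \<ge> 0" "\<And>c n. c \<ge> 1 \<Longrightarrow> norm (holo_pair (c, n)) \<le> B" using pair_bounds by blast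
  then show ?thesis unfolding holo_coeff_def by (intro divisor_conv_poly_bounded[of B _ 0]) auto
qed

lemma poly_bounded_anti_coeff: "poly_bounded (\<lambda>m. of_nat m ^ i * anti_coeff m)"
proof (induction i)
  case 0
  obtain B where "B \<ge> 0" "\<And>c n. c \<ge> 1 \<Longrightarrow> norm (anti_pair (c, n)) \<le> B" using pair_bounds by blast
  then show ?case unfolding anti_coeff_def by (simp, intro divisor_conv_poly_bounded[of B _ 0]) auto
next
  case (Suc i)
  from poly_bounded_mult_of_nat[OF this, of 1] show ?case by (simp add: mult.assoc)
qed

lemma holo_pairs_has_sum:
  assumes "Im z > 0"
  shows "((\<lambda>(c, n). holo_pair (c, n) * unity_exp (of_nat (c * n) * z / of_nat N)) has_sum nome_series N holo_coeff z) ({1..} \<times> {1..})"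
proof -
  obtain B where "B \<ge> 0" "\<And>c n. c \<ge> 1 \<Longrightarrow> norm (holo_pair (c, n)) \<le> B" using pair_bounds by blast
  then show ?thesis unfolding holo_coeff_def using N assms by (intro has_sum_divisor_conv[of B _ 0]) auto
qed

lemma anti_pairs_has_sum:
  assumes "Im z > 0"
  shows "((\<lambda>(c, n). of_nat (c * n) ^ i * anti_pair (c, n) * unity_exp (of_nat (c * n) * z / of_nat N)) has_sum anti_series i z) ({1..} \<times> {1..})"
proof -
  obtain B where B: "B \<ge> 0" "\<And>c n. c \<ge> 1 \<Longrightarrow> norm (anti_pair (c, n)) \<le> B" using pair_bounds by blast
  define g where "g = (\<lambda>(c, n). of_nat (c * n) ^ i * anti_pair (c, n))"
  have "norm (g (c, n)) \<le> B * real (c * n) ^ i" if "c \<ge> 1" for c n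
    using mult_left_mono[OF B(2)[OF that, of n], of "real (c * n) ^ i"]
    by (simp add: g_def norm_mult norm_power mult.commute del: of_nat_mult)
  then have "((\<lambda>(c, n). g (c, n) * unity_exp (of_nat (c * n) * z / of_nat N)) has_sum nome_series N (divisor_conv g) z) ({1..} \<times> {1..})"
    using N assms B(1) by (intro has_sum_divisor_conv[of B _ i]) auto
  moreover have "divisor_conv g = (\<lambda>m. of_nat m ^ i * anti_coeff m)"
    by (auto simp: fun_eq_iff divisor_conv_def anti_coeff_def g_def sum_distrib_left simp del: of_nat_mult intro!: sum.cong)
  ultimately show ?thesis by (simp add: anti_series_def g_def)
qed

text \<open>The row constants are the rows minus their two exponential series. As the rows and both
  series converge in this order of summation, so do the constants. They do not involve z, so the
  limit is the same at every point.\<close>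

lemma lat_sum_eq_aux:
  assumes "Im z > 0"
  shows "(\<lambda>M. (\<Sum>c\<in>{1..<N * M}. row_const c) + (\<Sum>c\<in>{1..N * M}. row_const c)) \<longlonglongrightarrow>
      lat_sum N K \<phi> z - lat_row K \<phi> z 0 - 2 * nome_series N holo_coeff z -
        2 * (\<Sum>i\<le>K. of_real ((4 * pi * Im z / N) ^ i / fact i) * cnj (anti_series i z))"
proof -
  let ?k = "\<lambda>i. of_real ((4 * pi * Im z / N) ^ i / fact i) :: complex"
  have H: "(\<lambda>M. \<Sum>c\<in>{1..<N * M}. holo_row z c) \<longlonglongrightarrow> nome_series N holo_coeff z"
          "(\<lambda>M. \<Sum>c\<in>{1..N * M}. holo_row z c) \<longlonglongrightarrow> nome_series N holo_coeff z"
    by (rule has_sum_pairs_imp_tendsto[OF holo_pairs_has_sum[OF assms]], use holo_row_has_sum[OF assms] in simp)+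
  have A: "(\<lambda>M. \<Sum>c\<in>{1..<N * M}. anti_row z i c) \<longlonglongrightarrow> anti_series i z"
          "(\<lambda>M. \<Sum>c\<in>{1..N * M}. anti_row z i c) \<longlonglongrightarrow> anti_series i z" for i
    by (rule has_sum_pairs_imp_tendsto[OF anti_pairs_has_sum[OF assms]], use anti_row_has_sum[OF assms] in simp)+
  have eq: "(\<Sum>c\<in>X. row_const c) = (\<Sum>c\<in>X. lat_row K \<phi> z (int c)) - (\<Sum>c\<in>X. holo_row z c) -
      (\<Sum>i\<le>K. ?k i * cnj (\<Sum>c\<in>X. anti_row z i c))" if "\<And>c. c \<in> X \<Longrightarrow> c \<ge> 1" for X
  proof -
    have "(\<Sum>i\<le>K. ?k i * cnj (\<Sum>c\<in>X. anti_row z i c)) = (\<Sum>c\<in>X. \<Sum>i\<le>K. ?k i * cnj (anti_row z i c))"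
      by (simp only: cnj_sum sum_distrib_left) (rule sum.swap)
    moreover have "(\<Sum>c\<in>X. lat_row K \<phi> z (int c)) = (\<Sum>c\<in>X. row_const c + holo_row z c + (\<Sum>i\<le>K. ?k i * cnj (anti_row z i c)))"
      using that by (intro sum.cong refl) (simp only: lat_row_eq[OF assms] row_const_def)
    ultimately show ?thesis by (simp add: sum.distrib)
  qed
  have "(\<lambda>M. ((\<Sum>c\<in>{1..<N * M}. lat_row K \<phi> z (int c)) + (\<Sum>c\<in>{1..N * M}. lat_row K \<phi> z (int c)))
      - (\<Sum>c\<in>{1..<N * M}. holo_row z c) - (\<Sum>c\<in>{1..N * M}. holo_row z c)
      - (\<Sum>i\<le>K. ?k i * cnj (\<Sum>c\<in>{1..<N * M}. anti_row z i c)) - (\<Sum>i\<le>K. ?k i * cnj (\<Sum>c\<in>{1..N * M}. anti_row z i c)))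
    \<longlonglongrightarrow> (lat_sum N K \<phi> z - lat_row K \<phi> z 0) - nome_series N holo_coeff z - nome_series N holo_coeff z
      - (\<Sum>i\<le>K. ?k i * cnj (anti_series i z)) - (\<Sum>i\<le>K. ?k i * cnj (anti_series i z))"
    by (intro tendsto_diff tendsto_sum tendsto_mult tendsto_const tendsto_cnj lat_rows_tendsto assms H A)
  moreover have "(\<Sum>c\<in>{1..<N * M}. row_const c) + (\<Sum>c\<in>{1..N * M}. row_const c) =
     ((\<Sum>c\<in>{1..<N * M}. lat_row K \<phi> z (int c)) + (\<Sum>c\<in>{1..N * M}. lat_row K \<phi> z (int c)))
      - (\<Sum>c\<in>{1..<N * M}. holo_row z c) - (\<Sum>c\<in>{1..N * M}. holo_row z c)
      - (\<Sum>i\<le>K. ?k i * cnj (\<Sum>c\<in>{1..<N * M}. anti_row z i c)) - (\<Sum>i\<le>K. ?k i * cnj (\<Sum>c\<in>{1..N * M}. anti_row z i c))" for M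
    by (subst (1 2) eq) auto
  ultimately have "(\<lambda>M. (\<Sum>c\<in>{1..<N * M}. row_const c) + (\<Sum>c\<in>{1..N * M}. row_const c))
    \<longlonglongrightarrow> (lat_sum N K \<phi> z - lat_row K \<phi> z 0) - nome_series N holo_coeff z - nome_series N holo_coeff z
      - (\<Sum>i\<le>K. ?k i * cnj (anti_series i z)) - (\<Sum>i\<le>K. ?k i * cnj (anti_series i z))"
    by (simp only:)
  then show ?thesis by (simp add: algebra_simps)
qed

text \<open>The two ranges differ by the single row N M, whose constant tends to 0. Existence of the
  limit is taken from the expansion at the point z = i.\<close>

lemma limit_const_tendsto: "(\<lambda>M. 2 * (\<Sum>c\<in>{1..N * M}. row_const c)) \<longlonglongrightarrow> limit_const"
proof -
  have *: "(\<lambda>M. (\<Sum>c\<in>{1..<N * M}. row_const c) + (\<Sum>c\<in>{1..N * M}. row_const c)) \<longlonglongrightarrow> limit_const"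
    using lat_sum_eq_aux[of \<i>] limI unfolding limit_const_def by fastforce
  obtain B where B: "\<And>v. norm (\<phi> v) \<le> B" using \<phi>_bounded by blast
  have bnd: "norm (row_const c) \<le> norm (fourier_const N K) * (real N * B) / real c" if "c \<ge> 1" for c
  proof -
    have "norm (\<Sum>b\<in>{0..<int N}. \<phi> (int c, b)) \<le> real N * B"
      using sum_norm_le[of "{0..<int N}" "\<lambda>b. \<phi> (int c, b)" "\<lambda>_. B"] B by simp
    moreover have "norm (fourier_const N K / of_nat c ^ Suc K) \<le> norm (fourier_const N K) / real c"
      using that self_le_power[of "real c" "Suc K"] unfolding norm_divide norm_power norm_of_nat
      by (intro divide_left_mono) auto
    ultimately have "norm (row_const c) \<le> norm (fourier_const N K) / real c * (real N * B)"
      unfolding row_const_def norm_mult by (intro mult_mono) auto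
    then show ?thesis by simp
  qed
  have "(\<lambda>M. row_const (N * M)) \<longlonglongrightarrow> 0"
  proof (rule Lim_null_comparison)
    show "eventually (\<lambda>M. norm (row_const (N * M)) \<le> norm (fourier_const N K) * (real N * B) / real (N * M)) sequentially"
      using eventually_ge_at_top[of 1] by eventually_elim (use N in \<open>auto intro!: bnd simp del: of_nat_mult\<close>)
    have "N > 0" by (rule N)
    then show "(\<lambda>M. norm (fourier_const N K) * (real N * B) / real (N * M)) \<longlonglongrightarrow> 0" by real_asymp
  qed
  from tendsto_add[OF * this] have "(\<lambda>M. (\<Sum>c\<in>{1..<N * M}. row_const c) + (\<Sum>c\<in>{1..N * M}. row_const c) + row_const (N * M)) \<longlonglongrightarrow> limit_const"
    by simp
  then show ?thesis
  proof (rule Lim_transform_eventually)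
    show "eventually (\<lambda>M. (\<Sum>c\<in>{1..<N * M}. row_const c) + (\<Sum>c\<in>{1..N * M}. row_const c) + row_const (N * M) =
        2 * (\<Sum>c\<in>{1..N * M}. row_const c)) sequentially"
      using eventually_ge_at_top[of 1]
    proof eventually_elim
      case (elim M)
      then have "{1..N * M} = insert (N * M) {1..<N * M}" using N by (auto simp: Suc_le_eq)
      then show ?case by simp
    qed
  qed
qed

definition holo_fun :: "complex \<Rightarrow> complex" where
  "holo_fun z = limit_const + 2 * nome_series N holo_coeff z"

text \<open>The factor 2 accounts for the rows c and - c; the j-th power is the effect of j
  differentiations.\<close>

definition anti_fun :: "nat \<Rightarrow> complex \<Rightarrow> complex" where
  "anti_fun j = nome_series N (\<lambda>m. 2 * (2 * of_real pi * \<i> * of_nat m / of_nat N) ^ j * anti_coeff m)"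

lemma anti_fun_eq:
  assumes "Im z > 0"
  shows "anti_fun j z = 2 * (2 * of_real pi * \<i> / of_nat N) ^ j * anti_series j z"
proof -
  have "(\<lambda>m. 2 * (2 * of_real pi * \<i> / of_nat N) ^ j * (of_nat m ^ j * anti_coeff m * unity_exp (of_nat m * z / of_nat N)))
    sums (2 * (2 * of_real pi * \<i> / of_nat N) ^ j * anti_series j z)"
    unfolding anti_series_def by (intro sums_mult nome_series_sums poly_bounded_anti_coeff N assms)
  then show ?thesis
    unfolding anti_fun_def nome_series_def by (simp add: sums_iff power_mult_distrib power_divide mult_ac)
qed

lemma poly_bounded_anti_fun: "poly_bounded (\<lambda>m. 2 * (2 * of_real pi * \<i> * of_nat m / of_nat N) ^ j * anti_coeff m)"
proof (induction j)
  case 0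
  from poly_bounded_anti_coeff[of 0] obtain B p where B: "\<And>m. norm (anti_coeff m) \<le> B * real (Suc m) ^ p"
    by (auto simp: poly_bounded_def)
  have "norm (2 * anti_coeff m) \<le> (2 * B) * real (Suc m) ^ p" for m using B[of m] by (simp add: norm_mult)
  then have "poly_bounded (\<lambda>m. 2 * anti_coeff m)" unfolding poly_bounded_def by blast
  then show ?case by simp
next
  case (Suc j)
  from poly_bounded_mult_of_nat[OF this, of "2 * of_real pi * \<i> / of_nat N"]
  show ?case by (simp add: mult_ac)
qed

lemma anti_fun_deriv:
  assumes "z \<in> upper_half_plane"
  shows "(anti_fun j has_field_derivative anti_fun (Suc j) z) (at z)"
proof -
  have eq: "(\<lambda>m. 2 * of_real pi * \<i> / of_nat N * of_nat m * (2 * (2 * of_real pi * \<i> * of_nat m / of_nat N) ^ j * anti_coeff m)) =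
    (\<lambda>m. 2 * (2 * of_real pi * \<i> * of_nat m / of_nat N) ^ Suc j * anti_coeff m)"
    by (simp add: fun_eq_iff)
  show ?thesis
    using nome_series_deriv[OF poly_bounded_anti_fun N, of z j UNIV] assms
    unfolding eq by (simp only: anti_fun_def upper_half_plane_def mem_Collect_eq)
qed

lemma holo_fun_deriv:
  assumes "z \<in> upper_half_plane"
  shows "(holo_fun has_field_derivative
    2 * nome_series N (\<lambda>n. 2 * of_real pi * \<i> / of_nat N * of_nat n * holo_coeff n) z) (at z)"
proof -
  have "((\<lambda>z. limit_const + 2 * nome_series N holo_coeff z) has_field_derivative
    0 + 2 * nome_series N (\<lambda>n. 2 * of_real pi * \<i> / of_nat N * of_nat n * holo_coeff n) z) (at z)"
    using assms by (intro DERIV_add DERIV_const DERIV_cmult nome_series_deriv poly_bounded_holo_coeff N) (simp add: upper_half_plane_def)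
  then show ?thesis by (simp add: holo_fun_def[abs_def])
qed

lemma holo_fun_deriv_holomorphic:
  "(\<lambda>z. 2 * nome_series N (\<lambda>n. 2 * of_real pi * \<i> / of_nat N * of_nat n * holo_coeff n) z) holomorphic_on upper_half_plane"
proof (rule holomorphic_on_mult[OF holomorphic_on_const])
  show "nome_series N (\<lambda>n. 2 * of_real pi * \<i> / of_nat N * of_nat n * holo_coeff n) holomorphic_on upper_half_plane"
    unfolding holomorphic_on_def field_differentiable_def
    by (intro ballI exI, rule nome_series_deriv[OF poly_bounded_mult_of_nat[OF poly_bounded_holo_coeff] N])
       (simp add: upper_half_plane_def)
qed

theorem lat_sum_eq_harmonic_poly:
  assumes "Im z > 0"
  shows "lat_sum N K \<phi> z = harmonic_poly K const_coeff holo_fun anti_fun z"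
proof -
  have "limit_const = lat_sum N K \<phi> z - lat_row K \<phi> z 0 - 2 * nome_series N holo_coeff z -
        2 * (\<Sum>i\<le>K. of_real ((4 * pi * Im z / N) ^ i / fact i) * cnj (anti_series i z))"
    unfolding limit_const_def by (rule limI[OF lat_sum_eq_aux[OF assms]])
  moreover have "antiholo_part K anti_fun z = 2 * (\<Sum>i\<le>K. of_real ((4 * pi * Im z / N) ^ i / fact i) * cnj (anti_series i z))"
    unfolding antiholo_part_def sum_distrib_left
  proof (intro sum.cong refl)
    fix i
    \<comment> \<open>z minus its conjugate, multiplied by the conjugate of 2 pi i / N, is the
      positive number 4 pi y / N. So the Taylor shape of \<open>antiholo_part\<close> is the sum
      produced by \<open>line_sum\<close>.\<close>
    have "(2 * \<i> * of_real (Im z)) ^ i * cnj ((2 * of_real pi * \<i> / of_nat N) ^ i) = of_real ((4 * pi * Im z / N) ^ i)"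
    proof -
      have "2 * \<i> * of_real (Im z) * cnj (2 * of_real pi * \<i> / of_nat N) = of_real (4 * pi * Im z / N)"
        by (simp add: complex_eq_iff)
      then show ?thesis
        by (simp only: complex_cnj_power power_mult_distrib[symmetric] of_real_power)
    qed
    then show "(z - cnj z) ^ i / fact i * cnj (anti_fun i z) =
       2 * (of_real ((4 * pi * Im z / N) ^ i / fact i) * cnj (anti_series i z))"
      unfolding anti_fun_eq[OF assms] diff_cnj_eq complex_cnj_mult by (simp add: mult_ac)
  qed
  ultimately show ?thesis by (simp add: harmonic_poly_def lat_row_0 holo_fun_def)
qed

end

section \<open>Growth\<close>

text \<open>On Im z >= 1 every term has modulus at most its modulus at i, so the absolute series at
  i is a uniform majorant.\<close>

lemma norm_nome_series_le:
  assumes "poly_bounded a" "N > 0" "Im z \<ge> 1"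
  shows "norm (nome_series N a z) \<le> (\<Sum>n. norm (a n * unity_exp (of_nat n * \<i> / of_nat N)))"
proof -
  have z: "Im z > 0" using assms by simp
  have "norm (nome_series N a z) \<le> (\<Sum>n. norm (a n * unity_exp (of_nat n * z / of_nat N)))"
    unfolding nome_series_def by (rule summable_norm[OF nome_series_summable[OF assms(1,2) z]])
  also have "\<dots> \<le> (\<Sum>n. norm (a n * unity_exp (of_nat n * \<i> / of_nat N)))"
  proof (rule suminf_le)
    show "norm (a n * unity_exp (of_nat n * z / of_nat N)) \<le> norm (a n * unity_exp (of_nat n * \<i> / of_nat N))" for n
      unfolding norm_mult norm_unity_exp using assms mult_right_mono[of 1 "Im z" "real n"]
      by (intro mult_left_mono) (auto simp: divide_right_mono mult.commute)
  qed (use assms z in \<open>auto intro!: nome_series_summable\<close>)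
  finally show ?thesis .
qed

lemma power_le_fact_exp:
  fixes x :: real
  assumes "x \<ge> 0"
  shows "x ^ n / fact n \<le> exp x"
proof -
  have s: "summable (\<lambda>n. x ^ n / fact n)" using summable_exp_generic[of x] by (simp add: divide_inverse mult.commute)
  have "(\<Sum>i\<in>{n}. x ^ i / fact i) \<le> (\<Sum>n. x ^ n / fact n)"
    using assms s by (intro sum_le_suminf) auto
  then show ?thesis by (simp add: exp_def divide_inverse mult.commute)
qed

text \<open>The exponent 2 comes from |z - z'| = 2 y: each factor (2 y)^j / j! is at most exp (2
  y).\<close>

lemma harmonic_poly_growth:
  assumes "\<And>z. Im z \<ge> 1 \<Longrightarrow> norm (P z) \<le> D" "\<And>j z. Im z \<ge> 1 \<Longrightarrow> norm (H j z) \<le> E j"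
  shows "\<exists>A. \<forall>z. Im z \<ge> 1 \<longrightarrow> norm (harmonic_poly K C P H z) \<le> A * exp (2 * Im z)"
proof (intro exI allI impI)
  fix z assume z: "Im z \<ge> 1"
  define y where "y = Im z"
  have y: "y \<ge> 1" using z by (simp add: y_def)
  have D: "D \<ge> 0" and E: "\<And>j. E j \<ge> 0" using assms(1)[OF z] assms(2)[OF z] norm_ge_zero order_trans by blast+
  have "norm (harmonic_poly K C P H z) \<le> norm (P z) + norm (C * of_real y ^ Suc K) + norm (antiholo_part K H z)"
    unfolding harmonic_poly_def y_def by (intro order_trans[OF norm_triangle_ineq] add_mono norm_triangle_ineq order_refl)
  also have "norm (P z) \<le> D * exp (2 * y)"
    using assms(1)[OF z] D y mult_left_mono[of 1 "exp (2 * y)" D] by simp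
  also have "norm (C * of_real y ^ Suc K) \<le> norm C * fact (Suc K) * exp (2 * y)"
  proof -
    have "y ^ Suc K / fact (Suc K) \<le> exp y" by (rule power_le_fact_exp) (use y in simp)
    also have "\<dots> \<le> exp (2 * y)" using y by simp
    finally have "y ^ Suc K \<le> exp (2 * y) * fact (Suc K)"
      by (simp only: pos_divide_le_eq[OF fact_gt_zero])
    then have "norm C * y ^ Suc K \<le> norm C * (exp (2 * y) * fact (Suc K))" by (intro mult_left_mono) auto
    then show ?thesis using y by (simp add: norm_mult norm_power mult_ac)
  qed
  also have "norm (antiholo_part K H z) \<le> (\<Sum>j\<le>K. E j) * exp (2 * y)"
    unfolding antiholo_part_def sum_distrib_right
  proof (rule sum_norm_le)
    fix j
    have "norm ((z - cnj z) ^ j / fact j) = (2 * y) ^ j / fact j"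
      using y unfolding diff_cnj_eq y_def[symmetric] by (simp add: norm_divide norm_power norm_mult)
    also have "\<dots> \<le> exp (2 * y)" by (rule power_le_fact_exp) (use y in simp)
    finally show "norm ((z - cnj z) ^ j / fact j * cnj (H j z)) \<le> E j * exp (2 * y)"
      unfolding norm_mult mult.commute[of "E j"] using assms(2)[OF z] by (intro mult_mono) auto
  qed
  finally show "norm (harmonic_poly K C P H z) \<le> (D + norm C * fact (Suc K) + (\<Sum>j\<le>K. E j)) * exp (2 * Im z)"
    by (simp only: y_def distrib_right)
qed

section \<open>Behaviour at the cusps\<close>

lemma antiholo_part_scale: "cnj s = s \<Longrightarrow> antiholo_part K (\<lambda>j z. s * H j z) z = s * antiholo_part K H z"
  by (simp add: antiholo_part_def sum_distrib_left mult_ac)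

lemma harmonic_poly_scale:
  "cnj s = s \<Longrightarrow> harmonic_poly K (s * C) (\<lambda>z. s * P z) (\<lambda>j z. s * H j z) z = s * harmonic_poly K C P H z"
  by (simp add: harmonic_poly_def antiholo_part_scale distrib_left mult_ac)

lemma lat_sum_scale: "lat_sum N K (\<lambda>v. s * \<phi> v) z = s * lat_sum N K \<phi> z"
  unfolding lat_sum_def mult.assoc sum_distrib_left[symmetric] by (rule infsum_cmult_right')

context lattice_weight
begin

lemma lat_sum_growth: "\<exists>A. \<forall>z. Im z \<ge> 1 \<longrightarrow> norm (lat_sum N K \<phi> z) \<le> A * exp (2 * Im z)"
proof -
  let ?D = "norm limit_const + 2 * (\<Sum>n. norm (holo_coeff n * unity_exp (of_nat n * \<i> / of_nat N)))"
  let ?a = "\<lambda>j m. 2 * (2 * of_real pi * \<i> * of_nat m / of_nat N) ^ j * anti_coeff m"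
  let ?E = "\<lambda>j. \<Sum>n. norm (?a j n * unity_exp (of_nat n * \<i> / of_nat N))"
  have "\<exists>A. \<forall>z. Im z \<ge> 1 \<longrightarrow> norm (harmonic_poly K const_coeff holo_fun anti_fun z) \<le> A * exp (2 * Im z)"
  proof (rule harmonic_poly_growth)
    fix z assume z: "Im z \<ge> 1"
    have "norm (holo_fun z) \<le> norm limit_const + 2 * norm (nome_series N holo_coeff z)"
      unfolding holo_fun_def by (rule order_trans[OF norm_triangle_ineq]) (simp add: norm_mult)
    then show "norm (holo_fun z) \<le> ?D" using norm_nome_series_le[OF poly_bounded_holo_coeff N z] by linarith
    show "norm (anti_fun j z) \<le> ?E j" for j
      unfolding anti_fun_def by (rule norm_nome_series_le[OF poly_bounded_anti_fun N z])
  qed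
  then obtain A where A: "\<And>z. Im z \<ge> 1 \<Longrightarrow> norm (harmonic_poly K const_coeff holo_fun anti_fun z) \<le> A * exp (2 * Im z)"
    by blast
  have "norm (lat_sum N K \<phi> z) \<le> A * exp (2 * Im z)" if "Im z \<ge> 1" for z
  proof -
    have "Im z > 0" using that by simp
    then show ?thesis using A[OF that] by (simp only: lat_sum_eq_harmonic_poly)
  qed
  then show ?thesis by blast
qed

text \<open>The value of \<open>xi\<close> in closed form, so that holomorphy and the expansion in
  q^(1/N) can be read off directly.\<close>

definition shadow :: "complex \<Rightarrow> complex" where
  "shadow z = of_nat (Suc K) * cnj const_coeff + 2 * \<i> * (- 2 * \<i>) ^ K / fact K * anti_fun (Suc K) z"

definition holo_fun' :: "complex \<Rightarrow> complex" where
  "holo_fun' z = 2 * nome_series N (\<lambda>n. 2 * of_real pi * \<i> / of_nat N * of_nat n * holo_coeff n) z"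

lemma holo_fun'_deriv: "z \<in> upper_half_plane \<Longrightarrow> (holo_fun has_field_derivative holo_fun' z) (at z)"
  unfolding holo_fun'_def by (rule holo_fun_deriv)

lemma holo_fun'_holomorphic: "holo_fun' holomorphic_on upper_half_plane"
  unfolding holo_fun'_def[abs_def] by (rule holo_fun_deriv_holomorphic)

lemma xi_lat_sum_poly:
  assumes "z \<in> upper_half_plane"
  shows "xi (- int K) (harmonic_poly K const_coeff holo_fun anti_fun) z = shadow z"
  unfolding shadow_def
  by (rule xi_harmonic_poly[where P = holo_fun and P' = holo_fun' and H = anti_fun, OF holo_fun'_deriv holo_fun'_holomorphic anti_fun_deriv assms])

lemma lat_sum_has_wirtinger:
  assumes "z \<in> upper_half_plane"
  obtains A B where "has_wirtinger (lat_sum N K \<phi>) A B z"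
    "shadow z = 2 * \<i> * of_real (Im z) powi (- int K) * cnj B"
proof -
  from has_wirtinger_harmonic_poly[where P = holo_fun and P' = holo_fun' and H = anti_fun, OF holo_fun'_deriv holo_fun'_holomorphic anti_fun_deriv assms]
  obtain A B where AB: "has_wirtinger (harmonic_poly K const_coeff holo_fun anti_fun) A B z" by blast
  have "has_wirtinger (lat_sum N K \<phi>) A B z"
    by (rule has_wirtinger_transform[OF AB open_upper_half_plane assms])
       (simp add: lat_sum_eq_harmonic_poly upper_half_plane_def)
  moreover have "shadow z = 2 * \<i> * of_real (Im z) powi (- int K) * cnj B"
    unfolding xi_lat_sum_poly[OF assms, symmetric] xi_def has_wirtinger_partial(3)[OF AB] ..
  ultimately show ?thesis by (rule that)
qed

lemma shadow_has_sum:
  assumes "Im z > 0"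
  shows "\<exists>u. \<forall>z\<in>upper_half_plane. ((\<lambda>n. u n * unity_exp (of_nat n * z / of_nat N)) has_sum shadow z) UNIV"
proof (intro exI ballI)
  fix z assume "z \<in> upper_half_plane"
  then have z: "Im z > 0" by (simp add: upper_half_plane_def)
  let ?c = "2 * \<i> * (- 2 * \<i>) ^ K / fact K :: complex"
  let ?a = "\<lambda>m. 2 * (2 * of_real pi * \<i> * of_nat m / of_nat N) ^ Suc K * anti_coeff m"
  let ?u = "\<lambda>m. (if m = 0 then of_nat (Suc K) * cnj const_coeff else 0) + ?c * ?a m"
  have "((\<lambda>m. ?c * (?a m * unity_exp (of_nat m * z / of_nat N))) has_sum ?c * anti_fun (Suc K) z) UNIV"
    unfolding anti_fun_def by (intro has_sum_cmult_right nome_series_has_sum poly_bounded_anti_fun N z)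
  moreover have "((\<lambda>m. if m = 0 then of_nat (Suc K) * cnj const_coeff else 0) has_sum of_nat (Suc K) * cnj const_coeff) UNIV"
    by (rule has_sum_finite_neutralI[of "{0}"]) auto
  ultimately have "((\<lambda>m. (if m = 0 then of_nat (Suc K) * cnj const_coeff else 0) + ?c * (?a m * unity_exp (of_nat m * z / of_nat N)))
      has_sum shadow z) UNIV"
    unfolding shadow_def by (rule has_sum_add[rotated])
  moreover have "(if m = 0 then of_nat (Suc K) * cnj const_coeff else 0) + ?c * (?a m * unity_exp (of_nat m * z / of_nat N)) =
     ?u m * unity_exp (of_nat m * z / of_nat N)" for m
    by (cases "m = 0") (simp_all add: unity_exp_def)
  ultimately show "((\<lambda>m. ?u m * unity_exp (of_nat m * z / of_nat N)) has_sum shadow z) UNIV" by (simp only:)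
qed

end

text \<open>Differentiate the law for \<open>lat_sum\<close> by the conjugate of z. The holomorphic
  factor j^K passes through and the chain rule adds the conjugate of 1 / j^2. After conjugation, the
  powers of the conjugate of j cancel against Im z' = Im z / |j|^2, which leaves j^(K+2).\<close>

theorem (in lattice_weight) shadow_moebius:
  assumes det: "a * d - b * c = 1" and z: "z \<in> upper_half_plane"
  defines "j \<equiv> of_int c * z + of_int d" and "z' \<equiv> (of_int a * z + of_int b) / (of_int c * z + of_int d)"
  shows "shadow z' = j ^ (K + 2) * lattice_weight.shadow N K (\<lambda>v. \<phi> (lat_act d (- b) (- c) a v)) z"
proof -
  have det': "d * a - (- b) * (- c) = 1" using det by (simp add: algebra_simps)
  interpret W: lattice_weight N K "\<lambda>v. \<phi> (lat_act d (- b) (- c) a v)"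
    by (rule lattice_weight_act[OF det'])
  have Imz: "Im z > 0" using z by (simp add: upper_half_plane_def)
  have j: "j \<noteq> 0" unfolding j_def by (rule moebius_denominator_nonzero[OF det Imz])
  have Imz': "Im z' = Im z / norm j ^ 2" unfolding z'_def j_def by (rule Im_moebius[OF det Imz])
  then have z': "z' \<in> upper_half_plane" using Imz j by (simp add: upper_half_plane_def)
  obtain A B where AB: "has_wirtinger (lat_sum N K \<phi>) A B z'"
    "shadow z' = 2 * \<i> * of_real (Im z') powi (- int K) * cnj B" by (rule lat_sum_has_wirtinger[OF z'])
  obtain A' B' where AB': "has_wirtinger (lat_sum N K (\<lambda>v. \<phi> (lat_act d (- b) (- c) a v))) A' B' z"
    "W.shadow z = 2 * \<i> * of_real (Im z) powi (- int K) * cnj B'" by (rule W.lat_sum_has_wirtinger[OF z])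
  let ?g = "\<lambda>z. (of_int a * z + of_int b) / (of_int c * z + of_int d)"
  have dg: "(?g has_field_derivative 1 / j^2) (at z)"
  proof -
    have "(?g has_field_derivative (of_int a * j - (of_int a * z + of_int b) * of_int c) / j^2) (at z)"
      unfolding j_def by (rule derivative_eq_intros refl | use j in \<open>simp add: j_def power2_eq_square\<close>)+
    moreover have "of_int a * j - (of_int a * z + of_int b) * of_int c = of_int (a * d - b * c)"
      by (simp add: j_def algebra_simps)
    ultimately show ?thesis by (simp add: det)
  qed
  have "has_wirtinger (\<lambda>z. lat_sum N K \<phi> (?g z)) (A * (1 / j^2)) (B * cnj (1 / j^2)) z"
    using AB(1) dg unfolding z'_def by (rule has_wirtinger_compose)
  moreover have "\<exists>D. ((\<lambda>z. (of_int c * z + of_int d) ^ K) has_field_derivative D) (at z)"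
    by (rule exI, (rule derivative_eq_intros refl)+)
  then obtain D where "((\<lambda>z. (of_int c * z + of_int d) ^ K) has_field_derivative D) (at z)" by blast
  ultimately have "has_wirtinger (\<lambda>z. (of_int c * z + of_int d) ^ K * lat_sum N K \<phi> (?g z))
     (j ^ K * (A * (1 / j^2)) + D * lat_sum N K \<phi> (?g z)) (j ^ K * (B * cnj (1 / j^2)) + 0 * lat_sum N K \<phi> (?g z)) z"
    unfolding j_def by (intro has_wirtinger_mult has_wirtinger_holomorphic)
  then have "has_wirtinger (lat_sum N K (\<lambda>v. \<phi> (lat_act d (- b) (- c) a v)))
     (j ^ K * (A * (1 / j^2)) + D * lat_sum N K \<phi> (?g z)) (j ^ K * (B * cnj (1 / j^2)) + 0 * lat_sum N K \<phi> (?g z)) z"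
    by (rule has_wirtinger_transform[OF _ open_upper_half_plane z])
       (simp add: lat_sum_moebius[OF det] upper_half_plane_def)
  from has_wirtinger_unique(2)[OF AB'(1) this]
  have B': "cnj B' = cnj j ^ K * cnj B / j^2" by simp
  have "of_real (Im z') powi (- int K) = (of_real (Im z) powi (- int K) * (j * cnj j) ^ K :: complex)"
  proof -
    have n: "of_real (norm j ^ 2) = j * cnj j" by (rule complex_norm_square)
    have "of_real (Im z') = (of_real (Im z) / (j * cnj j) :: complex)"
      unfolding Imz' by (simp only: n[symmetric] of_real_divide)
    then show ?thesis by (simp add: power_int_minus power_divide field_simps)
  qed
  then show ?thesis unfolding AB(2) AB'(2) B' using j
    by (simp add: power_mult_distrib power_add power2_eq_square field_simps)
qed

section \<open>The incomplete gamma integral\<close>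

text \<open>Differentiating a partial sum of the exponential series drops its top term, so after the
  product rule only that term is left.\<close>

lemma incomplete_gamma_deriv:
  fixes a u :: real
  shows "((\<lambda>u. exp (- (a * u)) * (\<Sum>j\<le>K. (a * u) ^ j / fact j)) has_real_derivative
     - a * exp (- (a * u)) * ((a * u) ^ K / fact K)) (at u within S)"
proof (induction K)
  case 0
  show ?case by (auto intro!: derivative_eq_intros)
next
  case (Suc K)
  have "((\<lambda>u. exp (- (a * u)) * ((a * u) ^ Suc K / fact (Suc K))) has_real_derivative
     - a * exp (- (a * u)) * ((a * u) ^ Suc K / fact (Suc K)) + exp (- (a * u)) * (a * ((a * u) ^ K / fact K))) (at u within S)"
  proof -
    have "((\<lambda>u. exp (- (a * u)) * ((a * u) ^ Suc K / fact (Suc K))) has_real_derivative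
     - a * exp (- (a * u)) * ((a * u) ^ Suc K / fact (Suc K)) + exp (- (a * u)) * (real (Suc K) * (a * u) ^ K * a / fact (Suc K))) (at u within S)"
      by (rule derivative_eq_intros refl | simp)+ (simp add: mult_ac)
    moreover have "real (Suc K) * X * a / fact (Suc K) = a * (X / fact K)" for X
      by (simp add: divide_simps del: of_nat_Suc)
    ultimately show ?thesis by (simp add: mult_ac)
  qed
  from DERIV_add[OF Suc.IH this] show ?case by (simp add: distrib_left algebra_simps)
qed

lemma integral_exp_power_to_infinity:
  fixes a y :: real
  assumes "a > 0" "y > 0"
  shows "integral {y..} (\<lambda>u. exp (- a * u) * u ^ K) = fact K / a ^ Suc K * (exp (- (a * y)) * (\<Sum>j\<le>K. (a * y) ^ j / fact j))"
proof -
  let ?S = "\<lambda>u. exp (- (a * u)) * (\<Sum>j\<le>K. (a * u) ^ j / fact j)"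
  let ?c = "fact K / a ^ Suc K"
  have d: "((\<lambda>u. - ?c * ?S u) has_real_derivative exp (- a * u) * u ^ K) (at u within S)" for u S
  proof -
    have "((\<lambda>u. - ?c * ?S u) has_real_derivative - ?c * (- a * exp (- (a * u)) * ((a * u) ^ K / fact K))) (at u within S)"
      by (rule DERIV_cmult[OF incomplete_gamma_deriv])
    moreover have "- ?c * (- a * exp (- (a * u)) * ((a * u) ^ K / fact K)) = exp (- a * u) * u ^ K"
      using assms(1) by (simp add: power_mult_distrib field_simps)
    ultimately show ?thesis by simp
  qed
  have FTC: "((\<lambda>u. exp (- a * u) * u ^ K) has_integral (- ?c * ?S T - - ?c * ?S y)) {y..T}" if "y \<le> T" for T
    using that d by (intro fundamental_theorem_of_calculus) (auto simp: has_real_derivative_iff_has_vector_derivative)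
  have "((\<lambda>T. ?S T) \<longlongrightarrow> 0) at_top"
  proof -
    have lim: "((\<lambda>T. (a * T) ^ j / exp (a * T)) \<longlongrightarrow> 0) at_top" for j
      by (rule filterlim_compose[OF tendsto_power_div_exp_0])
         (use assms(1) in \<open>auto intro!: filterlim_tendsto_pos_mult_at_top filterlim_ident tendsto_const\<close>)
    have "((\<lambda>T. \<Sum>j\<le>K. (1 / fact j) * ((a * T) ^ j / exp (a * T))) \<longlongrightarrow> (\<Sum>j\<le>K. (1 / fact j) * 0)) at_top"
      by (intro tendsto_sum tendsto_mult tendsto_const lim)
    then show ?thesis by (simp add: exp_minus sum_distrib_left field_simps)
  qed
  then have lim: "((\<lambda>T. - ?c * ?S T - - ?c * ?S y) \<longlongrightarrow> - ?c * 0 - - ?c * ?S y) at_top"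
    by (intro tendsto_intros)
  have "((\<lambda>u. exp (- a * u) * u ^ K) has_integral (- ?c * 0 - - ?c * ?S y)) {y..}"
  proof (rule has_integral_to_inf)
    show "(\<lambda>u. exp (- a * u) * u ^ K) integrable_on {y..T}" for T
      using FTC[of T] by (cases "y \<le> T") auto
    show "((\<lambda>T. integral {y..T} (\<lambda>u. exp (- a * u) * u ^ K)) \<longlongrightarrow> - ?c * 0 - - ?c * ?S y) at_top"
    proof (rule Lim_transform_eventually[OF lim])
      show "eventually (\<lambda>T. - ?c * ?S T - - ?c * ?S y = integral {y..T} (\<lambda>u. exp (- a * u) * u ^ K)) at_top"
        using eventually_ge_at_top[of y] by eventually_elim (rule integral_unique[OF FTC, symmetric])
    qed
  qed (use assms in auto)
  then show ?thesis by (simp add: integral_unique)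
qed

text \<open>The integral carries exp (- 4 pi n y) = |q^n|^2, and |q^n|^2 q^(-n) is the conjugate of
  q^n. What remains is the partial exponential sum found in \<open>line_sum\<close>.\<close>

lemma beta_mult_q_power:
  assumes "n > 0" "Im z > 0"
  shows "of_real (beta (- int K) n (Im z)) * q_power (- int n) z =
    of_real (fact K / (4 * pi * real n) ^ Suc K * (\<Sum>j\<le>K. (4 * pi * real n * Im z) ^ j / fact j)) * cnj (unity_exp (of_nat n * z))"
proof -
  have "beta (- int K) n (Im z) = integral {Im z..} (\<lambda>u. exp (- (4 * pi * real n) * u) * u ^ K)"
    using assms(1) by (simp add: beta_def)
  also have "\<dots> = fact K / (4 * pi * real n) ^ Suc K *
      (exp (- (4 * pi * real n * Im z)) * (\<Sum>j\<le>K. (4 * pi * real n * Im z) ^ j / fact j))"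
    using assms by (intro integral_exp_power_to_infinity) auto
  finally have b: "beta (- int K) n (Im z) = fact K / (4 * pi * real n) ^ Suc K *
      (\<Sum>j\<le>K. (4 * pi * real n * Im z) ^ j / fact j) * exp (- (4 * pi * real n * Im z))" by simp
  have "of_real (exp (- (4 * pi * real n * Im z))) * q_power (- int n) z = cnj (unity_exp (of_nat n * z))"
  proof -
    have "of_real (exp (- (4 * pi * real n * Im z))) * q_power (- int n) z =
       exp (of_real (- (4 * pi * real n * Im z)) + 2 * of_real pi * \<i> * of_int (- int n) * z)"
      by (simp only: q_power_def exp_add exp_of_real)
    also have "of_real (- (4 * pi * real n * Im z)) + 2 * of_real pi * \<i> * of_int (- int n) * z =
       cnj (2 * of_real pi * \<i> * (of_nat n * z))"
      by (simp add: complex_eq_iff)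
    finally show ?thesis by (simp only: unity_exp_def exp_cnj)
  qed
  then show ?thesis unfolding b of_real_mult by (simp only: mult.assoc)
qed

lemma has_sum_multiples:
  fixes f :: "nat \<Rightarrow> complex"
  assumes "((\<lambda>m. f (t * m)) has_sum S) UNIV" "t > 0" "\<And>n. \<not> t dvd n \<Longrightarrow> f n = 0"
  shows "(f has_sum S) UNIV"
proof -
  have "(f has_sum S) (range (\<lambda>m. t * m))"
    using assms by (subst has_sum_reindex) (auto simp: inj_on_def o_def)
  also have "?this \<longleftrightarrow> (f has_sum S) UNIV"
    by (rule has_sum_cong_neutral) (auto simp: assms(3) image_iff dvd_def)
  finally show ?thesis .
qed

section \<open>Values of Dirichlet L-functions\<close>

text \<open>A rival continuation g lives on another half-plane and may have poles. On the smaller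
  half-plane, g - f with its removable singularities filled in vanishes far to the right, hence
  everywhere by the identity theorem.\<close>

lemma dirichlet_L_eqI:
  assumes hol: "f holomorphic_on {w. Re w > b}" and b: "b < Re s"
    and eq: "\<And>w. Re w > max b 1 \<Longrightarrow> f w = dirichlet_series \<eta> w"
  shows "dirichlet_L s \<eta> = f s"
  unfolding dirichlet_L_def
proof (rule the_equality)
  have "f nicely_meromorphic_on {w. Re w > b}"
    using hol by (intro analytic_on_imp_nicely_meromorphic_on) (simp add: analytic_on_open open_halfspace_Re_gt)
  then show "\<exists>b<Re s. \<exists>g. g nicely_meromorphic_on {w. b < Re w} \<and> (\<forall>w. max b 1 < Re w \<longrightarrow> g w = dirichlet_series \<eta> w) \<and> f s = g s"
    using b eq by blast
next
  fix v
  assume "\<exists>b<Re s. \<exists>g. g nicely_meromorphic_on {w. b < Re w} \<and> (\<forall>w. max b 1 < Re w \<longrightarrow> g w = dirichlet_series \<eta> w) \<and> v = g s"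
  then obtain b' g where b': "b' < Re s" and g: "g nicely_meromorphic_on {w. b' < Re w}"
    and geq: "\<And>w. max b' 1 < Re w \<Longrightarrow> g w = dirichlet_series \<eta> w" and v: "v = g s" by blast
  define B where "B = max b b'"
  define A where "A = {w. Re w > B}"
  have A: "open A" "connected A" "s \<in> A"
    using b b' by (simp_all only: A_def open_halfspace_Re_gt convex_connected convex_halfspace_Re_gt) (simp add: B_def)
  have fan: "f analytic_on A"
    using hol A(1) by (subst analytic_on_open) (auto simp: A_def B_def intro: holomorphic_on_subset)
  have gn: "g nicely_meromorphic_on A"
    using g by (rule nicely_meromorphic_on_subset) (auto simp: A_def B_def)
  have dm: "(\<lambda>w. g w - f w) meromorphic_on A"
    using gn by (intro meromorphic_on_diff[OF _ analytic_on_imp_meromorphic_on[OF fan]]) (simp add: nicely_meromorphic_on_def)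
  define R where "R = remove_sings (\<lambda>w. g w - f w)"
  have R: "R nicely_meromorphic_on A" unfolding R_def by (rule remove_sings_nicely_meromorphic[OF dm])
  define p where "p = complex_of_real (max B 1 + 1)"
  define U where "U = {w. Re w > max B 1}"
  have "open U" by (simp only: U_def open_halfspace_Re_gt)
  then have U: "open U" "p \<in> U" "U \<subseteq> A" by (auto simp: U_def p_def A_def)
  have R0: "R w = 0" if "w \<in> U" for w
    unfolding R_def
  proof (rule remove_sings_eqI)
    have "eventually (\<lambda>x. 0 = g x - f x) (at w)"
      using eventually_at_in_open'[OF U(1) that]
      by eventually_elim (use eq geq in \<open>auto simp: U_def B_def\<close>)
    then show "(\<lambda>w. g w - f w) \<midarrow>w\<rightarrow> 0" by (rule Lim_transform_eventually[OF tendsto_const])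
  qed
  have "eventually (\<lambda>w. R w = 0) (at p)"
    using eventually_at_in_open'[OF U(1,2)] by eventually_elim (rule R0)
  then have "frequently (\<lambda>w. R w = 0) (at p)" by (rule eventually_frequently[rotated]) simp
  then have Rs: "R w = 0" if "w \<in> A" for w
    using R A(1,2) U that by (intro frequently_eq_meromorphic_imp_constant[of R 0 p A]) auto
  have "isolated_singularity_at (\<lambda>w. g w - f w) s"
    using meromorphic_on_isolated_singularity[OF meromorphic_on_subset[OF dm]] A(3) by auto
  then have "eventually (\<lambda>w. R w = g w - f w) (at s)"
    unfolding R_def by (rule eventually_remove_sings_eq_at)
  then have "eventually (\<lambda>w. f w = g w) (at s)"
    using eventually_at_in_open'[OF A(1,3)] by eventually_elim (use Rs in auto)
  moreover have "f \<midarrow>s\<rightarrow> f s"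
    using fan A(3) by (metis analytic_at_imp_isCont analytic_on_analytic_at isContD)
  ultimately have glim: "g \<midarrow>s\<rightarrow> f s" by (rule Lim_transform_eventually[rotated])
  \<comment> \<open>A nicely meromorphic function has value 0 at a pole and is continuous elsewhere.
    The finite limit of g at s excludes the first case, so its value there is f s.\<close>
  have "is_pole g s \<and> g s = 0 \<or> g \<midarrow>s\<rightarrow> g s" using gn A(3) by (auto simp: nicely_meromorphic_on_def)
  moreover have "\<not> is_pole g s" using glim by (meson at_neq_bot is_pole_def not_tendsto_and_filterlim_at_infinity)
  ultimately have "g \<midarrow>s\<rightarrow> g s" by blast
  then show "v = f s" using glim v LIM_unique by blast
qed

section \<open>Convergence and continuation of Dirichlet series\<close>

lemma holomorphic_on_suminf:
  fixes u :: "nat \<Rightarrow> complex \<Rightarrow> complex"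
  assumes "open S" "\<And>n. u n holomorphic_on S" "summable h" "\<And>n w. w \<in> S \<Longrightarrow> norm (u n w) \<le> h n"
  shows "(\<lambda>w. \<Sum>n. u n w) holomorphic_on S"
proof -
  have "\<exists>g g'. \<forall>x\<in>S. (\<lambda>n. u n x) sums g x \<and> (\<lambda>n. deriv (u n) x) sums g' x \<and> (g has_field_derivative g' x) (at x)"
  proof -
    have d: "(u n has_field_derivative deriv (u n) x) (at x)" if "x \<in> S" for n x
      by (rule holomorphic_derivI[OF assms(2,1) that])
    have e: "\<forall>\<^sub>F n in sequentially. \<forall>x\<in>S. norm (u n x) \<le> h n" using assms(4) by simp
    show ?thesis using series_and_derivative_comparison[OF assms(1,3) d e] by metis
  qed
  then obtain g g' where g: "\<And>x. x \<in> S \<Longrightarrow> (\<lambda>n. u n x) sums g x" "\<And>x. x \<in> S \<Longrightarrow> (g has_field_derivative g' x) (at x)"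
    by blast
  have "g holomorphic_on S" using g(2) assms(1) by (auto simp: holomorphic_on_open)
  then show ?thesis by (rule holomorphic_transform) (use g(1) in \<open>simp add: sums_iff\<close>)
qed

lemma norm_nat_powr:
  "norm (of_nat (Suc n) powr (- w) :: complex) = real (Suc n) powr (- Re w)"
  using norm_powr_real_powr[of "of_nat (Suc n)" "- w"] by simp

lemma summable_powr_shift: "\<delta> > 1 \<Longrightarrow> summable (\<lambda>n. real (Suc n) powr (- \<delta>))"
  using summable_Suc_iff[of "\<lambda>n. real n powr (- \<delta>)"] by (simp add: summable_real_powr_iff)

lemma norm_dirichlet_character_le: "dirichlet_character N \<eta> \<Longrightarrow> norm (\<eta> a) \<le> 1"
  by (simp add: norm_dirichlet_character)

lemma dirichlet_series_summable:
  assumes "dirichlet_character N \<eta>" "Re w > 1"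
  shows "summable (\<lambda>n. norm (\<eta> (int (Suc n)) * of_nat (Suc n) powr (- w)))"
proof (rule summable_comparison_test[OF _ summable_powr_shift[OF assms(2)]], intro exI[of _ 0] allI impI)
  fix n
  show "norm (norm (\<eta> (int (Suc n)) * of_nat (Suc n) powr (- w))) \<le> real (Suc n) powr (- Re w)"
    using mult_right_mono[OF norm_dirichlet_character_le[OF assms(1)], of "real (Suc n) powr (- Re w)" "int (Suc n)"]
    by (simp only: norm_mult norm_nat_powr) simp
qed

lemma holomorphic_onI_local:
  assumes "\<And>x. x \<in> S \<Longrightarrow> \<exists>U. open U \<and> x \<in> U \<and> f holomorphic_on U"
  shows "f holomorphic_on S"
  unfolding holomorphic_on_def
proof
  fix x assume "x \<in> S"
  then obtain U where "open U" "x \<in> U" "f holomorphic_on U" using assms by blast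
  then have "f field_differentiable at x" by (simp add: holomorphic_on_open field_differentiable_def)
  then show "f field_differentiable at x within S" by (rule field_differentiable_at_within)
qed

lemma holomorphic_nat_powr: "(\<lambda>w. of_nat (Suc n) powr (- w) :: complex) holomorphic_on S"
  by (intro holomorphic_intros) (simp_all del: of_nat_Suc)

lemma dirichlet_L_eq_series:
  assumes "dirichlet_character N \<eta>" "Re s > 1"
  shows "dirichlet_L s \<eta> = dirichlet_series \<eta> s"
proof (rule dirichlet_L_eqI[of _ 1])
  show "dirichlet_series \<eta> holomorphic_on {w. 1 < Re w}"
  proof (rule holomorphic_onI_local)
    fix x assume x: "x \<in> {w. 1 < Re w}"
    define \<delta> where "\<delta> = (1 + Re x) / 2"
    have \<delta>: "1 < \<delta>" "\<delta> < Re x" using x by (auto simp: \<delta>_def)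
    have "dirichlet_series \<eta> holomorphic_on {w. \<delta> < Re w}"
      unfolding dirichlet_series_def[abs_def]
    proof (rule holomorphic_on_suminf[OF open_halfspace_Re_gt _ summable_powr_shift[OF \<delta>(1)]])
      show "(\<lambda>w. \<eta> (int (Suc n)) * of_nat (Suc n) powr (- w)) holomorphic_on {w. \<delta> < Re w}" for n
        by (intro holomorphic_on_mult holomorphic_on_const holomorphic_nat_powr)
      fix n and w :: complex assume w: "w \<in> {w. \<delta> < Re w}"
      have "norm (\<eta> (int (Suc n)) * of_nat (Suc n) powr (- w)) \<le> 1 * real (Suc n) powr (- Re w)"
        unfolding norm_mult norm_nat_powr
        using norm_dirichlet_character_le[OF assms(1)] by (intro mult_right_mono) auto
      also have "\<dots> \<le> real (Suc n) powr (- \<delta>)" using w by (simp add: powr_mono del: of_nat_Suc)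
      finally show "norm (\<eta> (int (Suc n)) * of_nat (Suc n) powr (- w)) \<le> real (Suc n) powr (- \<delta>)" .
    qed
    then show "\<exists>U. open U \<and> x \<in> U \<and> dirichlet_series \<eta> holomorphic_on U"
      using \<delta>(2) open_halfspace_Re_gt[of \<delta>] by blast
  qed
qed (use assms in auto)

text \<open>Mean value inequality on the real segment; the difference gains one power of decay over
  a single term.\<close>

lemma norm_powr_diff_le:
  assumes "0 < x" "x \<le> y" "Re w > 0"
  shows "norm (of_real y powr (- w) - of_real x powr (- w)) \<le> norm w * x powr (- Re w - 1) * (y - x)"
proof -
  let ?S = "closed_segment (complex_of_real x) (of_real y)"
  have S: "\<exists>t. z = of_real t \<and> x \<le> t" if z: "z \<in> ?S" for z
  proof -
    obtain u where u: "0 \<le> u" "u \<le> 1" "z = (1 - u) *\<^sub>R of_real x + u *\<^sub>R of_real y"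
      using z by (auto simp: closed_segment_def)
    have "z = of_real (x + u * (y - x))" by (simp add: u(3) scaleR_conv_of_real algebra_simps)
    moreover have "x \<le> x + u * (y - x)" using u assms by simp
    ultimately show ?thesis by blast
  qed
  have "norm (of_real y powr (- w) - of_real x powr (- w)) \<le> (norm w * x powr (- Re w - 1)) * norm (of_real y - complex_of_real x)"
  proof (rule field_differentiable_bound[of ?S "\<lambda>z. z powr (- w)" "\<lambda>z. - w * z powr (- w - 1)"])
    fix z assume "z \<in> ?S"
    then obtain t where t: "z = of_real t" "x \<le> t" using S by blast
    have t0: "t > 0" using t assms by simp
    then have "z \<notin> \<real>\<^sub>\<le>\<^sub>0" by (simp add: t complex_nonpos_Reals_iff)
    then show "((\<lambda>z. z powr (- w)) has_field_derivative - w * z powr (- w - 1)) (at z within ?S)"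
      by (rule has_field_derivative_powr[THEN has_field_derivative_at_within])
    have "norm (z powr (- w - 1)) = t powr (- Re w - 1)"
      using t t0 norm_powr_real_powr[of z "- w - 1"] by simp
    also have "\<dots> \<le> x powr (- Re w - 1)" using assms t by (intro powr_mono2') auto
    finally show "norm (- w * z powr (- w - 1)) \<le> norm w * x powr (- Re w - 1)"
      by (simp add: norm_mult mult_left_mono)
  qed auto
  also have "norm (of_real y - complex_of_real x) = y - x"
    using assms by (simp flip: of_real_diff)
  finally show ?thesis .
qed

lemma sum_dirichlet_character_window:
  assumes "dirichlet_character L \<eta>"
  shows "(\<Sum>i\<in>{m * L..<m * L + L}. \<eta> (int (Suc i))) = (\<Sum>a\<in>{0..<int L}. \<eta> a)"
proof (rule sum.reindex_bij_witness[of _ "\<lambda>a. m * L + nat ((a - 1) mod int L)" "\<lambda>i. int (Suc i) mod int L"])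
  have L: "L > 0" using assms by (rule dirichlet_character_pos)
  fix i assume i: "i \<in> {m * L..<m * L + L}"
  then obtain j where j: "i = m * L + j" "j < L" by (metis add_less_cancel_left atLeastLessThan_iff le_Suc_ex)
  have "(int (Suc i) mod int L - 1) mod int L = int i mod int L" by (simp add: mod_simps)
  then show "m * L + nat ((int (Suc i) mod int L - 1) mod int L) = i" using j by (simp add: nat_mod_distrib)
  show "int (Suc i) mod int L \<in> {0..<int L}" using L by simp
  show "\<eta> (int (Suc i) mod int L) = \<eta> (int (Suc i))" by (rule dirichlet_character_mod[OF assms])
next
  have L: "L > 0" using assms by (rule dirichlet_character_pos)
  fix a assume a: "a \<in> {0..<int L}"
  have "int (Suc (m * L + nat ((a - 1) mod int L))) = (a - 1) mod int L + 1 + int m * int L" using L by simp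
  then have "int (Suc (m * L + nat ((a - 1) mod int L))) mod int L = a mod int L"
    by (simp only:) (simp add: mod_simps)
  then show "int (Suc (m * L + nat ((a - 1) mod int L))) mod int L = a" using a by simp
  have "nat ((a - 1) mod int L) < L" using L by (simp add: nat_less_iff)
  then show "m * L + nat ((a - 1) mod int L) \<in> {m * L..<m * L + L}" by simp
qed

lemma sum_nontrivial_character:
  assumes "dirichlet_character L \<eta>" "\<eta> \<noteq> trivial_char L"
  shows "(\<Sum>a\<in>{0..<int L}. \<eta> a) = 0"
proof -
  obtain b where b: "\<eta> b \<noteq> trivial_char L b" using assms(2) by blast
  have cop: "coprime b (int L)"
    using b dirichlet_character_eq_0_iff[OF assms(1), of b] by (auto simp: trivial_char_def)
  then have "\<eta> b \<noteq> 1" using b by (simp add: trivial_char_def)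
  have "(\<Sum>a\<in>{0..<int L}. \<eta> a) = (\<Sum>a\<in>{0..<int L}. \<eta> (b * a))"
    using cop dirichlet_character_pos[OF assms(1)]
    by (intro sum_mult_residues[symmetric]) (auto simp: dirichlet_character_mod[OF assms(1)])
  also have "\<dots> = \<eta> b * (\<Sum>a\<in>{0..<int L}. \<eta> a)"
    by (simp add: dirichlet_character_mult[OF assms(1)] sum_distrib_left)
  finally show ?thesis using \<open>\<eta> b \<noteq> 1\<close> by simp
qed

lemma sum_trivial_character:
  assumes "L > 0"
  shows "(\<Sum>a\<in>{0..<int L}. trivial_char L a) = of_nat (totient L)"
proof -
  have "(\<Sum>a\<in>{0..<int L}. trivial_char L a) = (\<Sum>i\<in>{0..<L}. trivial_char L (int (Suc i)))"
    using sum_dirichlet_character_window[OF dirichlet_character_trivial[OF assms], of 0] by simp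
  also have "\<dots> = (\<Sum>i\<in>{1..L}. trivial_char L (int i))"
    by (rule sum.reindex_bij_witness[of _ "\<lambda>i. i - 1" Suc]) auto
  also have "\<dots> = (\<Sum>i\<in>totatives L. 1)"
    by (rule sum.mono_neutral_cong_right) (auto simp: trivial_char_def totatives_def)
  finally show ?thesis by (simp add: totient_def)
qed

text \<open>Grouping by periods of a nontrivial character gives convergence for Re w > 0. This
  supplies the value at 1, which enters the constant term for k = 2.\<close>

definition block_L_series :: "nat \<Rightarrow> (int \<Rightarrow> complex) \<Rightarrow> complex \<Rightarrow> complex" where
  "block_L_series L \<eta> w = (\<Sum>m. \<Sum>i\<in>{m * L..<m * L + L}. \<eta> (int (Suc i)) * of_nat (Suc i) powr (- w))"

lemma block_L_series_bound:
  assumes "dirichlet_character L \<eta>" "\<eta> \<noteq> trivial_char L" "Re w > \<delta>" "\<delta> > 0" "norm w \<le> R"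
  shows "norm (\<Sum>i\<in>{m * L..<m * L + L}. \<eta> (int (Suc i)) * of_nat (Suc i) powr (- w)) \<le>
    real L * (1 + R * real L) * (real (Suc m) powr (- \<delta> - 1) * 2 powr (\<delta> + 1))"
proof -
  let ?I = "{m * L..<m * L + L}"
  have L: "L > 0" using assms(1) by (rule dirichlet_character_pos)
  have R: "R \<ge> 0" using assms(5) norm_ge_zero order_trans by blast
  have q: "real (Suc m) powr (- \<delta> - 1) * 2 powr (\<delta> + 1) = (real (Suc m) / 2) powr (- \<delta> - 1)"
    by (simp add: powr_divide powr_minus field_simps del: of_nat_Suc) (simp add: powr_add[symmetric])
  show ?thesis
  proof (cases "m = 0")
    case True
    have "norm (\<Sum>i\<in>?I. \<eta> (int (Suc i)) * of_nat (Suc i) powr (- w)) \<le> (\<Sum>i\<in>?I. 1)"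
    proof (rule sum_norm_le)
      fix i
      have "real (Suc i) powr (- Re w) \<le> real (Suc i) powr 0"
        using assms(3,4) by (intro powr_mono) auto
      then show "norm (\<eta> (int (Suc i)) * of_nat (Suc i) powr (- w)) \<le> 1"
        using norm_dirichlet_character_le[OF assms(1), of "int (Suc i)"] mult_mono[of "norm (\<eta> (int (Suc i)))" 1 "real (Suc i) powr (- Re w)" 1]
        by (simp add: norm_mult norm_nat_powr del: of_nat_Suc)
    qed
    also have "\<dots> = real L * 1 * 1" by simp
    also have "\<dots> \<le> real L * (1 + R * real L) * (1 / 2) powr (- \<delta> - 1)"
    proof (intro mult_mono mult_left_mono)
      have "1 = (1 / 2 :: real) powr 0" by simp
      also have "\<dots> \<le> (1 / 2) powr (- \<delta> - 1)" using assms(4) by (intro powr_mono') auto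
      finally show "1 \<le> (1 / 2 :: real) powr (- \<delta> - 1)" .
    qed (use R in auto)
    finally show ?thesis unfolding q by (simp add: True)
  next
    case False
    define x where "x = real (Suc (m * L))"
    have "m \<le> m * L" using L by simp
    then have mL: "real m \<le> real (m * L)" by (simp only: of_nat_le_iff)
    have "(1 + r) / 2 \<le> 1 + p" if "r \<le> p" "0 \<le> r" for r p :: real using that by simp
    from this[OF mL] have x: "real (Suc m) / 2 \<le> x" by (simp only: x_def of_nat_Suc of_nat_0_le_iff)
    have x1: "1 \<le> x" by (simp add: x_def)
    note x = x x1
    \<comment> \<open>A nontrivial character sums to 0 over a period, so the power at the first
      point x of the block may be subtracted from all terms.\<close>
    have "(\<Sum>i\<in>?I. \<eta> (int (Suc i)) * of_real x powr (- w)) = 0"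
      by (simp add: sum_distrib_right[symmetric] sum_dirichlet_character_window[OF assms(1)] sum_nontrivial_character[OF assms(1,2)] del: of_nat_Suc)
    then have "(\<Sum>i\<in>?I. \<eta> (int (Suc i)) * of_nat (Suc i) powr (- w)) =
       (\<Sum>i\<in>?I. \<eta> (int (Suc i)) * (of_real (real (Suc i)) powr (- w) - of_real x powr (- w)))"
      by (simp add: right_diff_distrib sum_subtractf del: of_nat_Suc)
    also have "norm \<dots> \<le> (\<Sum>i\<in>?I. R * real L * (real (Suc m) / 2) powr (- \<delta> - 1))"
    proof (rule sum_norm_le)
      fix i assume i: "i \<in> ?I"
      have "real (m * L) \<le> real i" "real i \<le> real (m * L + L)" using i by (auto simp only: of_nat_le_iff atLeastLessThan_iff intro: less_imp_le)
      then have xi: "x \<le> real (Suc i)" "real (Suc i) - x \<le> real L" unfolding x_def of_nat_Suc of_nat_add by linarith+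
      have "norm (of_real (real (Suc i)) powr (- w) - of_real x powr (- w)) \<le> norm w * x powr (- Re w - 1) * (real (Suc i) - x)"
        using x xi assms(3,4) by (intro norm_powr_diff_le) auto
      also have "\<dots> \<le> R * (real (Suc m) / 2) powr (- \<delta> - 1) * real L"
      proof (intro mult_mono xi assms(5))
        have "x powr (- Re w - 1) \<le> x powr (- \<delta> - 1)" using x assms(3) by (intro powr_mono) auto
        also have "\<dots> \<le> (real (Suc m) / 2) powr (- \<delta> - 1)" using x assms(4) by (intro powr_mono2') auto
        finally show "x powr (- Re w - 1) \<le> (real (Suc m) / 2) powr (- \<delta> - 1)" .
      qed (use R xi in auto)
      finally show "norm (\<eta> (int (Suc i)) * (of_real (real (Suc i)) powr (- w) - of_real x powr (- w)))
         \<le> R * real L * (real (Suc m) / 2) powr (- \<delta> - 1)"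
        using mult_mono[OF norm_dirichlet_character_le[OF assms(1), of "int (Suc i)"], of "norm (of_real (real (Suc i)) powr (- w) - of_real x powr (- w))"
            "R * (real (Suc m) / 2) powr (- \<delta> - 1) * real L"]
        by (simp add: norm_mult mult_ac del: of_nat_Suc)
    qed
    also have "\<dots> = real L * (R * real L) * (real (Suc m) / 2) powr (- \<delta> - 1)" by simp
    also have "\<dots> \<le> real L * (1 + R * real L) * (real (Suc m) / 2) powr (- \<delta> - 1)"
      by (intro mult_right_mono mult_left_mono) auto
    finally show ?thesis unfolding q .
  qed
qed

lemma summable_block_bound:
  assumes "\<delta> > 0"
  shows "summable (\<lambda>m. C * (real (Suc m) powr (- \<delta> - 1) * 2 powr (\<delta> + 1)))"
  using summable_powr_shift[of "\<delta> + 1"] assms by (intro summable_mult summable_mult2) simp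

lemma block_L_series_sums:
  assumes "dirichlet_character L \<eta>" "\<eta> \<noteq> trivial_char L" "Re w > 0"
  shows "(\<lambda>m. \<Sum>i\<in>{m * L..<m * L + L}. \<eta> (int (Suc i)) * of_nat (Suc i) powr (- w)) sums block_L_series L \<eta> w"
proof -
  have d: "Re w > Re w / 2" "Re w / 2 > 0" using assms(3) by auto
  have "summable (\<lambda>m. \<Sum>i\<in>{m * L..<m * L + L}. \<eta> (int (Suc i)) * of_nat (Suc i) powr (- w))"
    by (rule summable_comparison_test[OF _ summable_block_bound[OF d(2)]])
       (use block_L_series_bound[OF assms(1,2) d order_refl] in blast)
  then show ?thesis unfolding block_L_series_def by (rule summable_sums)
qed

lemma dirichlet_L_eq_block_series:
  assumes "dirichlet_character L \<eta>" "\<eta> \<noteq> trivial_char L" "Re s > 0"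
  shows "dirichlet_L s \<eta> = block_L_series L \<eta> s"
proof (rule dirichlet_L_eqI[of _ 0])
  show "block_L_series L \<eta> holomorphic_on {w. 0 < Re w}"
  proof (rule holomorphic_onI_local)
    fix x assume x: "x \<in> {w. 0 < Re w}"
    define \<delta> where "\<delta> = Re x / 2"
    have \<delta>: "0 < \<delta>" "\<delta> < Re x" using x by (auto simp: \<delta>_def)
    define U where "U = {w. \<delta> < Re w} \<inter> ball 0 (norm x + 1)"
    have U: "open U" "x \<in> U" using \<delta> by (auto simp: U_def open_halfspace_Re_gt)
    have "block_L_series L \<eta> holomorphic_on U"
      unfolding block_L_series_def[abs_def]
    proof (rule holomorphic_on_suminf[OF U(1) _ summable_block_bound[OF \<delta>(1)]])
      show "(\<lambda>w. \<Sum>i\<in>{m * L..<m * L + L}. \<eta> (int (Suc i)) * of_nat (Suc i) powr (- w)) holomorphic_on U" for m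
        by (intro holomorphic_on_sum holomorphic_on_mult holomorphic_on_const holomorphic_nat_powr)
      fix m w assume "w \<in> U"
      then show "norm (\<Sum>i\<in>{m * L..<m * L + L}. \<eta> (int (Suc i)) * of_nat (Suc i) powr (- w)) \<le>
         real L * (1 + (norm x + 1) * real L) * (real (Suc m) powr (- \<delta> - 1) * 2 powr (\<delta> + 1))"
        using \<delta>(1) by (intro block_L_series_bound assms) (auto simp: U_def)
    qed
    then show "\<exists>U. open U \<and> x \<in> U \<and> block_L_series L \<eta> holomorphic_on U" using U by blast
  qed
  fix w assume "max 0 1 < Re w"
  then have w: "Re w > 1" "Re w > 0" by auto
  have "(\<lambda>n. \<eta> (int (Suc n)) * of_nat (Suc n) powr (- w)) sums dirichlet_series \<eta> w"
    unfolding dirichlet_series_def using dirichlet_series_summable[OF assms(1) w(1)]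
    by (rule summable_sums[OF summable_norm_cancel])
  from sums_group[OF this dirichlet_character_pos[OF assms(1)]]
  show "block_L_series L \<eta> w = dirichlet_series \<eta> w"
    using block_L_series_sums[OF assms(1,2) w(2)] sums_unique2 by blast
qed (use assms in auto)

lemma nat_powr_minus_of_nat: "(of_nat (Suc n) :: complex) powr (- of_nat k) = 1 / of_nat (Suc n) ^ k"
  by (simp add: powr_minus divide_inverse del: of_nat_Suc)

text \<open>Partial sums over whole periods treat absolute convergence and the conditional case k =
  1 alike; they are also the sums that arise from the row constants.\<close>

theorem dirichlet_L_tendsto:
  assumes "dirichlet_character L \<eta>" "k \<ge> 1" "k \<ge> 2 \<or> \<eta> \<noteq> trivial_char L"
  shows "(\<lambda>M. \<Sum>n<M * L. \<eta> (int (Suc n)) / of_nat (Suc n) ^ k) \<longlonglongrightarrow> dirichlet_L (of_nat k) \<eta>"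
proof -
  have L: "L > 0" using assms(1) by (rule dirichlet_character_pos)
  let ?f = "\<lambda>n. \<eta> (int (Suc n)) * of_nat (Suc n) powr (- of_nat k)"
  have "(\<lambda>m. \<Sum>i\<in>{m * L..<m * L + L}. ?f i) sums dirichlet_L (of_nat k) \<eta>"
  proof (cases "k \<ge> 2")
    case True
    then have k: "Re (of_nat k) > 1" by simp
    have "?f sums dirichlet_L (of_nat k) \<eta>"
      unfolding dirichlet_L_eq_series[OF assms(1) k] unfolding dirichlet_series_def
      by (rule summable_sums[OF summable_norm_cancel[OF dirichlet_series_summable[OF assms(1) k]]])
    from sums_group[OF this L] show ?thesis .
  next
    case False
    then have nt: "\<eta> \<noteq> trivial_char L" using assms by auto
    have k: "Re (of_nat k) > 0" using assms by simp
    show ?thesis unfolding dirichlet_L_eq_block_series[OF assms(1) nt k]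
      by (rule block_L_series_sums[OF assms(1) nt k])
  qed
  then have "(\<lambda>M. \<Sum>n<M * L. ?f n) \<longlonglongrightarrow> dirichlet_L (of_nat k) \<eta>"
    by (simp only: sums_def sum.nat_group)
  then show ?thesis by (simp add: nat_powr_minus_of_nat del: of_nat_Suc)
qed

lemma dirichlet_L_sums:
  assumes "dirichlet_character L \<eta>" "k \<ge> 2"
  shows "summable (\<lambda>n. norm (\<eta> (int (Suc n)) / of_nat (Suc n) ^ k))"
    and "(\<lambda>n. \<eta> (int (Suc n)) / of_nat (Suc n) ^ k) sums dirichlet_L (of_nat k) \<eta>"
proof -
  have k: "Re (of_nat k) > 1" using assms by simp
  note s = dirichlet_series_summable[OF assms(1) k]
  show "summable (\<lambda>n. norm (\<eta> (int (Suc n)) / of_nat (Suc n) ^ k))"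
    using s by (simp add: nat_powr_minus_of_nat del: of_nat_Suc)
  show "(\<lambda>n. \<eta> (int (Suc n)) / of_nat (Suc n) ^ k) sums dirichlet_L (of_nat k) \<eta>"
    using summable_sums[OF summable_norm_cancel[OF s]] unfolding dirichlet_L_eq_series[OF assms(1) k] dirichlet_series_def
    by (simp add: nat_powr_minus_of_nat del: of_nat_Suc)
qed

section \<open>The weights attached to a pair of characters\<close>

definition twisted_sum :: "nat \<Rightarrow> (int \<Rightarrow> complex) \<Rightarrow> int \<Rightarrow> complex" where
  "twisted_sum M \<eta> n = (\<Sum>a\<in>{0..<int M}. \<eta> a * unity_exp (of_int (n * a) / of_nat M))"

text \<open>The Gauss sum in the coefficients is exactly what turns the inner Moebius sum of
  \<open>divisor_sum\<close> into a Gauss sum of the possibly imprimitive character.\<close>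

lemma divisor_sum_mult_gauss_sum:
  assumes "dirichlet_character M \<eta>" "m > 0"
  shows "divisor_sum k \<psi> M (conj_char \<eta>) m * primitive_gauss_sum M \<eta> =
     (\<Sum>c | c dvd m. \<psi> (int (m div c)) * of_nat c ^ (k - 1) * twisted_sum M \<eta> (int c))"
proof -
  have l: "conductor_index M (conj_char \<eta>) = conductor_index M \<eta>" by (simp add: conductor_index_def)
  define S where "S c = (\<Sum>d | d dvd gcd (conductor_index M (conj_char \<eta>)) c.
      of_nat d * of_int (moebius (conductor_index M (conj_char \<eta>) div d)) *
      cnj (primitive_char M (conj_char \<eta>) (int (conductor_index M (conj_char \<eta>) div d))) *
      primitive_char M (conj_char \<eta>) (int (c div d)))" for c
  have tw: "twisted_sum M \<eta> (int c) = primitive_gauss_sum M \<eta> * S c" for c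
    unfolding S_def twisted_sum_def sum_dirichlet_character_unity_exp[OF assms(1)] l primitive_char_conj[OF assms(1)]
    by (simp add: conj_char_def)
  have "divisor_sum k \<psi> M (conj_char \<eta>) m = (\<Sum>c | c dvd m. \<psi> (int (m div c)) * of_nat c ^ (k - 1) * S c)"
    using assms(2) by (simp add: divisor_sum_def S_def)
  then show ?thesis unfolding tw by (simp only: sum_distrib_right) (intro sum.cong refl, simp only: mult_ac)
qed

lemma cnj_twisted_sum: "cnj (twisted_sum M \<eta> (- n)) = twisted_sum M (conj_char \<eta>) n"
proof -
  have "cnj (unity_exp (of_int (- n * a) / of_nat M)) = unity_exp (of_int (n * a) / of_nat M)" for a
    using cnj_unity_exp[of "real_of_int (- n * a) / real M"] by simp
  then show ?thesis unfolding twisted_sum_def cnj_sum complex_cnj_mult by (simp only: conj_char_def)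
qed

text \<open>Exchanging a divisor with its cofactor turns 1 / c^(K+1) into c^(K+1) / m^(K+1). This is
  the origin of the product of m^(1-k) with a divisor sum of exponent k - 1.\<close>

lemma divisor_conv_twisted_sum:
  assumes "dirichlet_character M \<eta>" "m > 0"
  shows "divisor_conv (\<lambda>(c, n). A / of_nat (q * c) ^ Suc K * \<psi> (int c) * B * twisted_sum M \<eta> (int n)) m =
     A * B / of_nat q ^ Suc K / of_nat m ^ Suc K *
       (divisor_sum (K + 2) \<psi> M (conj_char \<eta>) m * primitive_gauss_sum M \<eta>)"
proof -
  have "divisor_conv (\<lambda>(c, n). A / of_nat (q * c) ^ Suc K * \<psi> (int c) * B * twisted_sum M \<eta> (int n)) m =
     (\<Sum>c | c dvd m. A / of_nat (q * (m div c)) ^ Suc K * \<psi> (int (m div c)) * B * twisted_sum M \<eta> (int c))"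
  proof -
    have "(\<Sum>c | c dvd m. A / of_nat (q * c) ^ Suc K * \<psi> (int c) * B * twisted_sum M \<eta> (int (m div c))) =
       (\<Sum>c | c dvd m. A / of_nat (q * (m div c)) ^ Suc K * \<psi> (int (m div c)) * B * twisted_sum M \<eta> (int c))"
      by (rule sum.reindex_bij_witness[of _ "\<lambda>c. m div c" "\<lambda>c. m div c"]) (use assms(2) in \<open>auto elim!: dvdE\<close>)
    then show ?thesis using assms(2) by (simp add: divisor_conv_def)
  qed
  also have "\<dots> = (\<Sum>c | c dvd m. A * B / of_nat q ^ Suc K / of_nat m ^ Suc K *
      (\<psi> (int (m div c)) * of_nat c ^ (K + 2 - 1) * twisted_sum M \<eta> (int c)))"
  proof (rule sum.cong[OF refl])
    fix c assume "c \<in> {c. c dvd m}"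
    then obtain e where e: "m = c * e" by auto
    then have "c > 0" "e > 0" using assms(2) by auto
    then have r: "m div c = e" and "1 / of_nat e ^ Suc K = (of_nat c ^ Suc K / of_nat m ^ Suc K :: complex)"
      by (simp_all add: e power_mult_distrib)
    then show "A / of_nat (q * (m div c)) ^ Suc K * \<psi> (int (m div c)) * B * twisted_sum M \<eta> (int c) =
        A * B / of_nat q ^ Suc K / of_nat m ^ Suc K * (\<psi> (int (m div c)) * of_nat c ^ (K + 2 - 1) * twisted_sum M \<eta> (int c))"
    proof -
      assume r: "m div c = e" and h: "1 / of_nat e ^ Suc K = (of_nat c ^ Suc K / of_nat m ^ Suc K :: complex)"
      have "A / (Q * E) * P * B * T = A * B / Q / R * (P * C * T)" if h: "1 / E = C / R" for Q E P T C R :: complex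
      proof -
        have "A / (Q * E) * P * B * T = A / Q * (1 / E) * P * B * T" by simp
        also have "\<dots> = A * B / Q / R * (P * C * T)" unfolding h by simp
        finally show ?thesis .
      qed
      from this[OF h] show ?thesis unfolding r of_nat_mult power_mult_distrib by simp
    qed
  qed
  also have "\<dots> = A * B / of_nat q ^ Suc K / of_nat m ^ Suc K *
       (divisor_sum (K + 2) \<psi> M (conj_char \<eta>) m * primitive_gauss_sum M \<eta>)"
    unfolding divisor_sum_mult_gauss_sum[OF assms] sum_distrib_left by (rule refl)
  finally show ?thesis .
qed

lemma has_sum_pair_multiples:
  fixes f :: "nat \<times> nat \<Rightarrow> complex"
  assumes "(f has_sum S) ({1..} \<times> {1..})" "p > 0" "q > 0"
    and "\<And>c n. \<not> (p dvd c \<and> q dvd n) \<Longrightarrow> f (c, n) = 0"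
  shows "((\<lambda>(c, n). f (p * c, q * n)) has_sum S) ({1..} \<times> {1..})"
proof -
  let ?h = "\<lambda>(c, n). (p * c, q * n)"
  have "(f has_sum S) (?h ` ({1..} \<times> {1..})) \<longleftrightarrow> (f has_sum S) ({1..} \<times> {1..})"
  proof (rule has_sum_cong_neutral)
    fix x assume x: "x \<in> {1..} \<times> {1..} - ?h ` ({1..} \<times> {1..})"
    obtain c n where cn: "x = (c, n)" by force
    have "\<not> (p dvd c \<and> q dvd n)"
    proof
      assume "p dvd c \<and> q dvd n"
      then have "p dvd c" "q dvd n" by auto
      then obtain c' n' where "c = p * c'" "n = q * n'" by (elim dvdE)
      then have "x = ?h (c', n')" "(c', n') \<in> {1..} \<times> {1..}" using x cn assms by (auto simp: Suc_le_eq)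
      then show False using x by blast
    qed
    then show "f x = 0" using assms(4) cn by simp
  qed (use assms in \<open>auto simp: Suc_le_eq\<close>)
  then have "(f has_sum S) (?h ` ({1..} \<times> {1..}))" using assms(1) by blast
  then show ?thesis
    using assms by (subst (asm) has_sum_reindex) (auto simp: inj_on_def o_def case_prod_unfold)
qed

lemma sum_multiples:
  fixes g :: "int \<Rightarrow> complex"
  assumes "p > 0"
  shows "(\<Sum>c\<in>{0..<int (p * L)}. if int p dvd c then g (c div int p) else 0) = (\<Sum>c\<in>{0..<int L}. g c)"
proof -
  have "(\<Sum>c\<in>{0..<int (p * L)}. if int p dvd c then g (c div int p) else 0) =
      (\<Sum>c\<in>{c\<in>{0..<int (p * L)}. int p dvd c}. g (c div int p))"
    by (rule sum.mono_neutral_cong_right) auto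
  also have "\<dots> = (\<Sum>c\<in>{0..<int L}. g c)"
    by (rule sum.reindex_bij_witness[of _ "\<lambda>c. int p * c" "\<lambda>c. c div int p"])
       (use assms in \<open>auto simp: pos_imp_zdiv_nonneg_iff intro: int_div_less elim!: dvdE\<close>)
  finally show ?thesis .
qed

locale character_pair =
  fixes K L M t :: nat and \<psi> \<rho> :: "int \<Rightarrow> complex"
  assumes t_pos: "t > 0"
    and \<psi>: "dirichlet_character L \<psi>" and \<rho>: "dirichlet_character M \<rho>"
    and parity_\<psi>\<rho>: "\<psi> (-1) * \<rho> (-1) = (-1) ^ K"
    and nontrivial: "K = 0 \<Longrightarrow> \<psi> \<noteq> trivial_char L \<or> \<rho> \<noteq> trivial_char M"
begin

abbreviation level :: nat where "level \<equiv> t * L * M"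

definition weight :: "int \<times> int \<Rightarrow> complex" where
  "weight = (\<lambda>(c, d). if int (t * M) dvd c then cnj (\<psi> (c div int (t * M))) * \<rho> d else 0)"

lemma L_pos: "L > 0" and M_pos: "M > 0"
  using \<psi> \<rho> by (simp_all add: dirichlet_character_pos)

lemma weight_scaled: "weight (int (t * M) * c, d) = cnj (\<psi> c) * \<rho> d"
  using t_pos M_pos by (simp add: weight_def)

lemma square_minus_one:
  assumes "dirichlet_character N \<eta>"
  shows "\<eta> (-1) = 1 \<or> \<eta> (-1) = -1"
proof -
  have "\<eta> (-1) * \<eta> (-1) = 1"
    using dirichlet_character_mult[OF assms, of "-1" "-1"] dirichlet_character_1[OF assms] by simp
  then show ?thesis by (simp add: square_eq_1_iff)
qed

lemma character_uminus: "dirichlet_character N \<eta> \<Longrightarrow> \<eta> (- x) = \<eta> (-1) * \<eta> x"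
  using dirichlet_character_mult[of N \<eta> "-1" x] by simp

lemma sum_\<rho>: "(\<Sum>b\<in>{0..<int level}. \<rho> b) = of_nat (t * L) * (\<Sum>b\<in>{0..<int M}. \<rho> b)"
proof -
  have "level = M * (t * L)" by simp
  then have "(\<Sum>b\<in>{0..<int level}. \<rho> b) = (\<Sum>b\<in>{0..<int M}. \<Sum>j\<in>{0..<int (t * L)}. \<rho> (b + int M * j))"
    by (simp only: sum_residues_split[OF M_pos])
  also have "\<dots> = (\<Sum>b\<in>{0..<int M}. \<Sum>j\<in>{0..<int (t * L)}. \<rho> b)"
    by (intro sum.cong refl dirichlet_character_cong[OF \<rho>]) (simp add: cong_def)
  finally show ?thesis by (simp add: sum_distrib_left)
qed

sublocale W: lattice_weight level K weight
proof
  show "level > 0" using t_pos L_pos M_pos by simp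
  show "weight (a + int level * m, b + int level * n) = weight (a, b)" for a b m n
  proof -
    have e: "a + int level * m = a + int (t * M) * (int L * m)" by simp
    have "int (t * M) dvd a + int level * m \<longleftrightarrow> int (t * M) dvd a"
      unfolding e by (rule dvd_add_left_iff) simp
    moreover have "(a + int level * m) div int (t * M) = a div int (t * M) + int L * m"
      unfolding e using t_pos M_pos by (subst div_mult_self2) auto
    moreover have "\<psi> (a div int (t * M) + int L * m) = \<psi> (a div int (t * M))"
      by (rule dirichlet_character_cong[OF \<psi>]) (simp add: cong_def)
    moreover have "b + int level * n = b + int M * (int (t * L) * n)" by simp
    then have "\<rho> (b + int level * n) = \<rho> b"
      by (intro dirichlet_character_cong[OF \<rho>]) (simp only: cong_def mod_mult_self2)
    ultimately show ?thesis by (simp only: weight_def prod.case)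
  qed
  show "weight (- a, - b) = (-1) ^ K * weight (a, b)" for a b
  proof (cases "int (t * M) dvd a")
    case True
    then obtain a' where a': "a = int (t * M) * a'" by auto
    have "weight (- a, - b) = cnj (\<psi> (- a')) * \<rho> (- b)"
      using weight_scaled[of "- a'" "- b"] by (simp add: a')
    also have "\<dots> = cnj (\<psi> (-1)) * \<rho> (-1) * (cnj (\<psi> a') * \<rho> b)"
      by (subst character_uminus[OF \<psi>], subst character_uminus[OF \<rho>]) simp
    also have "cnj (\<psi> (-1)) = \<psi> (-1)" using square_minus_one[OF \<psi>] by auto
    finally show ?thesis by (simp only: parity_\<psi>\<rho> a' weight_scaled)
  qed (simp add: weight_def)
  \<comment> \<open>The sum over the box factors into multiples of two full character sums, the
    first conjugated; one of them vanishes because one of the characters is nontrivial.\<close>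
  assume K: "K = 0"
  have "(\<Sum>r\<in>residue_box level. weight r) = (\<Sum>c\<in>{0..<int level}. \<Sum>d\<in>{0..<int level}. weight (c, d))"
    unfolding residue_box_def sum.cartesian_product by simp
  also have "\<dots> = (\<Sum>c\<in>{0..<int level}. (if int (t * M) dvd c then cnj (\<psi> (c div int (t * M))) else 0) * (\<Sum>d\<in>{0..<int level}. \<rho> d))"
    by (intro sum.cong refl) (simp add: weight_def sum_distrib_left)
  also have "\<dots> = (\<Sum>c\<in>{0..<int (t * M * L)}. (if int (t * M) dvd c then cnj (\<psi> (c div int (t * M))) else 0)) * (\<Sum>d\<in>{0..<int level}. \<rho> d)"
  proof -
    have lv: "level = t * M * L" by simp
    show ?thesis unfolding sum_distrib_right[symmetric] by (simp only: lv)
  qed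
  also have "\<dots> = (\<Sum>c\<in>{0..<int L}. cnj (\<psi> c)) * (of_nat (t * L) * (\<Sum>b\<in>{0..<int M}. \<rho> b))"
    unfolding sum_\<rho> using t_pos M_pos by (subst sum_multiples) simp_all
  also have "\<dots> = cnj (\<Sum>c\<in>{0..<int L}. \<psi> c) * (of_nat (t * L) * (\<Sum>b\<in>{0..<int M}. \<rho> b))" by simp
  also have "\<dots> = 0"
    using nontrivial[OF K] sum_nontrivial_character[OF \<psi>] sum_nontrivial_character[OF \<rho>] by (auto simp del: cnj_sum)
  finally show "(\<Sum>r\<in>residue_box level. weight r) = 0" .
qed

text \<open>In its second variable the weight has period M, a divisor of the level t L M. Its
  Fourier transform therefore lives on multiples of t L, where it reduces to a sum modulo M.\<close>

lemma dft_weight: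
  "dft level weight c n =
     (if int (t * M) dvd c \<and> int (t * L) dvd n
      then cnj (\<psi> (c div int (t * M))) * of_nat (t * L) * twisted_sum M \<rho> (n div int (t * L)) else 0)"
proof (cases "int (t * M) dvd c")
  case True
  let ?e = "\<lambda>n d. unity_exp (of_int n / of_nat d)"
  have lv: "level = M * (t * L)" by simp
  have pos: "M > 0" "t * L > 0" using M_pos L_pos t_pos by auto
  have "dft level weight c n = cnj (\<psi> (c div int (t * M))) * (\<Sum>b\<in>{0..<int level}. \<rho> b * ?e (n * b) level)"
    using True by (simp add: dft_def weight_def sum_distrib_left mult.assoc)
  also have "(\<Sum>b\<in>{0..<int level}. \<rho> b * ?e (n * b) level) =
      (\<Sum>b\<in>{0..<int M}. \<Sum>j\<in>{0..<int (t * L)}. \<rho> (b + int M * j) * ?e (n * (b + int M * j)) level)"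
    by (simp only: lv sum_residues_split[OF pos(1)])
  also have "\<dots> = (\<Sum>b\<in>{0..<int M}. \<Sum>j\<in>{0..<int (t * L)}. \<rho> b * ?e (n * b) level * ?e (n * j) (t * L))"
  proof (intro sum.cong refl)
    fix b j
    have "\<rho> (b + int M * j) = \<rho> b" by (rule dirichlet_character_cong[OF \<rho>]) (simp add: cong_def)
    moreover have "?e (n * (b + int M * j)) level = ?e (n * b) level * ?e (n * j) (t * L)"
      unfolding unity_exp_add[symmetric] using pos by (simp add: field_simps)
    ultimately show "\<rho> (b + int M * j) * ?e (n * (b + int M * j)) level = \<rho> b * ?e (n * b) level * ?e (n * j) (t * L)" by simp
  qed
  also have "\<dots> = (\<Sum>b\<in>{0..<int M}. \<rho> b * ?e (n * b) level) * (if int (t * L) dvd n then of_nat (t * L) else 0)"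
    unfolding sum_unity_exp[OF pos(2), symmetric] sum_product by (rule refl)
  also have "cnj (\<psi> (c div int (t * M))) * \<dots> = (if int (t * M) dvd c \<and> int (t * L) dvd n
      then cnj (\<psi> (c div int (t * M))) * of_nat (t * L) * twisted_sum M \<rho> (n div int (t * L)) else 0)"
  proof (cases "int (t * L) dvd n")
    case d: True
    then obtain n' where n': "n = int (t * L) * n'" by auto
    have "(\<Sum>b\<in>{0..<int M}. \<rho> b * ?e (n * b) level) = twisted_sum M \<rho> n'"
      unfolding twisted_sum_def n' using pos by (intro sum.cong refl) simp
    then show ?thesis using True d pos by (simp add: n')
  qed simp
  finally show ?thesis .
qed (simp add: dft_def weight_def)

definition holo_pair' :: "nat \<times> nat \<Rightarrow> complex" where
  "holo_pair' = (\<lambda>(c, n). fourier_const level K / of_nat (t * M * c) ^ Suc K * conj_char \<psi> (int c) *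
     of_nat (t * L) * twisted_sum M \<rho> (int n))"

definition anti_pair' :: "nat \<times> nat \<Rightarrow> complex" where
  "anti_pair' = (\<lambda>(c, n). cnj (fourier_const level K) / of_nat (t * M * c) ^ Suc K * \<psi> (int c) *
     of_nat (t * L) * twisted_sum M (conj_char \<rho>) (int n))"

lemma pair_multiples:
  "W.holo_pair (t * M * c, t * L * n) = holo_pair' (c, n)"
  "W.anti_pair (t * M * c, t * L * n) = anti_pair' (c, n)"
proof -
  have pos: "t * M > 0" "t * L > 0" using M_pos L_pos t_pos by auto
  have 1: "dft level weight (int (t * M * c)) (int (t * L * n)) = cnj (\<psi> (int c)) * of_nat (t * L) * twisted_sum M \<rho> (int n)"
    using pos by (simp add: dft_weight del: of_nat_mult) (simp add: of_nat_mult[of "t * M"] of_nat_mult[of "t * L"] del: of_nat_mult)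
  have "int (t * L * n) = int (t * L) * int n" "int (t * M * c) = int (t * M) * int c" by simp_all
  then have 2: "dft level weight (int (t * M * c)) (- int (t * L * n)) = cnj (\<psi> (int c)) * of_nat (t * L) * twisted_sum M \<rho> (- int n)"
    using pos by (simp add: dft_weight del: of_nat_mult flip: mult_minus_right)
  show "W.holo_pair (t * M * c, t * L * n) = holo_pair' (c, n)"
    unfolding W.holo_pair_def holo_pair'_def prod.case 1 by (simp add: conj_char_def)
  show "W.anti_pair (t * M * c, t * L * n) = anti_pair' (c, n)"
    unfolding W.anti_pair_def anti_pair'_def prod.case 2 by (simp add: cnj_twisted_sum[symmetric])
qed

lemma pair_zero:
  assumes "\<not> (t * M dvd c \<and> t * L dvd n)"
  shows "W.holo_pair (c, n) = 0" "W.anti_pair (c, n) = 0"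
proof -
  have "\<not> (int (t * M) dvd int c \<and> int (t * L) dvd int n)"
    unfolding of_nat_dvd_iff by (rule assms)
  moreover have "int (t * L) dvd - int n \<longleftrightarrow> int (t * L) dvd int n" by (rule dvd_minus_iff)
  ultimately have "dft level weight (int c) (int n) = 0" "dft level weight (int c) (- int n) = 0"
    unfolding dft_weight by auto
  then show "W.holo_pair (c, n) = 0" "W.anti_pair (c, n) = 0"
    by (simp_all add: W.holo_pair_def W.anti_pair_def)
qed

text \<open>As t M and t L have product t times the level, the surviving pairs produce integral
  powers of q^t, although the general expansion is in roots of q.\<close>

lemma nome_rescale:
  "unity_exp (of_nat ((t * M * c) * (t * L * n)) * z / of_nat level) = unity_exp (of_nat (c * n) * (of_nat t * z) / of_nat 1)"
  using M_pos L_pos t_pos by (simp add: field_simps)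

lemma pair_bounds':
  "\<exists>B\<ge>0. \<forall>c\<ge>1. \<forall>n. norm (holo_pair' (c, n)) \<le> B \<and> norm (anti_pair' (c, n)) \<le> B"
proof -
  obtain B where B: "B \<ge> 0" "\<And>c n. c \<ge> 1 \<Longrightarrow> norm (W.holo_pair (c, n)) \<le> B \<and> norm (W.anti_pair (c, n)) \<le> B"
    using W.pair_bounds by blast
  have "norm (holo_pair' (c, n)) \<le> B \<and> norm (anti_pair' (c, n)) \<le> B" if "c \<ge> 1" for c n
    using B(2)[of "t * M * c" "t * L * n"] that t_pos M_pos unfolding pair_multiples by (simp add: Suc_le_eq)
  then show ?thesis using B(1) by blast
qed

lemma holo_series_eq:
  assumes "Im z > 0"
  shows "nome_series level W.holo_coeff z = nome_series 1 (divisor_conv holo_pair') (of_nat t * z)"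
proof -
  obtain B where B: "B \<ge> 0" "\<And>c n. c \<ge> 1 \<Longrightarrow> norm (holo_pair' (c, n)) \<le> B" using pair_bounds' by blast
  have "((\<lambda>(c, n). holo_pair' (c, n) * unity_exp (of_nat (c * n) * (of_nat t * z) / of_nat 1)) has_sum
      nome_series 1 (divisor_conv holo_pair') (of_nat t * z)) ({1..} \<times> {1..})"
    using B assms t_pos by (intro has_sum_divisor_conv[of B _ 0]) auto
  moreover have "((\<lambda>(c, n). case (t * M * c, t * L * n) of (c, n) \<Rightarrow> W.holo_pair (c, n) * unity_exp (of_nat (c * n) * z / of_nat level))
      has_sum nome_series level W.holo_coeff z) ({1..} \<times> {1..})"
    using t_pos M_pos L_pos pair_zero(1)
    by (intro has_sum_pair_multiples[OF W.holo_pairs_has_sum[OF assms]]) auto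
  ultimately show ?thesis unfolding prod.case pair_multiples nome_rescale by (rule has_sum_unique[rotated])
qed

lemma anti_series_eq:
  assumes "Im z > 0"
  shows "W.anti_series i z = of_nat (t * level) ^ i * nome_series 1 (\<lambda>m. of_nat m ^ i * divisor_conv anti_pair' m) (of_nat t * z)"
proof -
  obtain B where B: "B \<ge> 0" "\<And>c n. c \<ge> 1 \<Longrightarrow> norm (anti_pair' (c, n)) \<le> B" using pair_bounds' by blast
  define g where "g = (\<lambda>(c, n). of_nat (c * n) ^ i * anti_pair' (c, n))"
  have "norm (g (c, n)) \<le> B * real (c * n) ^ i" if "c \<ge> 1" for c n
    using mult_left_mono[OF B(2)[OF that, of n], of "real (c * n) ^ i"]
    by (simp add: g_def norm_mult norm_power mult.commute del: of_nat_mult)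
  then have "((\<lambda>(c, n). g (c, n) * unity_exp (of_nat (c * n) * (of_nat t * z) / of_nat 1)) has_sum
      nome_series 1 (divisor_conv g) (of_nat t * z)) ({1..} \<times> {1..})"
    using B(1) assms t_pos by (intro has_sum_divisor_conv[of B _ i]) auto
  from has_sum_cmult_right[OF this, of "of_nat (t * level) ^ i"]
  have "((\<lambda>(c, n). of_nat (t * level) ^ i * (g (c, n) * unity_exp (of_nat (c * n) * (of_nat t * z) / of_nat 1))) has_sum
      of_nat (t * level) ^ i * nome_series 1 (divisor_conv g) (of_nat t * z)) ({1..} \<times> {1..})"
    by (simp only: case_prod_unfold)
  moreover have "((\<lambda>(c, n). case (t * M * c, t * L * n) of (c, n) \<Rightarrow>
       of_nat (c * n) ^ i * W.anti_pair (c, n) * unity_exp (of_nat (c * n) * z / of_nat level))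
      has_sum W.anti_series i z) ({1..} \<times> {1..})"
    using t_pos M_pos L_pos pair_zero(2)
    by (intro has_sum_pair_multiples[OF W.anti_pairs_has_sum[OF assms]]) auto
  moreover have "of_nat ((t * M * c) * (t * L * n)) ^ i * X * Y = of_nat (t * level) ^ i * (of_nat (c * n) ^ i * X * Y)" for c n and X Y :: complex
    by (simp add: power_mult_distrib mult_ac)
  ultimately have "W.anti_series i z = of_nat (t * level) ^ i * nome_series 1 (divisor_conv g) (of_nat t * z)"
    unfolding prod.case pair_multiples nome_rescale g_def by (simp only:) (rule has_sum_unique)
  moreover have "divisor_conv g = (\<lambda>m. of_nat m ^ i * divisor_conv anti_pair' m)"
    by (auto simp: fun_eq_iff divisor_conv_def g_def sum_distrib_left simp del: of_nat_mult intro!: sum.cong)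
  ultimately show ?thesis by simp
qed

lemma poly_bounded_pairs:
  "poly_bounded (divisor_conv holo_pair')" "poly_bounded (\<lambda>m. of_nat m ^ i * divisor_conv anti_pair' m)"
proof -
  obtain B where B: "B \<ge> 0" "\<And>c n. c \<ge> 1 \<Longrightarrow> norm (holo_pair' (c, n)) \<le> B \<and> norm (anti_pair' (c, n)) \<le> B"
    using pair_bounds' by blast
  show "poly_bounded (divisor_conv holo_pair')" using B by (intro divisor_conv_poly_bounded[of B _ 0]) auto
  show "poly_bounded (\<lambda>m. of_nat m ^ i * divisor_conv anti_pair' m)"
  proof (induction i)
    case 0
    show ?case using B by (simp, intro divisor_conv_poly_bounded[of B _ 0]) auto
  next
    case (Suc i)
    from poly_bounded_mult_of_nat[OF this, of 1] show ?case by (simp add: mult.assoc)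
  qed
qed

definition mass :: complex where "mass = 1 / (2 * of_nat (Suc K))"

lemma cnj_mass: "cnj mass = mass" by (simp add: mass_def)

definition anti_coeff' :: "nat \<Rightarrow> complex" where "anti_coeff' m = 2 * mass * divisor_conv anti_pair' m"

lemma anti_fun_has_sum:
  assumes "Im z > 0"
  shows "((\<lambda>m. (2 * of_real pi * \<i> * of_nat (t * m)) ^ j * anti_coeff' m * unity_exp (of_nat m * (of_nat t * z))) has_sum
     mass * W.anti_fun j z) UNIV"
proof -
  let ?c = "mass * (2 * (2 * of_real pi * \<i> / of_nat level) ^ j * of_nat (t * level) ^ j)"
  have "((\<lambda>m. ?c * (of_nat m ^ j * divisor_conv anti_pair' m * unity_exp (of_nat m * (of_nat t * z) / of_nat 1))) has_sum
     ?c * nome_series 1 (\<lambda>m. of_nat m ^ j * divisor_conv anti_pair' m) (of_nat t * z)) UNIV"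
    using assms t_pos by (intro has_sum_cmult_right nome_series_has_sum poly_bounded_pairs) auto
  moreover have "?c * nome_series 1 (\<lambda>m. of_nat m ^ j * divisor_conv anti_pair' m) (of_nat t * z) = mass * W.anti_fun j z"
    unfolding W.anti_fun_eq[OF assms] anti_series_eq[OF assms] by (simp only: mult.assoc)
  moreover have "?c * (of_nat m ^ j * divisor_conv anti_pair' m * X) =
      (2 * of_real pi * \<i> * of_nat (t * m)) ^ j * anti_coeff' m * X" for m X
  proof -
    have "(2 * of_real pi * \<i> / of_nat level) * of_nat (t * level) * of_nat m = 2 * of_real pi * \<i> * (of_nat (t * m) :: complex)"
      using M_pos L_pos t_pos by simp
    then have "(2 * of_real pi * \<i> / of_nat level) ^ j * of_nat (t * level) ^ j * of_nat m ^ j = (2 * of_real pi * \<i> * (of_nat (t * m) :: complex)) ^ j"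
      by (simp only: power_mult_distrib[symmetric])
    note e = this
    have "mass * (2 * p * q) * (r * D * X) = p * q * r * (2 * mass * D) * X" for p q r D by (simp only: mult_ac)
    then show ?thesis unfolding anti_coeff'_def e[symmetric] by (simp only:)
  qed
  ultimately show ?thesis by (simp only: div_by_1 of_nat_1)
qed

text \<open>Here the factor 2^(2-k) pi i^(k-2) of the coefficients arises, from 1 / i^K = (-1)^K
  i^K.\<close>

lemma fourier_const_eq: "fourier_const n K = of_real pi * \<i> ^ K / 2 ^ K / of_nat n"
proof -
  have "\<i> ^ K * \<i> ^ K = (-1) ^ K" by (simp flip: power_mult_distrib)
  then show ?thesis
    by (cases "n = 0") (simp_all add: fourier_const_def power_mult_distrib field_simps)
qed

lemma cnj_fourier_const: "cnj (fourier_const n K) = of_real pi * (-1) ^ K * \<i> ^ K / 2 ^ K / of_nat n"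
  unfolding fourier_const_eq by (simp add: power_minus[of \<i>])

lemma weights_nonzero: "of_nat t \<noteq> (0::complex)" "of_nat M \<noteq> (0::complex)" "of_nat L \<noteq> (0::complex)"
  using t_pos M_pos L_pos by auto

lemma mock_coeff_pos:
  assumes "m > 0"
  shows "mock_eisenstein_coeff (K + 2) t \<psi> M \<rho> (int (t * m)) = 2 * mass * divisor_conv holo_pair' m"
proof -
  define V where "V = divisor_sum (K + 2) (conj_char \<psi>) M (conj_char \<rho>) m"
  define G where "G = primitive_gauss_sum M \<rho>"
  have tm: "\<not> int (t * m) < 0" "int (t * m) \<noteq> 0" "int t dvd int (t * m)" "nat (int (t * m)) div t = m"
    by (simp_all only: nat_int not_less) (use assms t_pos in auto)
  have "mock_eisenstein_coeff (K + 2) t \<psi> M \<rho> (int (t * m)) =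
     2 powi (2 - int (K + 2)) * of_real pi * \<i> ^ K / (of_nat M ^ (K + 2) * of_nat (Suc K)) * G *
       of_int (int (t * m)) powi (1 - int (K + 2)) * V"
    unfolding mock_eisenstein_coeff_def using tm by (simp only: if_False if_True V_def G_def) simp
  also have "2 powi (2 - int (K + 2)) = (1 / 2 ^ K :: complex)"
    by (simp add: power_int_minus divide_inverse)
  also have "of_int (int (t * m)) powi (1 - int (K + 2)) = (1 / of_nat (t * m) ^ Suc K :: complex)"
  proof -
    have "1 - int (K + 2) = - int (Suc K)" by simp
    then show ?thesis by (simp only: power_int_minus power_int_of_nat of_int_of_nat_eq divide_inverse mult_1)
  qed
  also have "1 / 2 ^ K * of_real pi * \<i> ^ K / (of_nat M ^ (K + 2) * of_nat (Suc K)) * G * (1 / of_nat (t * m) ^ Suc K) * V =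
     2 * mass * (fourier_const level K * of_nat (t * L) / of_nat (t * M) ^ Suc K / of_nat m ^ Suc K * (V * G))"
    unfolding fourier_const_eq mass_def using weights_nonzero assms
    by (simp add: power_mult_distrib divide_simps del: of_nat_Suc)
  also have "fourier_const level K * of_nat (t * L) / of_nat (t * M) ^ Suc K / of_nat m ^ Suc K * (V * G) = divisor_conv holo_pair' m"
    unfolding holo_pair'_def V_def G_def by (rule divisor_conv_twisted_sum[OF \<rho> assms, symmetric])
  finally show ?thesis .
qed

text \<open>Only the rows c = t M e contribute. As the level is t M L, the range up to level * X
  corresponds to X full periods of \<psi>.\<close>

lemma row_const_sum:
  "(\<Sum>c\<in>{1..level * X}. W.row_const c) =
     fourier_const level K * of_nat (t * L) * (\<Sum>b\<in>{0..<int M}. \<rho> b) / of_nat (t * M) ^ Suc K *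
       (\<Sum>n<X * L. conj_char \<psi> (int (Suc n)) / of_nat (Suc n) ^ Suc K)"
proof -
  have pos: "t * M > 0" using t_pos M_pos by simp
  let ?C = "fourier_const level K * of_nat (t * L) * (\<Sum>b\<in>{0..<int M}. \<rho> b) / of_nat (t * M) ^ Suc K"
  have row: "W.row_const c = (if t * M dvd c then fourier_const level K / of_nat c ^ Suc K *
     (cnj (\<psi> (int c div int (t * M))) * (of_nat (t * L) * (\<Sum>b\<in>{0..<int M}. \<rho> b))) else 0)" for c
    unfolding W.row_const_def sum_\<rho>[symmetric] of_nat_dvd_iff[symmetric]
    by (simp add: weight_def sum_distrib_left del: of_nat_mult)
  have "(\<Sum>c\<in>{1..level * X}. W.row_const c) = (\<Sum>c\<in>{c\<in>{1..level * X}. t * M dvd c}. W.row_const c)"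
    by (rule sum.mono_neutral_right) (auto simp: row)
  also have "\<dots> = (\<Sum>n<X * L. ?C * (conj_char \<psi> (int (Suc n)) / of_nat (Suc n) ^ Suc K))"
  proof (rule sum.reindex_bij_witness[of _ "\<lambda>n. t * M * Suc n" "\<lambda>c. c div (t * M) - 1"])
    fix c assume "c \<in> {c \<in> {1..level * X}. t * M dvd c}"
    then obtain e where e: "c = t * M * e" "c \<ge> 1" "c \<le> level * X" by auto
    have e1: "e \<ge> 1" using e(1,2) by (cases e) auto
    have "t * M * e \<le> t * M * (X * L)" using e by (simp add: mult_ac)
    then have e2: "e \<le> X * L" using pos by simp
    have ce: "c div (t * M) = e" using pos e(1) by simp
    show "t * M * Suc (c div (t * M) - 1) = c" using e1 ce e(1) by simp
    show "c div (t * M) - 1 \<in> {..<X * L}" using e1 e2 ce by auto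
  next
    fix n assume n: "n \<in> {..<X * L}"
    show "t * M * Suc n div (t * M) - 1 = n" using pos by (simp del: mult_Suc_right)
    have "t * M * Suc n \<le> t * M * (X * L)" using n by (intro mult_left_mono) auto
    then show "t * M * Suc n \<in> {c \<in> {1..level * X}. t * M dvd c}"
      using pos by (simp add: mult_ac Suc_le_eq del: mult_Suc_right)
  next
    fix c assume "c \<in> {c \<in> {1..level * X}. t * M dvd c}"
    then obtain e where e: "c = t * M * e" "c \<ge> 1" by auto
    have e1: "e \<ge> 1" using e by (cases e) auto
    have ce: "c div (t * M) = e" "int c div int (t * M) = int e" "t * M dvd c" using pos e(1) by auto
    have "Suc (c div (t * M) - 1) = e" using ce e1 by simp
    then show "?C * (conj_char \<psi> (int (Suc (c div (t * M) - 1))) / of_nat (Suc (c div (t * M) - 1)) ^ Suc K) = W.row_const c"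
      unfolding row using ce e1 pos by (simp add: conj_char_def e(1) power_mult_distrib del: power_Suc)
  qed
  finally show ?thesis by (simp only: sum_distrib_left)
qed

text \<open>The sum of \<rho> over a period is 0 unless \<rho> is trivial, when it is
  \<open>totient M\<close>, that is, M times the product over its primes. The other factor is the
  limit of partial sums of the L-series.\<close>

lemma mock_coeff_0: "mock_eisenstein_coeff (K + 2) t \<psi> M \<rho> 0 = mass * W.limit_const"
proof -
  let ?D = "dirichlet_L (of_nat (Suc K)) (conj_char \<psi>)"
  let ?C = "fourier_const level K * of_nat (t * L) * (\<Sum>b\<in>{0..<int M}. \<rho> b) / of_nat (t * M) ^ Suc K"
  have lim: "W.limit_const = 2 * (?C * ?D)"
  proof (cases "\<rho> = trivial_char M")
    case True
    \<comment> \<open>For K = 0 the L-function is taken at 1. As \<rho> is trivial here, \<psi> is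
      not, and its series converges over periods.\<close>
    have nt: "Suc K \<ge> 2 \<or> conj_char \<psi> \<noteq> trivial_char L"
    proof (cases "K = 0")
      case K: True
      have "conj_char (trivial_char L) = trivial_char L" by (simp add: conj_char_def trivial_char_def fun_eq_iff)
      then show ?thesis using nontrivial[OF K] True conj_char_conj_char[of \<psi>] by metis
    qed auto
    have "(\<lambda>X. 2 * (?C * (\<Sum>n<X * L. conj_char \<psi> (int (Suc n)) / of_nat (Suc n) ^ Suc K))) \<longlonglongrightarrow> 2 * (?C * ?D)"
      using \<psi> nt by (intro tendsto_mult tendsto_const dirichlet_L_tendsto) auto
    then show ?thesis using W.limit_const_tendsto unfolding row_const_sum by (rule LIMSEQ_unique[rotated])
  next
    case False
    then have "?C = 0" using sum_nontrivial_character[OF \<rho>] by simp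
    then show ?thesis using W.limit_const_tendsto unfolding row_const_sum by (simp add: LIMSEQ_const_iff)
  qed
  show ?thesis
  proof (cases "\<rho> = trivial_char M")
    case True
    have tot: "(\<Sum>b\<in>{0..<int M}. \<rho> b) = of_nat M * (\<Prod>p\<in>prime_factors M. 1 - 1 / of_nat p)"
    proof -
      have "(\<Sum>b\<in>{0..<int M}. \<rho> b) = of_real (real (totient M))"
        unfolding True sum_trivial_character[OF M_pos] by simp
      also have "\<dots> = of_nat M * (\<Prod>p\<in>prime_factors M. 1 - 1 / of_nat p)"
        unfolding totient_formula2 by simp
      finally show ?thesis .
    qed
    have p: "2 powi (2 - int (K + 2)) = (1 / 2 ^ K :: complex)" by (simp add: power_int_minus divide_inverse)
    have "mock_eisenstein_coeff (K + 2) t \<psi> M \<rho> 0 = 1 / 2 ^ K * of_real pi * \<i> ^ K /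
       (of_nat (t * M) ^ Suc K * of_nat (Suc K)) * ?D * (\<Prod>p\<in>prime_factors M. 1 - 1 / of_nat p)"
      unfolding mock_eisenstein_coeff_def p using True by simp
    also have "\<dots> = mass * W.limit_const"
      unfolding lim tot fourier_const_eq mass_def using weights_nonzero
      by (simp add: divide_simps del: of_nat_Suc power_Suc)
    finally show ?thesis .
  next
    case False
    then have "(\<Sum>b\<in>{0..<int M}. \<rho> b) = 0" by (rule sum_nontrivial_character[OF \<rho>])
    then show ?thesis using False by (simp add: lim mock_eisenstein_coeff_def)
  qed
qed

definition shadow_coeff :: "nat \<Rightarrow> complex" where
  "shadow_coeff m = (- (2 * of_real pi * \<i> / of_nat M)) ^ (K + 2) *
     (primitive_gauss_sum M (conj_char \<rho>) / fact (Suc K)) * divisor_sum (K + 2) \<psi> M \<rho> m"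

lemma shadow_coeff_0: "shadow_coeff 0 = 0" and anti_coeff'_0: "anti_coeff' 0 = 0"
  by (simp_all add: shadow_coeff_def divisor_sum_def anti_coeff'_def divisor_conv_def)

lemma shadow_coeff_eq:
  assumes "m > 0"
  shows "shadow_coeff m = - ((4 * of_real pi * of_nat (t * m)) ^ Suc K / fact K) * anti_coeff' m"
proof -
  define V where "V = divisor_sum (K + 2) \<psi> M \<rho> m"
  define G where "G = primitive_gauss_sum M (conj_char \<rho>)"
  have "anti_coeff' m = 2 * mass * (cnj (fourier_const level K) * of_nat (t * L) / of_nat (t * M) ^ Suc K / of_nat m ^ Suc K * (V * G))"
    unfolding anti_coeff'_def anti_pair'_def V_def G_def
    using divisor_conv_twisted_sum[of M "conj_char \<rho>" m "cnj (fourier_const level K)" "t * M" K \<psi> "of_nat (t * L)"] \<rho> assms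
    by simp
  note coeff = this
  define s where "s = ((-1) ^ K * \<i> ^ K :: complex)"
  define P where "P = ((2 * of_real pi) ^ Suc K :: complex)"
  have mass: "2 * mass = 1 / of_nat (Suc K)" unfolding mass_def by (simp add: divide_simps del: of_nat_Suc)
  have fact: "(fact (Suc K) :: complex) = of_nat (Suc K) * fact K" by simp
  have pow: "(- (2 * of_real pi * \<i> / of_nat M)) ^ (K + 2) =
      - (2 * of_real pi * P * s / (of_nat M * of_nat M ^ Suc K) :: complex)"
  proof -
    have "(- X) ^ (K + 2) = (-1) ^ K * X ^ (K + 2)" for X :: complex by (cases "even K") simp_all
    moreover have "(2 * of_real pi * \<i> / of_nat M) ^ (K + 2) = ((2 * of_real pi) ^ (K + 2) * \<i> ^ (K + 2) / of_nat M ^ (K + 2) :: complex)"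
      by (simp only: power_mult_distrib power_divide)
    moreover have "\<i> ^ (K + 2) = - (\<i> ^ K)" by simp
    moreover have "X ^ (K + 2) = X * X ^ Suc K" for X :: complex by simp
    ultimately show ?thesis by (simp only: P_def s_def) (simp add: mult_ac)
  qed
  have pow4: "(4 * of_real pi * of_nat (t * m)) ^ Suc K = (2 * 2 ^ K * P * of_nat t ^ Suc K * of_nat m ^ Suc K :: complex)"
  proof -
    have "(4 * of_real pi * of_nat (t * m) :: complex) = 2 * (2 * of_real pi) * of_nat t * of_nat m" by simp
    then show ?thesis by (simp only: P_def power_mult_distrib power_Suc[of 2])
  qed
  \<comment> \<open>All powers and factorials are abstracted to nonzero variables, so that clearing
    denominators settles the identity.\<close>
  have alg: "- (2 * p * P * s / (mm * Q)) * (G / (n * F)) * V =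
      - ((2 * A * P * T * R) / F) * (1 / n * (p * s / A / (tt * l * mm) * (tt * l) / (T * Q) / R * (V * G)))"
    if "mm \<noteq> 0" "n \<noteq> 0" "F \<noteq> 0" "A \<noteq> 0" "tt \<noteq> 0" "l \<noteq> 0" "T \<noteq> 0" "Q \<noteq> 0" "R \<noteq> 0"
    for p mm Q n F A T R tt l :: complex
    using that by (simp add: divide_simps)
  have c: "cnj (fourier_const level K) = of_real pi * s / 2 ^ K / (of_nat t * of_nat L * of_nat M)"
    unfolding cnj_fourier_const s_def by (simp add: mult.assoc)
  show ?thesis
    unfolding shadow_coeff_def V_def[symmetric] G_def[symmetric] coeff mass fact pow pow4 c
    unfolding of_nat_mult power_mult_distrib
    using weights_nonzero assms by (intro alg) (auto simp del: of_nat_Suc)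
qed

text \<open>The row c = 0 carries the factor \<psi> 0, conjugated, which is 1 for L = 1 and 0
  otherwise; this is the case distinction of \<open>eisenstein_const\<close>. By parity d and - d
  contribute equally, and the resulting 2 cancels the one in \<open>mass\<close>.\<close>

lemma const_coeff_eq: "of_nat (Suc K) * cnj (mass * W.const_coeff) = eisenstein_const (K + 2) \<psi> \<rho>"
proof -
  have "W.const_coeff = cnj (\<psi> 0) * (\<Sum>\<^sub>\<infinity>d. \<rho> d / of_int d ^ (K + 2))"
    unfolding W.const_coeff_def by (subst infsum_cmult_right'[symmetric]) (simp add: weight_def)
  note cc = this
  have h: "of_nat (Suc K) * mass = 1 / 2" by (simp add: mass_def divide_simps del: of_nat_Suc)
  have "of_nat (Suc K) * cnj (mass * W.const_coeff) = (of_nat (Suc K) * mass) * cnj W.const_coeff"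
    by (simp only: complex_cnj_mult cnj_mass mult.assoc)
  also have "\<dots> = \<psi> 0 * (cnj (\<Sum>\<^sub>\<infinity>d. \<rho> d / of_int d ^ (K + 2)) / 2)"
    unfolding h cc complex_cnj_mult complex_cnj_cnj by simp
  finally have C: "of_nat (Suc K) * cnj (mass * W.const_coeff) = \<psi> 0 * (cnj (\<Sum>\<^sub>\<infinity>d. \<rho> d / of_int d ^ (K + 2)) / 2)" .
  show ?thesis
  proof (cases "L = 1")
    case True
    have \<psi>1: "\<psi> n = 1" for n
    proof -
      have "\<psi> n = \<psi> 1" by (rule dirichlet_character_cong[OF \<psi>]) (simp add: True)
      then show ?thesis using dirichlet_character_1[OF \<psi>] by simp
    qed
    then have triv: "\<psi> = trivial_char 1" by (auto simp: trivial_char_def)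
    let ?f = "\<lambda>d::int. \<rho> d / of_int d ^ (K + 2)"
    have s: "summable (\<lambda>n. norm (?f (int (Suc n))))"
      using dirichlet_L_sums(1)[OF \<rho>, of "K + 2"] by simp
    have neg: "?f (- int (Suc n)) = ?f (int (Suc n))" for n
    proof -
      have "\<rho> (- int (Suc n)) = (-1) ^ K * \<rho> (int (Suc n))"
        using character_uminus[OF \<rho>, of "int (Suc n)"] parity_\<psi>\<rho> \<psi>1 by simp
      moreover have "(of_int (- int (Suc n)) :: complex) ^ (K + 2) = (-1) ^ K * of_int (int (Suc n)) ^ (K + 2)"
        by (cases "even K") (simp_all del: of_nat_Suc)
      ultimately show ?thesis by (simp del: of_nat_Suc power_add)
    qed
    have z: "?f (int 0) = 0" by simp
    have s0: "summable (\<lambda>n. norm (?f (int n)))" using s by (subst (asm) summable_Suc_iff)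
    have "(?f has_sum ((\<Sum>n. ?f (int n)) + (\<Sum>n. ?f (- int (Suc n))))) UNIV"
      using s0 s unfolding neg[symmetric] by (rule has_sum_int_from_nat)
    also have "(\<Sum>n. ?f (int n)) = (\<Sum>n. ?f (int (Suc n)))"
      using suminf_split_head[OF summable_norm_cancel[OF s0]] z by simp
    finally have "(\<Sum>\<^sub>\<infinity>d. ?f d) = (\<Sum>n. ?f (int (Suc n))) + (\<Sum>n. ?f (- int (Suc n)))" by (rule infsumI)
    then have "(\<Sum>\<^sub>\<infinity>d. ?f d) = 2 * (\<Sum>n. ?f (int (Suc n)))" by (simp only: neg mult_2)
    moreover have "(\<lambda>n. cnj (?f (int (Suc n)))) sums dirichlet_L (of_nat (K + 2)) (conj_char \<rho>)"
      using dirichlet_L_sums(2)[of M "conj_char \<rho>" "K + 2"] \<rho> by (simp add: conj_char_def)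
    then have "(\<lambda>n. ?f (int (Suc n))) sums cnj (dirichlet_L (of_nat (K + 2)) (conj_char \<rho>))"
      using sums_cnj[of "\<lambda>n. ?f (int (Suc n))" "cnj (dirichlet_L (of_nat (K + 2)) (conj_char \<rho>))"] by simp
    ultimately have "(\<Sum>\<^sub>\<infinity>d. ?f d) = 2 * cnj (dirichlet_L (of_nat (K + 2)) (conj_char \<rho>))"
      by (simp only: sums_iff)
    then show ?thesis unfolding C by (simp add: eisenstein_const_def triv trivial_char_def)
  next
    case False
    then have "\<psi> 0 = 0" using L_pos by (simp add: dirichlet_character_eq_0_iff[OF \<psi>])
    then have "\<psi> \<noteq> trivial_char 1" by (auto simp: trivial_char_def)
    then show ?thesis unfolding C by (simp add: eisenstein_const_def \<open>\<psi> 0 = 0\<close>)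
  qed
qed

end

context character_pair
begin

section \<open>The harmonic Maass form\<close>

text \<open>Taking the closed form as the definition makes the analytic properties immediate;
  \<open>mock_form_eq\<close> brings in the lattice sum where the modular group acts.\<close>

definition mock_form :: "complex \<Rightarrow> complex" where
  "mock_form = harmonic_poly K (mass * W.const_coeff) (\<lambda>z. mass * W.holo_fun z) (\<lambda>j z. mass * W.anti_fun j z)"

lemma mock_form_eq: "Im z > 0 \<Longrightarrow> mock_form z = mass * lat_sum level K weight z"
  unfolding mock_form_def harmonic_poly_scale[OF cnj_mass] by (simp add: W.lat_sum_eq_harmonic_poly)

lemma scaled_derivs:
  assumes "z \<in> upper_half_plane"
  shows "((\<lambda>z. mass * W.holo_fun z) has_field_derivative mass * W.holo_fun' z) (at z)"
    and "((\<lambda>z. mass * W.anti_fun j z) has_field_derivative mass * W.anti_fun (Suc j) z) (at z)"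
  using assms by (auto intro!: DERIV_cmult W.holo_fun'_deriv W.anti_fun_deriv)

lemma scaled_holomorphic: "(\<lambda>z. mass * W.holo_fun' z) holomorphic_on upper_half_plane"
  by (intro holomorphic_on_mult holomorphic_on_const W.holo_fun'_holomorphic)

lemmas mock_form_props =
  xi_harmonic_poly[where P = "\<lambda>z. mass * W.holo_fun z" and P' = "\<lambda>z. mass * W.holo_fun' z" and H = "\<lambda>j z. mass * W.anti_fun j z",
    OF scaled_derivs(1) scaled_holomorphic scaled_derivs(2)]
  laplacian_harmonic_poly[where P = "\<lambda>z. mass * W.holo_fun z" and P' = "\<lambda>z. mass * W.holo_fun' z" and H = "\<lambda>j z. mass * W.anti_fun j z",
    OF scaled_derivs(1) scaled_holomorphic scaled_derivs(2)]
  real_analytic_harmonic_poly[where P = "\<lambda>z. mass * W.holo_fun z" and P' = "\<lambda>z. mass * W.holo_fun' z" and H = "\<lambda>j z. mass * W.anti_fun j z",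
    OF scaled_derivs(1) scaled_holomorphic scaled_derivs(2)]

lemma xi_mock_form:
  assumes "z \<in> upper_half_plane"
  shows "xi (- int K) mock_form z = of_nat (Suc K) * cnj (mass * W.const_coeff) +
      2 * \<i> * (- 2 * \<i>) ^ K / fact K * (mass * W.anti_fun (Suc K) z)"
    and "xi (- int K) mock_form z = mass * W.shadow z"
proof -
  show *: "xi (- int K) mock_form z = of_nat (Suc K) * cnj (mass * W.const_coeff) +
      2 * \<i> * (- 2 * \<i>) ^ K / fact K * (mass * W.anti_fun (Suc K) z)"
    unfolding mock_form_def by (rule mock_form_props(1)[OF _ _ assms])
  show "xi (- int K) mock_form z = mass * W.shadow z"
    unfolding * W.shadow_def complex_cnj_mult cnj_mass by (simp only: distrib_left mult_ac times_divide_eq_right)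
qed

lemma xi_mock_form_eq_eisenstein:
  assumes "z \<in> upper_half_plane"
  shows "xi (- int K) mock_form z = eisenstein (K + 2) \<psi> M \<rho> (of_nat t * z)"
proof -
  have z: "Im z > 0" using assms by (simp add: upper_half_plane_def)
  let ?c = "2 * \<i> * (- 2 * \<i>) ^ K / fact K :: complex"
  let ?C = "(- (2 * of_real pi * \<i> / of_nat M)) ^ (K + 2) * (primitive_gauss_sum M (conj_char \<rho>) / fact (Suc K))"
  have "((\<lambda>m. ?c * ((2 * of_real pi * \<i> * of_nat (t * m)) ^ Suc K * anti_coeff' m * unity_exp (of_nat m * (of_nat t * z)))) has_sum
     ?c * (mass * W.anti_fun (Suc K) z)) UNIV"
    by (intro has_sum_cmult_right anti_fun_has_sum z)
  moreover have "?c * ((2 * of_real pi * \<i> * of_nat (t * m)) ^ Suc K * anti_coeff' m * X) = shadow_coeff m * X" for m X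
  proof (cases "m = 0")
    case False
    have "2 * \<i> * (- 2 * \<i>) ^ K = - ((- 2 * \<i>) ^ Suc K)" by simp
    moreover have "(- 2 * \<i>) ^ Suc K * (2 * of_real pi * \<i> * of_nat (t * m)) ^ Suc K = (4 * of_real pi * of_nat (t * m)) ^ Suc K"
    proof -
      have "(- 2 * \<i>) * (2 * of_real pi * \<i> * of_nat (t * m)) = (4 * of_real pi * of_nat (t * m) :: complex)" by simp
      then show ?thesis by (simp only: power_mult_distrib[symmetric])
    qed
    moreover have "p = - q \<Longrightarrow> q * r = s \<Longrightarrow> p / F * (r * A * X) = - (s / F) * A * X" for p q r s F A :: complex
      by auto
    ultimately have "?c * ((2 * of_real pi * \<i> * of_nat (t * m)) ^ Suc K * anti_coeff' m * X) =
       - ((4 * of_real pi * of_nat (t * m)) ^ Suc K / fact K) * anti_coeff' m * X" by blast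
    then show ?thesis using False by (simp only: shadow_coeff_eq)
  qed (simp add: shadow_coeff_0)
  ultimately have "((\<lambda>m. shadow_coeff m * unity_exp (of_nat m * (of_nat t * z))) has_sum ?c * (mass * W.anti_fun (Suc K) z)) UNIV"
    by simp
  also have "?this \<longleftrightarrow> ((\<lambda>m. ?C * (divisor_sum (K + 2) \<psi> M \<rho> m * q_power (int m) (of_nat t * z))) has_sum
      ?c * (mass * W.anti_fun (Suc K) z)) {1..}"
    by (rule has_sum_cong_neutral)
       (auto simp: shadow_coeff_0 not_less_eq_eq, simp add: shadow_coeff_def q_power_def unity_exp_def mult_ac)
  finally have "?C * (\<Sum>\<^sub>\<infinity>m\<in>{1..}. divisor_sum (K + 2) \<psi> M \<rho> m * q_power (int m) (of_nat t * z)) =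
     ?c * (mass * W.anti_fun (Suc K) z)"
    unfolding infsum_cmult_right'[symmetric] by (rule infsumI)
  then show ?thesis
    unfolding xi_mock_form(1)[OF assms] const_coeff_eq eisenstein_def by simp
qed

text \<open>Here the level is used. If t L M divides c, the new first coordinate divided by t M is
  m' d modulo L. The second is n a modulo M, since M divides m. With a the inverse of d modulo M,
  the values at d are those of the conjugate of \<psi>\<rho>.\<close>

lemma weight_act:
  assumes det: "a * d - b * c = 1" and lv: "int level dvd c"
  shows "weight (lat_act d (- b) (- c) a v) = conj_char (product_char level \<psi> \<rho>) d * weight v"
proof -
  obtain m n where v: "v = (m, n)" by force
  let ?tM = "int (t * M)"
  obtain e where "c = int level * e" using lv by auto
  then have e: "c = ?tM * (int L * e)" by simp
  have "coprime d c"
  proof (rule coprimeI)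
    fix g assume "g dvd d" "g dvd c"
    then have "g dvd a * d - b * c" by simp
    then show "is_unit g" by (simp add: det)
  qed
  then have cop: "coprime d (int level)" using lv by (meson coprime_divisors dvd_refl)
  have cop': "coprime d ?tM" using cop by (simp add: coprime_commute)
  have act: "lat_act d (- b) (- c) a v = (m * d - n * c, n * a - m * b)" by (simp add: lat_act_def v)
  show ?thesis
  proof (cases "?tM dvd m")
    case True
    then obtain m' where m: "m = ?tM * m'" by auto
    have "m * d - n * c = ?tM * (m' * d - n * (int L * e))" by (simp add: m e algebra_simps)
    then have "weight (lat_act d (- b) (- c) a v) = cnj (\<psi> (m' * d - n * (int L * e))) * \<rho> (n * a - m * b)"
      unfolding act by (simp only: weight_scaled)
    moreover have "\<psi> (m' * d - n * (int L * e)) = \<psi> (m' * d)"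
    proof (rule dirichlet_character_cong[OF \<psi>])
      have "m' * d = (m' * d - n * (int L * e)) + int L * (n * e)" by (simp add: algebra_simps)
      then show "[m' * d - n * (int L * e) = m' * d] (mod int L)" by (metis cong_iff_lin)
    qed
    moreover have "\<rho> (n * a - m * b) = \<rho> (n * a)"
    proof (rule dirichlet_character_cong[OF \<rho>])
      have "n * a = (n * a - m * b) + int M * (int t * m' * b)" by (simp add: m algebra_simps)
      then show "[n * a - m * b = n * a] (mod int M)" by (metis cong_iff_lin)
    qed
    moreover have "\<rho> a = cnj (\<rho> d)"
    proof (rule dirichlet_character_inverse[OF \<rho>])
      have "a * d = 1 + int M * (int t * int L * e * b)" using det by (simp add: e algebra_simps)
      then have "1 = a * d + int M * (- (int t * int L * e * b))" by simp
      then show "[a * d = 1] (mod int M)" by (metis cong_iff_lin)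
    qed
    moreover have "conj_char (product_char level \<psi> \<rho>) d = cnj (\<psi> d) * cnj (\<rho> d)"
      using cop by (simp add: conj_char_def product_char_def)
    moreover have "weight v = cnj (\<psi> m') * \<rho> n" by (simp only: v m weight_scaled)
    ultimately show ?thesis
      by (simp add: dirichlet_character_mult[OF \<psi>] dirichlet_character_mult[OF \<rho>])
  next
    case False
    \<comment> \<open>As d is coprime to t M and t M divides c, the support of the weight is
      preserved.\<close>
    have "?tM dvd m * d - n * c \<longleftrightarrow> ?tM dvd m * d" unfolding e by (rule dvd_diff_left_iff) simp
    also have "\<dots> \<longleftrightarrow> ?tM dvd m" using cop' by (simp add: coprime_dvd_mult_left_iff coprime_commute)
    finally have "weight (lat_act d (- b) (- c) a v) = 0" using False unfolding act by (simp add: weight_def)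
    then show ?thesis using False by (simp add: v weight_def)
  qed
qed

lemma transforms_mock_form: "transforms (- int K) level (conj_char (product_char level \<psi> \<rho>)) mock_form"
  unfolding transforms_def
proof (intro allI impI ballI)
  fix a b c d :: int and z
  assume det: "a * d - b * c = 1" and lv: "int level dvd c" and "z \<in> upper_half_plane"
  then have z: "Im z > 0" by (simp add: upper_half_plane_def)
  let ?j = "of_int c * z + of_int d"
  have j: "?j \<noteq> 0" by (rule moebius_denominator_nonzero[OF det z])
  have "?j ^ K * lat_sum level K weight ((of_int a * z + of_int b) / ?j) =
      conj_char (product_char level \<psi> \<rho>) d * lat_sum level K weight z"
    unfolding W.lat_sum_moebius[OF det z] weight_act[OF det lv] by (rule lat_sum_scale)
  then have "mock_form ((of_int a * z + of_int b) / ?j) =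
     mass * (conj_char (product_char level \<psi> \<rho>) d * lat_sum level K weight z) / ?j ^ K"
    unfolding mock_form_eq[OF Im_moebius_pos[OF det z]] using j by (simp add: field_simps)
  then show "mock_form ((of_int a * z + of_int b) / ?j) =
      conj_char (product_char level \<psi> \<rho>) d * ?j powi (- int K) * mock_form z"
    unfolding mock_form_eq[OF z] by (simp add: power_int_minus divide_inverse mult_ac)
qed

lemma growth_mock_form: "linear_exponential_growth_at_cusps (- int K) mock_form"
  unfolding linear_exponential_growth_at_cusps_def
proof (intro allI impI)
  fix a b c d :: int
  assume det: "a * d - b * c = 1"
  then have det': "d * a - (- b) * (- c) = 1" by (simp add: algebra_simps)
  interpret V: lattice_weight level K "\<lambda>v. weight (lat_act d (- b) (- c) a v)"
    by (rule W.lattice_weight_act[OF det'])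
  obtain A where A: "\<And>z. Im z \<ge> 1 \<Longrightarrow> norm (lat_sum level K (\<lambda>v. weight (lat_act d (- b) (- c) a v)) z) \<le> A * exp (2 * Im z)"
    using V.lat_sum_growth by blast
  have "norm (slash (- int K) mock_form a b c d z) \<le> (norm mass * A) * exp (2 * Im z)" if "Im z \<ge> 1" for z
  proof -
    have z: "Im z > 0" using that by simp
    have "slash (- int K) mock_form a b c d z =
        mass * ((of_int c * z + of_int d) ^ K * lat_sum level K weight ((of_int a * z + of_int b) / (of_int c * z + of_int d)))"
      unfolding slash_def mock_form_eq[OF Im_moebius_pos[OF det z]] by simp
    also have "\<dots> = mass * lat_sum level K (\<lambda>v. weight (lat_act d (- b) (- c) a v)) z"
      unfolding W.lat_sum_moebius[OF det z] ..
    finally show ?thesis using mult_left_mono[OF A[OF that], of "norm mass"] by (simp add: norm_mult mult.assoc)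
  qed
  then show "\<exists>A B y\<^sub>0. 0 < y\<^sub>0 \<and> (\<forall>z. y\<^sub>0 \<le> Im z \<longrightarrow> norm (slash (- int K) mock_form a b c d z) \<le> A * exp (B * Im z))"
    by (intro exI[of _ "norm mass * A"] exI[of _ 2] exI[of _ 1]) simp
qed

lemma cusps_mock_form: "holomorphic_at_cusps (int (K + 2)) (xi (- int K) mock_form)"
  unfolding holomorphic_at_cusps_def
proof (intro allI impI)
  fix a b c d :: int
  assume det: "a * d - b * c = 1"
  then have det': "d * a - (- b) * (- c) = 1" by (simp add: algebra_simps)
  interpret V: lattice_weight level K "\<lambda>v. weight (lat_act d (- b) (- c) a v)"
    by (rule W.lattice_weight_act[OF det'])
  obtain u where u: "\<And>z. z \<in> upper_half_plane \<Longrightarrow>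
      ((\<lambda>n. u n * unity_exp (of_nat n * z / of_nat level)) has_sum V.shadow z) UNIV"
    using V.shadow_has_sum[of \<i>] by auto
  have "((\<lambda>n. mass * u n * exp (2 * of_real pi * \<i> * of_nat n * z / of_nat level)) has_sum
      slash (int (K + 2)) (xi (- int K) mock_form) a b c d z) UNIV" if z: "z \<in> upper_half_plane" for z
  proof -
    let ?j = "of_int c * z + of_int d"
    have Imz: "Im z > 0" using z by (simp add: upper_half_plane_def)
    have j: "?j \<noteq> 0" by (rule moebius_denominator_nonzero[OF det Imz])
    have "(of_int a * z + of_int b) / ?j \<in> upper_half_plane"
      using Im_moebius_pos[OF det Imz] by (simp add: upper_half_plane_def)
    then have "slash (int (K + 2)) (xi (- int K) mock_form) a b c d z =
        ?j powi (- int (K + 2)) * (mass * (?j ^ (K + 2) * V.shadow z))"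
      unfolding slash_def by (simp only: xi_mock_form(2) W.shadow_moebius[OF det z])
    also have "\<dots> = mass * V.shadow z"
    proof -
      have "inverse p * (q * (p * s)) = q * s" if "p \<noteq> 0" for p q s :: complex using that by simp
      from this[of "?j ^ (K + 2)"] show ?thesis
        unfolding power_int_minus power_int_of_nat using j by simp
    qed
    finally have eq: "slash (int (K + 2)) (xi (- int K) mock_form) a b c d z = mass * V.shadow z" .
    have "((\<lambda>n. mass * (u n * unity_exp (of_nat n * z / of_nat level))) has_sum mass * V.shadow z) UNIV"
      by (intro has_sum_cmult_right u z)
    then show ?thesis unfolding eq unity_exp_def by (simp only: mult.assoc times_divide_eq_right)
  qed
  then show "\<exists>h>0. \<exists>u. \<forall>z\<in>upper_half_plane.
      ((\<lambda>n. u n * exp (2 * of_real pi * \<i> * of_nat n * z / of_nat h)) has_sum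
        slash (int (K + 2)) (xi (- int K) mock_form) a b c d z) UNIV"
    using W.N by (intro exI[of _ level] conjI exI[of _ "\<lambda>n. mass * u n"]) auto
qed

lemma dirichlet_character_product: "dirichlet_character level (product_char level \<psi> \<rho>)"
  unfolding dirichlet_character_def
proof (intro conjI allI)
  show "level > 0" by (rule W.N)
  fix m n :: int
  have cop: "coprime n (int L)" "coprime n (int M)" if "coprime n (int level)" for n
    using that by simp_all
  show "product_char level \<psi> \<rho> (m * n) = product_char level \<psi> \<rho> m * product_char level \<psi> \<rho> n"
    by (simp add: product_char_def dirichlet_character_mult[OF \<psi>] dirichlet_character_mult[OF \<rho>] del: of_nat_mult)
  have "n + int level = n + int L * int (t * M)" by simp
  then have "\<psi> (n + int level) = \<psi> n" by (intro dirichlet_character_cong[OF \<psi>]) (simp only: cong_def mod_mult_self2)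
  moreover have "n + int level = n + int M * int (t * L)" by simp
  then have "\<rho> (n + int level) = \<rho> n" by (intro dirichlet_character_cong[OF \<rho>]) (simp only: cong_def mod_mult_self2)
  moreover have "coprime (n + int level) (int level) \<longleftrightarrow> coprime n (int level)"
    by (simp add: coprime_iff_gcd_eq_1 del: of_nat_mult)
  ultimately show "product_char level \<psi> \<rho> (n + int level) = product_char level \<psi> \<rho> n"
    by (simp only: product_char_def)
  show "product_char level \<psi> \<rho> n \<noteq> 0 \<longleftrightarrow> coprime n (int level)"
    using cop[of n] dirichlet_character_eq_0_iff[OF \<psi>] dirichlet_character_eq_0_iff[OF \<rho>]
    by (auto simp: product_char_def simp del: of_nat_mult)
qed

lemma harmonic_maass_form_mock_form:
  "harmonic_maass_form (- int K) level (conj_char (product_char level \<psi> \<rho>)) mock_form"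
  unfolding harmonic_maass_form_def
proof (intro conjI ballI)
  show "holomorphic_at_cusps (2 - - int K) (xi (- int K) mock_form)"
    using cusps_mock_form by (simp add: add.commute)
  show "real_analytic_on mock_form upper_half_plane"
    unfolding mock_form_def by (rule mock_form_props(3))
  show "laplacian (- int K) mock_form z = 0" if "z \<in> upper_half_plane" for z
    unfolding mock_form_def by (rule mock_form_props(2)[OF _ _ that])
qed (use W.N dirichlet_character_product transforms_mock_form growth_mock_form in auto)

lemma holo_coeff_has_sum:
  assumes "Im z > 0"
  shows "((\<lambda>n. mock_eisenstein_coeff (K + 2) t \<psi> M \<rho> n * q_power n z) has_sum mass * W.holo_fun z) {0..}"
proof -
  let ?a = "\<lambda>n. mock_eisenstein_coeff (K + 2) t \<psi> M \<rho> n"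
  have "((\<lambda>m. 2 * mass * (divisor_conv holo_pair' m * unity_exp (of_nat m * (of_nat t * z) / of_nat 1))) has_sum
      2 * mass * nome_series 1 (divisor_conv holo_pair') (of_nat t * z)) UNIV"
    using assms t_pos by (intro has_sum_cmult_right nome_series_has_sum poly_bounded_pairs) auto
  moreover have "((\<lambda>m. if m = 0 then mass * W.limit_const else 0) has_sum mass * W.limit_const) (UNIV :: nat set)"
    by (rule has_sum_finite_neutralI[of "{0}"]) auto
  ultimately have "((\<lambda>m. (if m = 0 then mass * W.limit_const else 0) +
       2 * mass * (divisor_conv holo_pair' m * unity_exp (of_nat m * (of_nat t * z) / of_nat 1))) has_sum
     mass * W.limit_const + 2 * mass * nome_series 1 (divisor_conv holo_pair') (of_nat t * z)) UNIV"
    by (rule has_sum_add[rotated])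
  moreover have "(if m = 0 then mass * W.limit_const else 0) +
       2 * mass * (divisor_conv holo_pair' m * unity_exp (of_nat m * (of_nat t * z) / of_nat 1)) =
     ?a (int (t * m)) * q_power (int (t * m)) z" for m
  proof (cases "m = 0")
    case True
    then show ?thesis using mock_coeff_0 by (simp add: divisor_conv_def q_power_def)
  next
    case False
    then have m: "m > 0" by simp
    show ?thesis unfolding mock_coeff_pos[OF m] using m by (simp add: q_power_def unity_exp_def mult_ac)
  qed
  moreover have "mass * W.limit_const + 2 * mass * nome_series 1 (divisor_conv holo_pair') (of_nat t * z) = mass * W.holo_fun z"
    unfolding W.holo_fun_def holo_series_eq[OF assms] by (simp add: algebra_simps)
  ultimately have "((\<lambda>m. ?a (int (t * m)) * q_power (int (t * m)) z) has_sum mass * W.holo_fun z) UNIV"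
    by (simp only:)
  then have "((\<lambda>n. ?a (int n) * q_power (int n) z) has_sum mass * W.holo_fun z) UNIV"
  proof (rule has_sum_multiples[where f = "\<lambda>n. ?a (int n) * q_power (int n) z"])
    fix n assume n: "\<not> t dvd n"
    then have "n \<noteq> 0" "\<not> int t dvd int n" by (auto intro!: Nat.gr0I)
    then show "?a (int n) * q_power (int n) z = 0" by (simp add: mock_eisenstein_coeff_def)
  qed (use t_pos in auto)
  also have "?this \<longleftrightarrow> ((\<lambda>n. ?a n * q_power n z) has_sum mass * W.holo_fun z) {0..}"
    by (rule has_sum_reindex_bij_witness[of _ nat int]) auto
  finally show ?thesis .
qed

definition shadow_fourier :: "nat \<Rightarrow> complex" where
  "shadow_fourier n = (if n = 0 then eisenstein_const (K + 2) \<psi> \<rho> else if t dvd n then shadow_coeff (n div t) else 0)"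

text \<open>The minus sign comes from writing F = P - Q. For positive m, the factor 1 / (4 pi
  n)^(K+1) in \<open>beta\<close> cancels the power that differentiation puts into the shadow
  coefficients.\<close>

lemma anti_part_has_sum:
  assumes "Im z > 0"
  shows "((\<lambda>n. cnj (shadow_fourier n) * of_real (beta (- int K) n (Im z)) * q_power (- int n) z) has_sum
     - (mass * W.const_coeff * of_real (Im z) ^ Suc K + antiholo_part K (\<lambda>j z. mass * W.anti_fun j z) z)) UNIV"
proof -
  let ?e = "\<lambda>m. unity_exp (of_nat m * (of_nat t * z))"
  let ?S = "\<lambda>m. (\<Sum>j\<le>K. (4 * pi * real (t * m) * Im z) ^ j / fact j)"
  let ?f = "\<lambda>n. cnj (shadow_fourier n) * of_real (beta (- int K) n (Im z)) * q_power (- int n) z"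
  have "((\<lambda>m. \<Sum>j\<le>K. (z - cnj z) ^ j / fact j * cnj ((2 * of_real pi * \<i> * of_nat (t * m)) ^ j * anti_coeff' m * ?e m)) has_sum
      antiholo_part K (\<lambda>j z. mass * W.anti_fun j z) z) UNIV"
    unfolding antiholo_part_def
    by (intro has_sum_sum has_sum_cmult_right has_sum_cnj_iff[THEN iffD2] anti_fun_has_sum assms) simp
  moreover have "(\<Sum>j\<le>K. (z - cnj z) ^ j / fact j * cnj ((2 * of_real pi * \<i> * of_nat (t * m)) ^ j * anti_coeff' m * ?e m)) =
      of_real (?S m) * cnj (anti_coeff' m * ?e m)" for m
  proof -
    have "(z - cnj z) ^ j / fact j * cnj ((2 * of_real pi * \<i> * of_nat (t * m)) ^ j * anti_coeff' m * ?e m) =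
      of_real ((4 * pi * real (t * m) * Im z) ^ j / fact j) * cnj (anti_coeff' m * ?e m)" for j
    proof -
      have "(z - cnj z) * cnj (2 * of_real pi * \<i> * of_nat (t * m)) = of_real (4 * pi * real (t * m) * Im z)"
        unfolding diff_cnj_eq by (simp add: complex_eq_iff)
      then have "(z - cnj z) ^ j * cnj ((2 * of_real pi * \<i> * of_nat (t * m)) ^ j) = of_real ((4 * pi * real (t * m) * Im z) ^ j)"
        by (simp only: complex_cnj_power power_mult_distrib[symmetric] of_real_power)
      then have "(z - cnj z) ^ j * cnj ((2 * of_real pi * \<i> * of_nat (t * m)) ^ j) / fact j = of_real ((4 * pi * real (t * m) * Im z) ^ j / fact j)"
        by (simp only: of_real_divide of_real_fact)
      then show ?thesis unfolding complex_cnj_mult mult.assoc[of "(2 * of_real pi * \<i> * of_nat (t * m)) ^ j"]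
        by (metis (no_types, lifting) complex_cnj_mult mult.assoc times_divide_eq_left)
    qed
    then show ?thesis by (simp only: of_real_sum sum_distrib_right)
  qed
  ultimately have "((\<lambda>m. - (of_real (?S m) * cnj (anti_coeff' m * ?e m))) has_sum
     - antiholo_part K (\<lambda>j z. mass * W.anti_fun j z) z) UNIV"
    by (intro has_sum_uminusI) simp
  moreover have "((\<lambda>m. if m = 0 then - (mass * W.const_coeff * of_real (Im z) ^ Suc K) else 0) has_sum
     - (mass * W.const_coeff * of_real (Im z) ^ Suc K)) (UNIV :: nat set)"
    by (rule has_sum_finite_neutralI[of "{0}"]) auto
  ultimately have "((\<lambda>m. (if m = 0 then - (mass * W.const_coeff * of_real (Im z) ^ Suc K) else 0) +
      - (of_real (?S m) * cnj (anti_coeff' m * ?e m))) has_sum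
    - (mass * W.const_coeff * of_real (Im z) ^ Suc K) + - antiholo_part K (\<lambda>j z. mass * W.anti_fun j z) z) UNIV"
    by (rule has_sum_add[rotated])
  moreover have "(if m = 0 then - (mass * W.const_coeff * of_real (Im z) ^ Suc K) else 0) +
      - (of_real (?S m) * cnj (anti_coeff' m * ?e m)) = ?f (t * m)" for m
  proof (cases "m = 0")
    case True
    \<comment> \<open>The denominator 1 - k is negative; with cnj (\<open>shadow_fourier\<close> 0)
      = (k - 1) \<open>mass\<close> \<open>const_coeff\<close> it accounts for the power of y in the
      completion.\<close>
    have b: "beta (- int K) 0 (Im z) = - (Im z ^ Suc K) / real (Suc K)"
    proof -
      have "1 - (- int K) = int (Suc K)" by simp
      moreover have "real_of_int (- int K - 1) = - real (Suc K)" by simp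
      moreover have "beta (- int K) 0 (Im z) = Im z powi (1 - (- int K)) / real_of_int (- int K - 1)"
        by (simp add: beta_def)
      ultimately have "beta (- int K) 0 (Im z) = Im z ^ Suc K / - real (Suc K)"
        by (simp only: power_int_of_nat)
      then show ?thesis by (simp only: minus_divide_left[symmetric] minus_divide_right[symmetric])
    qed
    have c: "cnj (shadow_fourier 0) = of_nat (Suc K) * (mass * W.const_coeff)"
      unfolding shadow_fourier_def const_coeff_eq[symmetric] by simp
    have "?f 0 = of_nat (Suc K) * (mass * W.const_coeff) * of_real (- (Im z ^ Suc K) / real (Suc K))"
      unfolding b c by (simp add: q_power_def)
    also have "\<dots> = - (mass * W.const_coeff * of_real (Im z) ^ Suc K)"
      by (simp add: field_simps del: of_nat_Suc)
    finally show ?thesis using True by (simp add: anti_coeff'_0)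
  next
    case False
    then have m: "m > 0" "t * m > 0" using t_pos by auto
    let ?Y = "4 * pi * real (t * m)"
    have "?f (t * m) = cnj (shadow_coeff m) * (of_real (beta (- int K) (t * m) (Im z)) * q_power (- int (t * m)) z)"
      using m t_pos by (simp add: shadow_fourier_def)
    also have "\<dots> = cnj (shadow_coeff m) * (of_real (fact K / ?Y ^ Suc K * ?S m) * cnj (unity_exp (of_nat (t * m) * z)))"
      by (simp only: beta_mult_q_power[OF m(2) assms])
    also have "cnj (shadow_coeff m) = - of_real (?Y ^ Suc K / fact K) * cnj (anti_coeff' m)"
      unfolding shadow_coeff_eq[OF m(1)] by simp
    also have "unity_exp (of_nat (t * m) * z) = ?e m" by (simp add: mult_ac)
    also have "- of_real (?Y ^ Suc K / fact K) * cnj (anti_coeff' m) * (of_real (fact K / ?Y ^ Suc K * ?S m) * cnj (?e m)) =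
       - (of_real ((?Y ^ Suc K / fact K) * (fact K / ?Y ^ Suc K * ?S m)) * cnj (anti_coeff' m * ?e m))"
      unfolding of_real_mult complex_cnj_mult by (simp only: mult_ac minus_mult_left[symmetric] mult_minus_right[symmetric])
    also have "(?Y ^ Suc K / fact K) * (fact K / ?Y ^ Suc K * ?S m) = ?S m"
    proof -
      have "?Y ^ Suc K \<noteq> 0" using m by simp
      then have "y / F * (F / y * x) = x" if "y = ?Y ^ Suc K" "F = fact K" for x y F :: real
        using that by (simp del: power_Suc)
      then show ?thesis by blast
    qed
    finally show ?thesis using False by simp
  qed
  ultimately have "((\<lambda>m. ?f (t * m)) has_sum - (mass * W.const_coeff * of_real (Im z) ^ Suc K + antiholo_part K (\<lambda>j z. mass * W.anti_fun j z) z)) UNIV"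
    by simp
  then show ?thesis
  proof (rule has_sum_multiples[where f = ?f])
    fix n assume "\<not> t dvd n"
    then have "shadow_fourier n = 0" by (auto simp: shadow_fourier_def)
    then show "?f n = 0" by simp
  qed (rule t_pos)
qed

lemma holomorphic_part_mock_form:
  "holomorphic_part (- int K) mock_form (mock_eisenstein_coeff (K + 2) t \<psi> M \<rho>)"
  unfolding holomorphic_part_def
proof (intro exI[of _ "0 :: int"] exI[of _ shadow_fourier] conjI allI impI ballI)
  show "mock_eisenstein_coeff (K + 2) t \<psi> M \<rho> n = 0" if "n < 0" for n
    using that by (simp add: mock_eisenstein_coeff_def)
  fix z assume "z \<in> upper_half_plane"
  then have z: "Im z > 0" by (simp add: upper_half_plane_def)
  have "mock_form z = mass * W.holo_fun z -
     - (mass * W.const_coeff * of_real (Im z) ^ Suc K + antiholo_part K (\<lambda>j z. mass * W.anti_fun j z) z)"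
    by (simp add: mock_form_def harmonic_poly_def)
  then show "\<exists>P Q. ((\<lambda>n. mock_eisenstein_coeff (K + 2) t \<psi> M \<rho> n * q_power n z) has_sum P) {0..} \<and>
     ((\<lambda>n. cnj (shadow_fourier n) * of_real (beta (- int K) n (Im z)) * q_power (- int n) z) has_sum Q) UNIV \<and>
     mock_form z = P - Q"
    using holo_coeff_has_sum[OF z] anti_part_has_sum[OF z] by blast
qed

theorem mock_modular_form_mock_eisenstein:
  "mock_modular_form (- int K) level (conj_char (product_char level \<psi> \<rho>))
     (mock_eisenstein_coeff (K + 2) t \<psi> M \<rho>) (\<lambda>z. eisenstein (K + 2) \<psi> M \<rho> (of_nat t * z))"
  unfolding mock_modular_form_def
  using harmonic_maass_form_mock_form holomorphic_part_mock_form xi_mock_form_eq_eisenstein by blast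

end

theorem theorem1p1:
  fixes k L M t :: nat and \<psi> \<rho> :: "int \<Rightarrow> complex"
  assumes "k \<ge> 2" and "L \<ge> 1" and "M \<ge> 1" and "t \<ge> 1"
    and "dirichlet_character L \<psi>" and "dirichlet_character M \<rho>"
    and "\<psi> (-1) * \<rho> (-1) = (-1) ^ k"
    and "k > 2 \<or> (k = 2 \<and> (\<psi>, \<rho>) \<noteq> (trivial_char L, trivial_char M))"
  shows "mock_modular_form (2 - int k) (t * L * M) (conj_char (product_char (t * L * M) \<psi> \<rho>))
           (mock_eisenstein_coeff k t \<psi> M \<rho>)
           (\<lambda>z. eisenstein k \<psi> M \<rho> (of_nat t * z))"
proof -
  obtain K where k: "k = K + 2" using assms(1) by (metis add.commute le_Suc_ex)
  interpret character_pair K L M t \<psi> \<rho>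
    using assms by unfold_locales (auto simp: k)
  have "2 - int k = - int K" by (simp add: k)
  then show ?thesis using mock_modular_form_mock_eisenstein by (simp only: k)
qed

end
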